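(* Let $P \subseteq \mathbb{R}^d$ be a closed rational convex polytope that is transverse to $\mathcal{H}[K_d]$, and let $s := \operatorname{aff} P$. For positive integers $t$ let $E^\circ(t)$ be the number of integer points $x \in \mathbb{Z}^d \cap tP^\circ$ whose coordinates are all distinct. Then $E^\circ$ is a quasipolynomial in $t$ with leading term $(\operatorname{vol} P)\, t^{\dim s}$. Furthermore, $(-1)^{\dim s} E^\circ(-t) = E(t)$, where $E(t)$ is the number of pairs $(x,\sigma)$ consisting of an integer point $x \in tP$ and a permutation $\sigma$ of $[d]$ that is compatible with $x$ and realizable in $P$. The constant term of the quasipolynomial $E$ equals the number of permutations of $[d]$ that are realizable in $P$.
   Context: $\mathcal{H}[K_d]$ is the arrangement of the hyperplanes $x_j = x_k$ ($1\le j<k\le d$) in $\mathbb{R}^d$; a flat is any nonempty intersection of some of these hyperplanes. $P$ is transverse to $\mathcal{H}[K_d]$ if $P$ is not contained in any hyperplane $x_j=x_k$ and every flat that intersects $P$ also intersects the relative interior $P^\circ$. A quasipolynomial is a function $Q(t)=\sum_{i=0}^{D} c_i(t)t^i$ whose coefficients $c_i$ are periodic functions of the integer $t$; $E^\circ(-t)$ means the value of this quasipolynomial at $-t$. $\operatorname{vol} P$ is the volume of $P$ normalized relative to the lattice $\mathbb{Z}^d \cap \operatorname{aff} P$ (a fundamental domain of that lattice has volume 1). A point $x$ with distinct coordinates realizes the permutation $\tau$ of $[d]=\{1,\dots,d\}$ if $x_{\tau 1}<x_{\tau 2}<\cdots<x_{\tau d}$; a permutation is realizable in a set $A$ if some $x\in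 A$ realizes it. A point $x\in\mathbb{R}^d$ and a permutation $\sigma$ are compatible if $x_{\sigma 1}\le x_{\sigma 2}\le\cdots\le x_{\sigma d}$.
   Formalization: Leading coefficient is vol P for those t where t·aff P contains an integer point and 0 otherwise (vol normalized by the integer vectors parallel to aff P); the constant term of E means its periodic coefficient c_0 evaluated at t = 0; P is taken nonempty. *)

theory Defs
  imports "HOL-Analysis.Analysis" "HOL-Combinatorics.Permutations"
begin

text \<open>
  The index set \<open>[d]\<close> is a type \<open>'n\<close> of sort \<open>{finite, wellorder}\<close>, that is, a nonempty finite
  linear order with \<open>d = CARD('n)\<close> elements; \<open>\<real>\<^sup>d\<close> is \<open>real ^ 'n\<close>.
\<close>

definition integer_points :: "(real ^ 'n) set" where
  "integer_points = {x. \<forall>i. x $ i \<in> \<int>}"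

definition rational_polytope :: "(real ^ 'n) set \<Rightarrow> bool" where
  "rational_polytope P \<longleftrightarrow>
     polytope P \<and> P \<noteq> {} \<and> (\<forall>v. v extreme_point_of P \<longrightarrow> (\<forall>i. v $ i \<in> \<rat>))"

definition complete_graph_arrangement :: "(real ^ 'n::{finite,wellorder}) set set" where
  "complete_graph_arrangement = {{x. x $ j = x $ k} | j k. j < k}"

text \<open>The subfamily \<open>\<B>\<close> may be empty, so the whole space is a flat.\<close>

definition flats :: "'a set set \<Rightarrow> 'a set set" where
  "flats \<H> = {\<Inter>\<B> | \<B>. \<B> \<subseteq> \<H> \<and> \<Inter>\<B> \<noteq> {}}"

definition transverse_to :: "'a::euclidean_space set \<Rightarrow> 'a set set \<Rightarrow> bool" where
  "transverse_to P \<H> \<longleftrightarrow>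
     (\<forall>H\<in>\<H>. \<not> P \<subseteq> H) \<and>
     (\<forall>F\<in>flats \<H>. F \<inter> P \<noteq> {} \<longrightarrow> F \<inter> rel_interior P \<noteq> {})"

definition lattice_basis :: "'a::real_vector set \<Rightarrow> 'a set \<Rightarrow> bool" where
  "lattice_basis L B \<longleftrightarrow>
     finite B \<and> independent B \<and> L = range (\<lambda>m :: 'a \<Rightarrow> int. \<Sum>b\<in>B. of_int (m b) *\<^sub>R b)"

definition direction_lattice :: "(real ^ 'n) set \<Rightarrow> (real ^ 'n) set" where
  "direction_lattice P =
     integer_points \<inter> {x - y | x y. x \<in> affine hull P \<and> y \<in> affine hull P}"

text \<open>
  Lattice-normalized volume: Lebesgue measure in the affine coordinates \<open>p + (\<Sum>b\<in>B. a b *\<^sub>R b)\<close>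
  of \<open>aff P\<close>, where \<open>B\<close> is a \<open>\<int>\<close>-basis of the integer vectors parallel to \<open>aff P\<close>, so that
  the fundamental parallelepiped spanned by \<open>B\<close> has volume 1.  The value depends neither on \<open>B\<close>
  (base changes are unimodular) nor on \<open>p\<close>.  If \<open>aff P\<close> contains an integer point, then
  \<open>\<int>\<^sup>d \<inter> aff P\<close> is a translate of \<open>direction_lattice P\<close>.
\<close>

definition lattice_volume :: "(real ^ 'n) set \<Rightarrow> real" where
  "lattice_volume P =
     (let B = (SOME B. lattice_basis (direction_lattice P) B);
          p = (SOME p. p \<in> affine hull P)
      in measure (\<Pi>\<^sub>M b\<in>B. lborel)
           {a \<in> B \<rightarrow>\<^sub>E UNIV. p + (\<Sum>b\<in>B. a b *\<^sub>R b) \<in> P})"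

definition quasipolynomial :: "nat \<Rightarrow> (nat \<Rightarrow> int \<Rightarrow> real) \<Rightarrow> (int \<Rightarrow> real) \<Rightarrow> bool" where
  "quasipolynomial D c Q \<longleftrightarrow>
     (\<forall>i\<le>D. \<exists>p>0. \<forall>t. c i (t + p) = c i t) \<and>
     (\<forall>t. Q t = (\<Sum>i\<le>D. c i t * of_int t ^ i))"

definition realizes :: "real ^ 'n::{finite,wellorder} \<Rightarrow> ('n::{finite,wellorder} \<Rightarrow> 'n) \<Rightarrow> bool" where
  "realizes x \<tau> \<longleftrightarrow> strict_mono (\<lambda>i. x $ \<tau> i)"

definition realizable_in :: "('n::{finite,wellorder} \<Rightarrow> 'n) \<Rightarrow> (real ^ 'n::{finite,wellorder}) set \<Rightarrow> bool" where
  "realizable_in \<tau> A \<longleftrightarrow> (\<exists>x\<in>A. realizes x \<tau>)"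

definition compatible :: "real ^ 'n::{finite,wellorder} \<Rightarrow> ('n::{finite,wellorder} \<Rightarrow> 'n) \<Rightarrow> bool" where
  "compatible x \<sigma> \<longleftrightarrow> mono (\<lambda>i. x $ \<sigma> i)"

definition open_count :: "(real ^ 'n) set \<Rightarrow> nat \<Rightarrow> nat" where
  "open_count P t =
     card {x \<in> integer_points \<inter> (\<lambda>y. real t *\<^sub>R y) ` rel_interior P. inj (\<lambda>i. x $ i)}"

definition closed_count :: "(real ^ 'n::{finite,wellorder}) set \<Rightarrow> nat \<Rightarrow> nat" where
  "closed_count P t =
     card {(x, \<sigma>). x \<in> integer_points \<inter> (\<lambda>y. real t *\<^sub>R y) ` P \<and>
                   \<sigma> permutes UNIV \<and> compatible x \<sigma> \<and> realizable_in \<sigma> P}"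

end

theory Submission
  imports Defs
begin

text \<open>
  The polytope is cut by the closed order regions into the pieces \<open>P\<^sub>\<tau>\<close>, one for each realizable
  permutation \<open>\<tau>\<close>; these are rational polytopes of full dimension in \<open>aff P\<close>, whose relative
  interiors contain exactly the points of \<open>P\<^sup>\<circ>\<close> that realize \<open>\<tau>\<close>.  Hence both counts are sums of
  Ehrhart functions of the pieces, and everything except the leading term follows from
  Ehrhart--Macdonald reciprocity for rational polytopes together with \<open>E(0) = 1\<close> for each piece.

  Reciprocity is proved on the cone over the polytope.  A generic linear objective on the
  generators yields a regular triangulation (its cells are the dual feasible bases of a linear
  program), and pushing points towards or away from a generic interior point \<open>q\<close> turns it into
  disjoint decompositions of the closed cone and of its interior into complementary half-open
  simplicial cones.  For those, reciprocity is the point reflection of the fundamental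
  parallelepiped combined with the upper negation of binomial coefficients.

  The leading coefficient is the limit of \<open>E\<^sup>\<circ>(t) / t\<^sup>D\<close> along a residue class, computed by
  dominated convergence in lattice coordinates of \<open>aff P\<close>.
\<close>

subsection \<open>Affine functions of a small parameter\<close>

text \<open>The cells of a triangulation overlap along faces, and correcting for this by
  inclusion-exclusion would turn reciprocity into an Euler characteristic computation. Half-open
  cones avoid it. One generic \<open>q\<close> serves both decompositions: since no coordinate of
  \<open>q\<close> vanishes in any cell, a facet removed for the closed cone is kept for the
  interior and vice versa, and the reflection of the parallelepiped makes exactly this exchange. A
  combination \<open>q\<close> with strictly positive weights on all generators lies in the relative
  interior, so "can still be moved away from \<open>q\<close>" describes interior points without a
  dimension hypothesis; all work takes place inside \<open>span V\<close>. The value 1 at 0 has the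
  same source: only the cell that contains \<open>q\<close> keeps the apex in the closed
  decomposition. The leading coefficient needs a separate argument for two reasons. Dilates of
  \<open>aff P\<close> may miss the lattice, so it is a periodic function and has to be found on
  each residue class; and a limit of counts gives the volume of \<open>P\<close> at once, whereas
  the cones would only give sums over points of parallelepipeds.\<close>

lemma eventually_affine_pos_iff:
  fixes \<alpha> \<beta> :: real
  assumes "\<beta> \<noteq> 0"
  shows "eventually (\<lambda>\<epsilon>. 0 < \<alpha> + \<epsilon> * \<beta> \<longleftrightarrow> 0 < \<alpha> \<or> \<alpha> = 0 \<and> 0 < \<beta>) (at_right 0)"
proof -
  have lim: "((\<lambda>\<epsilon>. \<alpha> + \<epsilon> * \<beta>) \<longlongrightarrow> \<alpha> + 0 * \<beta>) (at_right 0)"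
    by (intro tendsto_intros)
  have pos: "eventually (\<lambda>\<epsilon>::real. 0 < \<epsilon>) (at_right 0)"
    by (rule eventually_at_right_less)
  consider "\<alpha> > 0" | "\<alpha> < 0" | "\<alpha> = 0" by linarith
  then show ?thesis
  proof cases
    case 1
    then have "eventually (\<lambda>\<epsilon>. 0 < \<alpha> + \<epsilon> * \<beta>) (at_right 0)"
      using order_tendstoD(1)[OF lim, of 0] by simp
    then show ?thesis by eventually_elim (use 1 in auto)
  next
    case 2
    then have "eventually (\<lambda>\<epsilon>. \<alpha> + \<epsilon> * \<beta> < 0) (at_right 0)"
      using order_tendstoD(2)[OF lim, of 0] by simp
    then show ?thesis by eventually_elim (use 2 in auto)
  next
    case 3
    from pos show ?thesis by eventually_elim (use 3 in \<open>auto simp: zero_less_mult_iff\<close>)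
  qed
qed

lemma eventually_affine_nonzero:
  fixes \<alpha> \<beta> :: real
  assumes "\<alpha> \<noteq> 0 \<or> \<beta> \<noteq> 0"
  shows "eventually (\<lambda>\<epsilon>. \<alpha> + \<epsilon> * \<beta> \<noteq> 0) (at_right 0)"
proof (cases "\<beta> = 0")
  case False
  have "eventually (\<lambda>\<epsilon>. \<epsilon> \<noteq> - \<alpha> / \<beta>) (at_right 0)"
    by (rule eventually_neq_at_within)
  then show ?thesis by eventually_elim (use False in \<open>auto simp: field_simps\<close>)
qed (use assms in auto)

lemma eventually_notin_subspace:
  fixes x q :: "'a::real_vector"
  assumes T: "subspace T" and q: "q \<notin> T"
  shows "eventually (\<lambda>\<epsilon>. x + \<epsilon> *\<^sub>R q \<notin> T) (at_right 0)"
proof (cases "\<exists>\<delta>. x + \<delta> *\<^sub>R q \<in> T")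
  case True
  then obtain \<delta> where \<delta>: "x + \<delta> *\<^sub>R q \<in> T" by auto
  have "x + \<epsilon> *\<^sub>R q \<notin> T" if "\<epsilon> \<noteq> \<delta>" for \<epsilon>
  proof
    assume "x + \<epsilon> *\<^sub>R q \<in> T"
    then have "(x + \<epsilon> *\<^sub>R q) - (x + \<delta> *\<^sub>R q) \<in> T"
      using T \<delta> subspace_diff by blast
    then have "(\<epsilon> - \<delta>) *\<^sub>R q \<in> T" by (simp add: algebra_simps)
    then have "(1 / (\<epsilon> - \<delta>)) *\<^sub>R (\<epsilon> - \<delta>) *\<^sub>R q \<in> T" using T subspace_scale by blast
    then show False using q that by simp
  qed
  moreover have "eventually (\<lambda>\<epsilon>. \<epsilon> \<noteq> \<delta>) (at_right 0)"
    by (rule eventually_neq_at_within)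
  ultimately show ?thesis by (auto elim: eventually_mono)
qed auto

text \<open>Each form in \<open>F\<close> excludes one hyperplane of weights. The induction moves a
  weight that suits \<open>F\<close> slightly in the direction \<open>c\<close> itself: the value of
  \<open>c\<close> then grows at the positive rate \<open>\<Sum>v\<in>V. c v * c v\<close>, while
  positivity and the finitely many earlier conditions survive small changes.\<close>

lemma generic_positive_weights:
  fixes F :: "('v \<Rightarrow> real) set"
  assumes V: "finite V" and "finite F" and "\<forall>c\<in>F. \<exists>v\<in>V. c v \<noteq> 0"
  shows "\<exists>w. (\<forall>v\<in>V. 0 < w v) \<and> (\<forall>c\<in>F. (\<Sum>v\<in>V. c v * w v) \<noteq> (0::real))"
  using assms(2,3)
proof (induction F rule: finite_induct)
  case empty
  show ?case by (intro exI[of _ "\<lambda>_. 1"]) simp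
next
  case (insert c F)
  then obtain w where w: "\<forall>v\<in>V. 0 < w v" "\<forall>c\<in>F. (\<Sum>v\<in>V. c v * w v) \<noteq> 0" by auto
  obtain v0 where v0: "v0 \<in> V" "c v0 \<noteq> 0" using insert by auto
  have "0 < c v0 * c v0" using v0 by (auto simp: zero_less_mult_iff)
  also have "\<dots> \<le> (\<Sum>v\<in>V. c v * c v)"
    by (rule member_le_sum[OF v0(1)]) (use V in auto)
  finally have cc: "(\<Sum>v\<in>V. c v * c v) \<noteq> 0" by simp
  have split: "(\<Sum>v\<in>V. d v * (w v + \<epsilon> * c v)) = (\<Sum>v\<in>V. d v * w v) + \<epsilon> * (\<Sum>v\<in>V. d v * c v)" for d \<epsilon>
    by (simp add: sum.distrib sum_distrib_left algebra_simps)
  have "eventually (\<lambda>\<epsilon>. (\<Sum>v\<in>V. d v * (w v + \<epsilon> * c v)) \<noteq> 0) (at_right 0)" if "d \<in> insert c F" for d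
    unfolding split by (rule eventually_affine_nonzero) (use that w cc in auto)
  then have 1: "eventually (\<lambda>\<epsilon>. \<forall>d\<in>insert c F. (\<Sum>v\<in>V. d v * (w v + \<epsilon> * c v)) \<noteq> 0) (at_right 0)"
    using insert.hyps by (intro eventually_ball_finite) auto
  have "eventually (\<lambda>\<epsilon>. 0 < w v + \<epsilon> * c v) (at_right 0)" if "v \<in> V" for v
  proof (cases "c v = 0")
    case False
    show ?thesis using eventually_affine_pos_iff[OF False, of "w v"]
      by eventually_elim (use w that in auto)
  qed (use w that in auto)
  then have 2: "eventually (\<lambda>\<epsilon>. \<forall>v\<in>V. 0 < w v + \<epsilon> * c v) (at_right 0)"
    using V by (intro eventually_ball_finite) auto
  have "eventually (\<lambda>\<epsilon>. (\<forall>v\<in>V. 0 < w v + \<epsilon> * c v) \<and>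
      (\<forall>d\<in>insert c F. (\<Sum>v\<in>V. d v * (w v + \<epsilon> * c v)) \<noteq> 0)) (at_right (0::real))"
    using 1 2 by eventually_elim auto
  then obtain \<epsilon> where "\<forall>v\<in>V. 0 < w v + \<epsilon> * c v"
      "\<forall>d\<in>insert c F. (\<Sum>v\<in>V. d v * (w v + \<epsilon> * c v)) \<noteq> 0"
    using eventually_happens'[OF trivial_limit_at_right_real] by blast
  then show ?case by (intro exI[of _ "\<lambda>v. w v + \<epsilon> * c v"]) auto
qed

subsection \<open>Coordinates and cones\<close>

lemma representation_of_sum:
  fixes B :: "'a::real_vector set"
  assumes "independent B" "finite B" "b \<in> B"
  shows "representation B (\<Sum>b\<in>B. f b *\<^sub>R b) b = f b"
proof -
  let ?f = "\<lambda>b. if b \<in> B then f b else 0"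
  have "representation B (\<Sum>b\<in>B. f b *\<^sub>R b) = ?f"
  proof (rule real_vector.representation_eqI)
    show "finite {b. ?f b \<noteq> 0}"
      by (rule finite_subset[OF _ assms(2)]) (auto split: if_splits)
    show "(\<Sum>b | ?f b \<noteq> 0. ?f b *\<^sub>R b) = (\<Sum>b\<in>B. f b *\<^sub>R b)"
      by (rule sum.mono_neutral_cong_left[OF assms(2)]) (auto split: if_splits)
  qed (use assms in \<open>auto intro!: span_sum intro: span_scale span_base split: if_splits\<close>)
  then show ?thesis using assms by simp
qed

lemma sum_representation:
  fixes B :: "'a::real_vector set"
  assumes "independent B" "finite B" "x \<in> span B"
  shows "(\<Sum>b\<in>B. representation B x b *\<^sub>R b) = x"
  using real_vector.sum_representation_eq[OF assms(1,3,2)] by simp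

definition conic_span :: "'a::real_vector set \<Rightarrow> 'a set" where
  "conic_span V = {\<Sum>v\<in>V. c v *\<^sub>R v | c. \<forall>v\<in>V. 0 \<le> c v}"

lemma conic_span_subset_span: "conic_span V \<subseteq> span V"
  by (auto simp: conic_span_def intro!: span_sum intro: span_scale span_base)

lemma conic_span_add: "x \<in> conic_span V \<Longrightarrow> y \<in> conic_span V \<Longrightarrow> x + y \<in> conic_span V"
proof -
  assume "x \<in> conic_span V" "y \<in> conic_span V"
  then obtain c d where "x = (\<Sum>v\<in>V. c v *\<^sub>R v)" "\<forall>v\<in>V. 0 \<le> c v" "y = (\<Sum>v\<in>V. d v *\<^sub>R v)" "\<forall>v\<in>V. 0 \<le> d v"
    by (auto simp: conic_span_def)
  then show ?thesis unfolding conic_span_def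
    by (intro CollectI exI[of _ "\<lambda>v. c v + d v"]) (auto simp: algebra_simps sum.distrib)
qed

lemma conic_span_scale: "x \<in> conic_span V \<Longrightarrow> 0 \<le> r \<Longrightarrow> r *\<^sub>R x \<in> conic_span V"
proof -
  assume "x \<in> conic_span V" "0 \<le> r"
  then obtain c where "x = (\<Sum>v\<in>V. c v *\<^sub>R v)" "\<forall>v\<in>V. 0 \<le> c v"
    by (auto simp: conic_span_def)
  then show ?thesis unfolding conic_span_def using \<open>0 \<le> r\<close>
    by (intro CollectI exI[of _ "\<lambda>v. r * c v"]) (auto simp: scaleR_sum_right)
qed

lemma conic_span_mono: "finite V \<Longrightarrow> B \<subseteq> V \<Longrightarrow> conic_span B \<subseteq> conic_span V"
proof
  fix x assume V: "finite V" "B \<subseteq> V" "x \<in> conic_span B"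
  then obtain c where c: "x = (\<Sum>v\<in>B. c v *\<^sub>R v)" "\<forall>v\<in>B. 0 \<le> c v"
    by (auto simp: conic_span_def)
  have "x = (\<Sum>v\<in>V. (if v \<in> B then c v else 0) *\<^sub>R v)"
    unfolding c by (rule sum.mono_neutral_cong_left) (use V in auto)
  then show "x \<in> conic_span V" unfolding conic_span_def
    using c by (intro CollectI exI[of _ "\<lambda>v. if v \<in> B then c v else 0"]) auto
qed

lemma conic_spanI_representation:
  assumes "independent B" "finite B" "x \<in> span B" "\<And>b. b \<in> B \<Longrightarrow> 0 \<le> representation B x b"
  shows "x \<in> conic_span B"
  unfolding conic_span_def
  using assms sum_representation[OF assms(1-3)]
  by (intro CollectI exI[of _ "representation B x"]) auto

subsection \<open>Regular triangulations of cones\<close>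

text \<open>A linear relation among the generators has coefficient sum 0, so a nontrivial one has
  coefficients of both signs; the support reduction below relies on this. For the cone over a
  polytope, \<open>h\<close> is the added last coordinate.\<close>

locale height_cone =
  fixes V :: "'a::euclidean_space set" and h :: "'a \<Rightarrow> real"
  assumes finite_V: "finite V" and linear_h: "linear h" and h_V: "\<And>v. v \<in> V \<Longrightarrow> h v = 1"
begin

lemma h_sum: "B \<subseteq> V \<Longrightarrow> h (\<Sum>b\<in>B. c b *\<^sub>R b) = (\<Sum>b\<in>B. c b)"
proof -
  assume B: "B \<subseteq> V"
  have "h (\<Sum>b\<in>B. c b *\<^sub>R b) = (\<Sum>b\<in>B. c b * h b)"
    using linear_h by (simp add: linear_sum linear_cmul)
  also have "\<dots> = (\<Sum>b\<in>B. c b)"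
    by (rule sum.cong) (use B h_V in auto)
  finally show ?thesis .
qed

text \<open>Caratheodory's theorem for cones, with a cost that must not rise: a linear dependence,
  oriented so that the cost does not increase, has a negative entry, hence moving along it makes
  some coefficient vanish.\<close>

lemma independent_support:
  fixes c w :: "'a \<Rightarrow> real"
  assumes "\<forall>v\<in>V. 0 \<le> c v"
  shows "\<exists>c'. (\<forall>v\<in>V. 0 \<le> c' v) \<and> (\<Sum>v\<in>V. c' v *\<^sub>R v) = (\<Sum>v\<in>V. c v *\<^sub>R v) \<and>
    (\<Sum>v\<in>V. c' v * w v) \<le> (\<Sum>v\<in>V. c v * w v) \<and> independent {v\<in>V. c' v \<noteq> 0}"
  using assms
proof (induction "card {v\<in>V. c v \<noteq> 0}" arbitrary: c rule: less_induct)
  case less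
  let ?S = "{v\<in>V. c v \<noteq> 0}"
  show ?case
  proof (cases "independent ?S")
    case True
    then show ?thesis using less.prems by (intro exI[of _ c]) auto
  next
    case False
    have finS: "finite ?S" using finite_V by auto
    obtain u0 where u0: "\<exists>v\<in>?S. u0 v \<noteq> 0" "(\<Sum>v\<in>?S. u0 v *\<^sub>R v) = 0"
      using False real_vector.dependent_finite[OF finS] by auto
    define u1 where "u1 = (\<lambda>v. if v \<in> ?S then u0 v else 0)"
    define sg :: real where "sg = (if (\<Sum>v\<in>V. u1 v * w v) \<le> 0 then 1 else -1)"
    define u where "u = (\<lambda>v. sg * u1 v)"
    have u1_0: "(\<Sum>v\<in>V. u1 v *\<^sub>R v) = 0"
      unfolding u0(2)[symmetric] by (rule sum.mono_neutral_cong_right) (auto simp: u1_def finite_V)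
    have u_0: "(\<Sum>v\<in>V. u v *\<^sub>R v) = 0"
      using u1_0 unfolding u_def by (simp flip: scaleR_scaleR scaleR_sum_right)
    have uw: "(\<Sum>v\<in>V. u v * w v) \<le> 0"
      unfolding u_def sg_def by (auto simp: mult.assoc sum_negf)
    have u_nz: "\<exists>v\<in>?S. u v \<noteq> 0" using u0(1) by (auto simp: u_def u1_def sg_def)
    have u_out: "u v = 0" if "v \<notin> ?S" for v using that by (auto simp: u_def u1_def)
    have sum_u: "(\<Sum>v\<in>V. u v) = 0" using h_sum[of V u] u_0 linear_h by (simp add: linear_0)
    have "\<exists>v\<in>V. u v < 0"
    proof (rule ccontr)
      assume "\<not> ?thesis"
      then have "\<forall>v\<in>V. u v = 0" using sum_u finite_V by (subst (asm) sum_nonneg_eq_0_iff) auto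
      with u_nz show False by auto
    qed
    then have ne: "{v\<in>V. u v < 0} \<noteq> {}" by auto
    \<comment> \<open>Ratio test of the simplex method: the least ratio is the longest step along
      \<open>u\<close> that keeps all coefficients nonnegative, and it annihilates the coefficient
      of \<open>v0\<close>.\<close>
    define r where "r = (\<lambda>v. c v / (- u v))"
    obtain v0 where v0: "v0 \<in> {v\<in>V. u v < 0}" and "\<And>v. v \<in> {v\<in>V. u v < 0} \<Longrightarrow> r v0 \<le> r v"
      using arg_min_if_finite[of "{v\<in>V. u v < 0}" r] ne finite_V
      by (metis (no_types, lifting) finite_subset linorder_not_less mem_Collect_eq subsetI)
    then have min: "\<And>v. v \<in> V \<Longrightarrow> u v < 0 \<Longrightarrow> r v0 \<le> r v" by auto
    have r0: "r v0 \<ge> 0" using v0 less.prems by (auto simp: r_def divide_nonneg_nonpos)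
    define c' where "c' = (\<lambda>v. c v + r v0 * u v)"
    have c'_nn: "\<forall>v\<in>V. 0 \<le> c' v"
    proof
      fix v assume v: "v \<in> V"
      show "0 \<le> c' v"
      proof (cases "u v < 0")
        case True
        with min[OF v] have "r v0 \<le> c v / (- u v)" by (simp add: r_def)
        with True have "r v0 * (- u v) \<le> c v" by (subst (asm) pos_le_divide_eq) auto
        then show ?thesis by (simp add: c'_def)
      qed (use less.prems v r0 in \<open>auto simp: c'_def\<close>)
    qed
    have "c' v0 = 0" using v0 by (simp add: c'_def r_def)
    moreover have "v0 \<in> ?S" using u_out v0 by fastforce
    moreover have "c' v = 0" if "v \<in> V" "c v = 0" for v using u_out[of v] that by (simp add: c'_def)
    ultimately have "{v\<in>V. c' v \<noteq> 0} \<subset> ?S" by auto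
    then have "card {v\<in>V. c' v \<noteq> 0} < card ?S" using finS by (rule psubset_card_mono[rotated])
    from less.hyps[OF this c'_nn] obtain d where d: "\<forall>v\<in>V. 0 \<le> d v"
      "(\<Sum>v\<in>V. d v *\<^sub>R v) = (\<Sum>v\<in>V. c' v *\<^sub>R v)" "(\<Sum>v\<in>V. d v * w v) \<le> (\<Sum>v\<in>V. c' v * w v)"
      "independent {v\<in>V. d v \<noteq> 0}" by auto
    have "(\<Sum>v\<in>V. c' v *\<^sub>R v) = (\<Sum>v\<in>V. c v *\<^sub>R v) + r v0 *\<^sub>R (\<Sum>v\<in>V. u v *\<^sub>R v)"
      by (simp add: c'_def algebra_simps sum.distrib scaleR_sum_right)
    moreover have "(\<Sum>v\<in>V. c' v * w v) = (\<Sum>v\<in>V. c v * w v) + r v0 * (\<Sum>v\<in>V. u v * w v)"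
      by (simp add: c'_def algebra_simps sum.distrib sum_distrib_left)
    moreover have "r v0 * (\<Sum>v\<in>V. u v * w v) \<le> 0" using r0 uw by (rule mult_nonneg_nonpos)
    ultimately show ?thesis using d u_0 by (intro exI[of _ d]) auto
  qed
qed

text \<open>The walls of every simplicial cone formed from \<open>V\<close> lie in such proper
  subspaces; conversely, generators whose span contains a generic point span everything.\<close>

definition generic :: "'a \<Rightarrow> bool" where
  "generic x \<longleftrightarrow> (\<forall>S\<subseteq>V. span S \<noteq> span V \<longrightarrow> x \<notin> span S)"

text \<open>The sum is the value at \<open>v\<close> of the linear functional that agrees with
  \<open>w\<close> on \<open>B\<close>. The inequality says that no lifted generator
  \<open>(v, w v)\<close> lies below the graph of this functional, so the cells come from the lower
  faces of the lifted cone.\<close>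

definition cells :: "('a \<Rightarrow> real) \<Rightarrow> 'a set set" where
  "cells w = {B. B \<subseteq> V \<and> independent B \<and> span B = span V \<and>
     (\<forall>v\<in>V. (\<Sum>b\<in>B. representation B v b * w b) \<le> w v)}"

text \<open>The cell is the support of a cheapest basic representation of \<open>x\<close>.
  Genericity makes this support span, and a generator that violates the cell inequality could enter
  with a small weight and lower the cost.\<close>

lemma generic_in_cell:
  assumes x: "x \<in> conic_span V" and gen: "generic x"
  shows "\<exists>B\<in>cells w. \<forall>b\<in>B. 0 < representation B x b"
proof -
  define \<S> where "\<S> = {S. S \<subseteq> V \<and> independent S \<and> x \<in> span S \<and> (\<forall>b\<in>S. 0 < representation S x b)}"
  define val where "val = (\<lambda>S. \<Sum>b\<in>S. representation S x b * w b)"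
  have basic: "\<exists>S\<in>\<S>. val S \<le> (\<Sum>v\<in>V. c v * w v)"
    if c: "\<forall>v\<in>V. 0 \<le> c v" "x = (\<Sum>v\<in>V. c v *\<^sub>R v)" for c
  proof -
    from independent_support[OF c(1), of w] obtain c' where c': "\<forall>v\<in>V. 0 \<le> c' v"
      "(\<Sum>v\<in>V. c' v *\<^sub>R v) = x" "(\<Sum>v\<in>V. c' v * w v) \<le> (\<Sum>v\<in>V. c v * w v)" "independent {v\<in>V. c' v \<noteq> 0}"
      using c(2) by auto
    let ?S = "{v\<in>V. c' v \<noteq> 0}"
    have fin: "finite ?S" using finite_V by auto
    have xS: "x = (\<Sum>v\<in>?S. c' v *\<^sub>R v)"
      unfolding c'(2)[symmetric] by (rule sum.mono_neutral_right) (auto simp: finite_V)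
    have rep: "representation ?S x b = c' b" if "b \<in> ?S" for b
      unfolding xS using representation_of_sum[OF c'(4) fin that] .
    have "x \<in> span ?S" unfolding xS by (intro span_sum span_scale span_base)
    moreover have "\<forall>b\<in>?S. 0 < representation ?S x b" using rep c'(1) by force
    moreover have "val ?S = (\<Sum>v\<in>V. c' v * w v)"
      unfolding val_def by (rule sum.mono_neutral_cong_left) (auto simp: finite_V rep)
    ultimately show ?thesis unfolding \<S>_def using c' by (intro bexI[of _ ?S]) auto
  qed
  have finS: "finite \<S>" by (rule finite_subset[of _ "Pow V"]) (auto simp: \<S>_def finite_V)
  obtain c0 where c0: "\<forall>v\<in>V. 0 \<le> c0 v" "x = (\<Sum>v\<in>V. c0 v *\<^sub>R v)"
    using x by (auto simp: conic_span_def)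
  have "\<S> \<noteq> {}" using basic[OF c0] by auto
  then obtain S where S: "S \<in> \<S>" and min: "\<And>S'. S' \<in> \<S> \<Longrightarrow> val S \<le> val S'"
    using arg_min_if_finite[OF finS, of val] by (metis linorder_not_less)
  have S': "S \<subseteq> V" "independent S" "x \<in> span S" "\<forall>b\<in>S. 0 < representation S x b"
    using S by (auto simp: \<S>_def)
  have fin: "finite S" using S'(1) finite_V finite_subset by auto
  have spanS: "span S = span V" using gen S' by (auto simp: generic_def)
  have "(\<Sum>b\<in>S. representation S v b * w b) \<le> w v" if v: "v \<in> V" for v
  proof (rule ccontr)
    assume neg: "\<not> ?thesis"
    have "v \<in> span S" unfolding spanS using v by (rule span_base)
    note vrep = sum_representation[OF S'(2) fin this]
    have "eventually (\<lambda>\<epsilon>. 0 < representation S x b + \<epsilon> * (- representation S v b)) (at_right 0)" if "b \<in> S" for b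
    proof (cases "representation S v b = 0")
      case False
      then show ?thesis
        using eventually_affine_pos_iff[of "- representation S v b" "representation S x b"] S'(4) that
        by (auto elim!: eventually_mono)
    qed (use S'(4) that in auto)
    then have "eventually (\<lambda>\<epsilon>. \<forall>b\<in>S. 0 < representation S x b + \<epsilon> * (- representation S v b)) (at_right 0)"
      using fin by (intro eventually_ball_finite) auto
    then have "eventually (\<lambda>\<epsilon>. 0 < \<epsilon> \<and> (\<forall>b\<in>S. 0 < representation S x b + \<epsilon> * (- representation S v b))) (at_right 0)"
      using eventually_at_right_less by (rule eventually_conj[rotated])
    then obtain \<epsilon> where \<epsilon>: "0 < \<epsilon>" "\<forall>b\<in>S. 0 < representation S x b + \<epsilon> * (- representation S v b)"
      using eventually_happens'[OF trivial_limit_at_right_real] by blast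
    \<comment> \<open>\<open>v\<close> enters with weight \<epsilon> and the basis coordinates pay
      for it. Adding two terms instead of distinguishing cases also covers
      \<open>v \<in> S\<close>.\<close>
    define c where "c = (\<lambda>b. (if b \<in> S then representation S x b + \<epsilon> * (- representation S v b) else 0)
        + (if b = v then \<epsilon> else 0))"
    have "\<forall>b\<in>V. 0 \<le> c b" using \<epsilon> by (auto simp: c_def less_imp_le add_nonneg_nonneg)
    \<comment> \<open>Additivity in the scalar is what the vector sum and the cost sum have in
      common, so one computation serves both.\<close>
    have split: "(\<Sum>b\<in>V. f (c b) b) =
        (\<Sum>b\<in>S. f (representation S x b + \<epsilon> * (- representation S v b)) b) + f \<epsilon> v"
      if f: "\<And>r s b. f (r + s) b = f r b + f s b" for f :: "real \<Rightarrow> 'a \<Rightarrow> 'b::real_vector"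
    proof -
      have f0: "f 0 b = 0" for b using f[of 0 0 b] by simp
      have "(\<Sum>b\<in>V. f (c b) b) =
        (\<Sum>b\<in>V. f (if b \<in> S then representation S x b + \<epsilon> * (- representation S v b) else 0) b)
        + (\<Sum>b\<in>V. f (if b = v then \<epsilon> else 0) b)"
        unfolding c_def f by (simp add: sum.distrib)
      also have "(\<Sum>b\<in>V. f (if b = v then \<epsilon> else 0) b) = (\<Sum>b\<in>V. if b = v then f \<epsilon> v else 0)"
        by (rule sum.cong) (auto simp: f0)
      also have "\<dots> = f \<epsilon> v" using v finite_V by simp
      also have "(\<Sum>b\<in>V. f (if b \<in> S then representation S x b + \<epsilon> * (- representation S v b) else 0) b)
        = (\<Sum>b\<in>S. f (representation S x b + \<epsilon> * (- representation S v b)) b)"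
        by (rule sum.mono_neutral_cong_right) (use S'(1) finite_V in \<open>auto simp: f0\<close>)
      finally show ?thesis .
    qed
    have "(\<Sum>b\<in>V. c b *\<^sub>R b) = (\<Sum>b\<in>S. representation S x b *\<^sub>R b)
        - \<epsilon> *\<^sub>R (\<Sum>b\<in>S. representation S v b *\<^sub>R b) + \<epsilon> *\<^sub>R v"
      by (subst split) (auto simp: algebra_simps sum_subtractf scaleR_sum_right)
    then have "x = (\<Sum>b\<in>V. c b *\<^sub>R b)"
      using vrep sum_representation[OF S'(2) fin S'(3)] by simp
    from basic[OF \<open>\<forall>b\<in>V. 0 \<le> c b\<close> this] min have "val S \<le> (\<Sum>b\<in>V. c b * w b)" by force
    also have "(\<Sum>b\<in>V. c b * w b) = val S - \<epsilon> * (\<Sum>b\<in>S. representation S v b * w b) + \<epsilon> * w v"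
      unfolding val_def by (subst split) (auto simp: algebra_simps sum_subtractf sum_distrib_left)
    also have "\<dots> < val S" using neg \<epsilon>(1) by auto
    finally show False by simp
  qed
  then show ?thesis using S' spanS unfolding cells_def by (intro bexI[of _ S]) auto
qed


text \<open>Complementary slackness: the functionals of both cells lie below \<open>w\<close> on
  \<open>V\<close>, and each is exact on its own cell, so positive coordinates of \<open>x\<close>
  in both cells force equal values at \<open>x\<close>. Then each functional is exact on the other
  cell too, and for generic \<open>w\<close> it is exact only on its own generators.\<close>

lemma generic_cell_unique:
  assumes w: "\<And>B j. B \<subseteq> V \<Longrightarrow> independent B \<Longrightarrow> j \<in> V - B \<Longrightarrow> (\<Sum>b\<in>B. representation B j b * w b) \<noteq> w j"
    and B: "B \<in> cells w" and B': "B' \<in> cells w"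
    and x: "\<forall>b\<in>B. 0 < representation B x b" and x': "\<forall>b\<in>B'. 0 < representation B' x b"
    and xV: "x \<in> span V"
  shows "B = B'"
proof -
  define y where "y = (\<lambda>B v. \<Sum>b\<in>B. representation B v b * w b)"
  \<comment> \<open>Linearity of the functional of \<open>A\<close>, with \<open>x\<close> expanded
    in the other basis \<open>A'\<close>.\<close>
  have expand: "y A x = (\<Sum>b\<in>A'. representation A' x b * y A b)" if A: "A \<in> cells w" "A' \<in> cells w" for A A'
  proof -
    have A': "A' \<subseteq> V" "independent A'" "span A' = span V" "finite A'"
      "A \<subseteq> V" "independent A" "span A = span V" "finite A"
      using A finite_V finite_subset by (auto simp: cells_def)
    have "x = (\<Sum>b\<in>A'. representation A' x b *\<^sub>R b)"
      using sum_representation[of A' x] A' xV by simp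
    then have "representation A x = representation A (\<Sum>b\<in>A'. representation A' x b *\<^sub>R b)" by simp
    also have "\<dots> = (\<lambda>a. \<Sum>b\<in>A'. representation A (representation A' x b *\<^sub>R b) a)"
      using A' by (intro real_vector.representation_sum) (auto intro: span_scale span_base)
    also have "\<dots> = (\<lambda>a. \<Sum>b\<in>A'. representation A' x b * representation A b a)"
    proof (intro ext sum.cong refl)
      fix a b assume "b \<in> A'"
      then have "b \<in> span A" using A' by (auto intro: span_base)
      then show "representation A (representation A' x b *\<^sub>R b) a = representation A' x b * representation A b a"
        using real_vector.representation_scale[OF A'(6)] by simp
    qed
    finally have "representation A x = (\<lambda>a. \<Sum>b\<in>A'. representation A' x b * representation A b a)" .
    then have "y A x = (\<Sum>a\<in>A. \<Sum>b\<in>A'. representation A' x b * representation A b a * w a)"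
      by (simp add: y_def sum_distrib_right)
    also have "\<dots> = (\<Sum>b\<in>A'. \<Sum>a\<in>A. representation A' x b * representation A b a * w a)"
      by (rule sum.swap)
    also have "\<dots> = (\<Sum>b\<in>A'. representation A' x b * y A b)"
      by (simp add: y_def sum_distrib_left mult.assoc)
    finally show ?thesis .
  qed
  have le: "y A x \<le> y A' x"
    if A: "A \<in> cells w" "A' \<in> cells w" "\<forall>b\<in>A'. 0 < representation A' x b" for A A'
  proof -
    have "representation A' x b * y A b \<le> representation A' x b * w b" if "b \<in> A'" for b
      using A that by (intro mult_left_mono) (auto simp: y_def cells_def less_imp_le subset_iff)
    then show ?thesis unfolding expand[OF A(1,2)] by (simp add: y_def sum_mono)
  qed
  have sub: "A' \<subseteq> A"
    if A: "A \<in> cells w" "A' \<in> cells w" "\<forall>b\<in>A'. 0 < representation A' x b" and eq: "y A' x \<le> y A x" for A A'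
  proof
    fix b assume b: "b \<in> A'"
    have finA': "finite A'" using A(2) finite_V finite_subset by (auto simp: cells_def)
    have nn: "0 \<le> representation A' x b * (w b - y A b)" if "b \<in> A'" for b
      using A that by (intro mult_nonneg_nonneg) (auto simp: y_def cells_def less_imp_le subset_iff)
    have "(\<Sum>b\<in>A'. representation A' x b * (w b - y A b)) = y A' x - y A x"
      unfolding expand[OF A(1,2)] by (simp add: y_def right_diff_distrib sum_subtractf)
    with eq le[OF A] have "(\<Sum>b\<in>A'. representation A' x b * (w b - y A b)) = 0" by simp
    then have "representation A' x b * (w b - y A b) = 0"
      using sum_nonneg_eq_0_iff[OF finA' nn] b by auto
    then have "y A b = w b" using A(3) b by force
    then show "b \<in> A" using w[of A b] A(1,2) b by (auto simp: y_def cells_def)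
  qed
  show ?thesis using sub[OF B B' x'] sub[OF B' B x] le[OF B B' x'] le[OF B' B x] by auto
qed

lemma generic_perturbation:
  assumes "generic q"
  shows "eventually (\<lambda>\<epsilon>. generic (x + \<epsilon> *\<^sub>R q)) (at_right 0)"
proof -
  have "eventually (\<lambda>\<epsilon>. \<forall>S\<in>{S. S \<subseteq> V \<and> span S \<noteq> span V}. x + \<epsilon> *\<^sub>R q \<notin> span S) (at_right 0)"
    using assms finite_V
    by (intro eventually_ball_finite ballI eventually_notin_subspace) (auto simp: generic_def)
  then show ?thesis by eventually_elim (auto simp: generic_def)
qed

lemma generic_uminus: "generic q \<Longrightarrow> generic (- q)"
  unfolding generic_def by (metis add.inverse_inverse span_neg)

text \<open>A proper span of generators has a normal vector inside \<open>span V\<close>. It cannot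
  be orthogonal to all of \<open>V\<close>, so avoiding that span is one nontrivial linear condition
  on the weights.\<close>

lemma exists_generic_positive:
  "\<exists>c. (\<forall>v\<in>V. 0 < c v) \<and> generic (\<Sum>v\<in>V. c v *\<^sub>R v)"
proof -
  define \<S> where "\<S> = {S. S \<subseteq> V \<and> span S \<noteq> span V}"
  have "\<exists>f. (\<forall>y\<in>span S. inner f y = 0) \<and> (\<exists>v\<in>V. inner f v \<noteq> 0)" if "S \<in> \<S>" for S
  proof -
    have "span S \<subset> span V" using that by (auto simp: \<S>_def intro: span_mono psubsetI dest: subsetD[OF span_mono])
    then obtain f where f: "f \<noteq> 0" "f \<in> span V" "\<And>y. y \<in> span S \<Longrightarrow> orthogonal f y"
      using orthogonal_to_subspace_exists_gen by metis
    have "\<exists>v\<in>V. inner f v \<noteq> 0"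
    proof (rule ccontr)
      assume "\<not> ?thesis"
      then have "orthogonal f f" using orthogonal_to_span[OF f(2), of f] by (simp add: orthogonal_def)
      with f(1) show False by (simp add: orthogonal_def)
    qed
    then show ?thesis using f(3) by (auto simp: orthogonal_def)
  qed
  then obtain f where f: "\<And>S y. S \<in> \<S> \<Longrightarrow> y \<in> span S \<Longrightarrow> inner (f S) y = 0"
    "\<And>S. S \<in> \<S> \<Longrightarrow> \<exists>v\<in>V. inner (f S) v \<noteq> 0" by metis
  have "finite \<S>" by (rule finite_subset[of _ "Pow V"]) (auto simp: \<S>_def finite_V)
  then obtain c where c: "\<forall>v\<in>V. 0 < c v" "\<And>S. S \<in> \<S> \<Longrightarrow> (\<Sum>v\<in>V. inner (f S) v * c v) \<noteq> 0"
    using generic_positive_weights[OF finite_V, of "(\<lambda>S v. inner (f S) v) ` \<S>"] f(2) by auto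
  have "(\<Sum>v\<in>V. c v *\<^sub>R v) \<notin> span S" if "S \<in> \<S>" for S
    using f(1)[OF that, of "\<Sum>v\<in>V. c v *\<^sub>R v"] c(2)[OF that] by (auto simp: inner_sum_right mult.commute)
  then show ?thesis using c(1) by (auto simp: generic_def \<S>_def)
qed

lemma exists_generic_weight:
  "\<exists>w. \<forall>B j. B \<subseteq> V \<longrightarrow> independent B \<longrightarrow> j \<in> V - B \<longrightarrow> (\<Sum>b\<in>B. representation B j b * w b) \<noteq> w j"
proof -
  \<comment> \<open>Coefficients, as a form in \<open>w\<close>, of the gap between the functional
    of \<open>B\<close> at \<open>j\<close> and \<open>w j\<close>. The entry at \<open>j\<close> is
    -1 because \<open>j\<close> lies outside \<open>B\<close>.\<close>
  define g where "g = (\<lambda>(B,j::'a) v. (if v \<in> B then representation B j v else 0) - (if v = j then 1 else (0::real)))"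
  define I where "I = {(B,j). B \<subseteq> V \<and> j \<in> V - B}"
  have finI: "finite I" by (rule finite_subset[of _ "Pow V \<times> V"]) (auto simp: I_def finite_V)
  have "\<forall>c\<in>g ` I. \<exists>v\<in>V. c v \<noteq> 0" by (force simp: I_def g_def)
  with generic_positive_weights[OF finite_V finite_imageI[OF finI]] obtain w where
    w: "\<forall>c\<in>g ` I. (\<Sum>v\<in>V. c v * w v) \<noteq> 0" by blast
  have "(\<Sum>b\<in>B. representation B j b * w b) \<noteq> w j" if B: "B \<subseteq> V" "j \<in> V - B" for B j
  proof -
    have "(\<Sum>v\<in>V. g (B,j) v * w v) = (\<Sum>v\<in>V. (if v \<in> B then representation B j v else 0) * w v)
        - (\<Sum>v\<in>V. (if v = j then 1 else 0) * w v)"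
      by (simp add: g_def left_diff_distrib sum_subtractf)
    also have "(\<Sum>v\<in>V. (if v \<in> B then representation B j v else 0) * w v) = (\<Sum>b\<in>B. representation B j b * w b)"
      by (rule sum.mono_neutral_cong_right) (use B finite_V in auto)
    also have "(\<Sum>v\<in>V. (if v = j then 1 else 0) * w v) = (\<Sum>v\<in>V. if v = j then w v else 0)"
      by (rule sum.cong) auto
    also have "\<dots> = w j" using B finite_V by simp
    finally show ?thesis using w B by (auto simp: I_def)
  qed
  then show ?thesis by blast
qed

end

text \<open>\<open>A\<close> lists the removed facets, each by the generator opposite to it.\<close>

definition half_open_cone :: "'a::real_vector set \<Rightarrow> 'a set \<Rightarrow> 'a set" where
  "half_open_cone B A = {x \<in> span B. \<forall>b\<in>B. 0 \<le> representation B x b \<and> (b \<in> A \<longrightarrow> 0 < representation B x b)}"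

context height_cone
begin

text \<open>
  A point of the cone is pushed a little towards (or away from) the generic interior point \<open>q\<close>;
  it then lies in the interior of exactly one cell, and the signs of the coordinates of \<open>q\<close>
  decide which facets of the cell are kept.
\<close>

lemma half_open_decomposition:
  obtains \<B> q where "\<And>B. B \<in> \<B> \<Longrightarrow> B \<subseteq> V \<and> independent B \<and> span B = span V"
    and "\<And>B b. B \<in> \<B> \<Longrightarrow> b \<in> B \<Longrightarrow> representation B q b \<noteq> 0"
    and "\<exists>c. (\<forall>v\<in>V. 0 < c v) \<and> q = (\<Sum>v\<in>V. c v *\<^sub>R v)"
    and "\<And>x. x \<in> conic_span V \<Longrightarrow> \<exists>!B. B \<in> \<B> \<and> x \<in> half_open_cone B {b\<in>B. representation B q b < 0}"
    and "\<And>B. B \<in> \<B> \<Longrightarrow> half_open_cone B {b\<in>B. representation B q b < 0} \<subseteq> conic_span V"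
    and "\<And>x \<epsilon>. 0 < \<epsilon> \<Longrightarrow> x - \<epsilon> *\<^sub>R q \<in> conic_span V \<Longrightarrow>
       \<exists>!B. B \<in> \<B> \<and> x \<in> half_open_cone B {b\<in>B. 0 < representation B q b}"
    and "\<And>B x. B \<in> \<B> \<Longrightarrow> x \<in> half_open_cone B {b\<in>B. 0 < representation B q b} \<Longrightarrow>
       \<exists>\<epsilon>>0. x - \<epsilon> *\<^sub>R q \<in> conic_span V"
    and "\<exists>!B. B \<in> \<B> \<and> (\<forall>b\<in>B. 0 < representation B q b)"
proof -
  obtain w where w: "\<And>B j. B \<subseteq> V \<Longrightarrow> independent B \<Longrightarrow> j \<in> V - B \<Longrightarrow> (\<Sum>b\<in>B. representation B j b * w b) \<noteq> w j"
    using exists_generic_weight by blast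
  obtain c where c: "\<forall>v\<in>V. 0 < c v" "generic (\<Sum>v\<in>V. c v *\<^sub>R v)"
    using exists_generic_positive by blast
  define q where "q = (\<Sum>v\<in>V. c v *\<^sub>R v)"
  have gq: "generic q" using c by (simp add: q_def)
  have qC: "q \<in> conic_span V" using c(1) unfolding q_def conic_span_def by (auto intro: less_imp_le)
  have qV: "q \<in> span V" using qC conic_span_subset_span by blast
  let ?\<B> = "cells w"
  have cell: "B \<subseteq> V" "independent B" "span B = span V" "finite B" if "B \<in> ?\<B>" for B
    using that finite_V finite_subset by (auto simp: cells_def)
  have finB: "finite ?\<B>" by (rule finite_subset[of _ "Pow V"]) (auto simp: cells_def finite_V)
  have unique: "\<exists>!B. B \<in> ?\<B> \<and> (\<forall>b\<in>B. 0 < representation B x b)" if x: "x \<in> conic_span V" "generic x" for x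
  proof (rule ex_ex1I)
    show "\<exists>B. B \<in> ?\<B> \<and> (\<forall>b\<in>B. 0 < representation B x b)"
      using generic_in_cell[OF x, of w] by auto
    show "B = B'" if "B \<in> ?\<B> \<and> (\<forall>b\<in>B. 0 < representation B x b)"
        "B' \<in> ?\<B> \<and> (\<forall>b\<in>B'. 0 < representation B' x b)" for B B'
      using generic_cell_unique[OF w, of B B' x] that x(1) conic_span_subset_span by blast
  qed
  have qnz: "representation B q b \<noteq> 0" if B: "B \<in> ?\<B>" "b \<in> B" for B b
  proof
    assume z: "representation B q b = 0"
    have "q = (\<Sum>b\<in>B. representation B q b *\<^sub>R b)"
      using sum_representation[of B q] cell[OF B(1)] qV by simp
    also have "\<dots> = (\<Sum>b\<in>B - {b}. representation B q b *\<^sub>R b)"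
      using z B cell(4)[OF B(1)] by (simp add: sum.remove[of B b])
    also have "\<dots> \<in> span (B - {b})" by (intro span_sum span_scale span_base)
    finally have "q \<in> span (B - {b})" .
    moreover have "span (B - {b}) \<noteq> span V"
    proof
      assume "span (B - {b}) = span V"
      then have "b \<in> span (B - {b})" using B cell[OF B(1)] by (auto intro: span_base)
      then show False using B cell(2)[OF B(1)] by (auto simp: dependent_def)
    qed
    moreover have "B - {b} \<subseteq> V" using cell(1)[OF B(1)] by auto
    ultimately show False using gq unfolding generic_def by blast
  qed
  \<comment> \<open>The sign after a small push is lexicographic: the coordinate of \<open>x\<close>
    decides, and where it vanishes the coordinate of \<open>r *\<^sub>R q\<close> does. Finitely
    many cells and generators allow one \<epsilon> for all.\<close>
  have signs: "eventually (\<lambda>\<epsilon>. \<forall>B\<in>?\<B>. \<forall>b\<in>B. 0 < representation B (x + \<epsilon> *\<^sub>R (r *\<^sub>R q)) b \<longleftrightarrow>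
      0 < representation B x b \<or> representation B x b = 0 \<and> 0 < r * representation B q b) (at_right 0)"
    if x: "x \<in> span V" and r: "r \<noteq> 0" for x and r :: real
  proof (intro eventually_ball_finite finB ballI)
    fix B assume B: "B \<in> ?\<B>"
    show "finite B" using cell[OF B] by simp
    fix b assume b: "b \<in> B"
    have "representation B (x + \<epsilon> *\<^sub>R (r *\<^sub>R q)) b = representation B x b + \<epsilon> * (r * representation B q b)" for \<epsilon>
      using cell[OF B] x qV
      by (simp add: real_vector.representation_add real_vector.representation_scale span_scale)
    then show "eventually (\<lambda>\<epsilon>. 0 < representation B (x + \<epsilon> *\<^sub>R (r *\<^sub>R q)) b \<longleftrightarrow>
      0 < representation B x b \<or> representation B x b = 0 \<and> 0 < r * representation B q b) (at_right 0)"
      using eventually_affine_pos_iff[of "r * representation B q b" "representation B x b"] r qnz[OF B b]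
      by simp
  qed
  have half: "x \<in> half_open_cone B {b\<in>B. r * representation B q b < 0} \<longleftrightarrow>
      (\<forall>b\<in>B. 0 < representation B x b \<or> representation B x b = 0 \<and> 0 < r * representation B q b)"
    if "B \<in> ?\<B>" "x \<in> span V" "r \<noteq> 0" for B x and r :: real
  proof -
    have "r * representation B q b < 0 \<longleftrightarrow> \<not> 0 < r * representation B q b" if "b \<in> B" for b
      using qnz[OF \<open>B \<in> ?\<B>\<close> that] \<open>r \<noteq> 0\<close> by (simp add: not_less order_le_less)
    then show ?thesis using that cell(3)[OF that(1)] unfolding half_open_cone_def
      by (auto simp: order_le_less)
  qed
  \<comment> \<open>\<open>r = 1\<close> serves the closed cone, \<open>r = -1\<close> its interior.
    By \<open>signs\<close> and \<open>half\<close>, the cells having the pushed point in their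
    interior are exactly those whose half-open cone contains \<open>x\<close>, so uniqueness is
    inherited from generic points.\<close>
  have pushed: "\<exists>!B. B \<in> ?\<B> \<and> x \<in> half_open_cone B {b\<in>B. r * representation B q b < 0}"
    if x: "eventually (\<lambda>\<epsilon>. x + \<epsilon> *\<^sub>R (r *\<^sub>R q) \<in> conic_span V) (at_right 0)" "x \<in> span V" and r: "r = 1 \<or> r = -1"
    for x and r :: real
  proof -
    have "generic (r *\<^sub>R q)" using gq generic_uminus r by auto
    then have gen: "eventually (\<lambda>\<epsilon>. generic (x + \<epsilon> *\<^sub>R (r *\<^sub>R q))) (at_right 0)"
      by (rule generic_perturbation)
    have "r \<noteq> 0" using r by auto
    from gen x(1) signs[OF x(2) this]
    have "eventually (\<lambda>\<epsilon>. generic (x + \<epsilon> *\<^sub>R (r *\<^sub>R q)) \<and> x + \<epsilon> *\<^sub>R (r *\<^sub>R q) \<in> conic_span V \<and>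
      (\<forall>B\<in>?\<B>. \<forall>b\<in>B. 0 < representation B (x + \<epsilon> *\<^sub>R (r *\<^sub>R q)) b \<longleftrightarrow>
      0 < representation B x b \<or> representation B x b = 0 \<and> 0 < r * representation B q b)) (at_right 0)"
      by eventually_elim blast
    then obtain \<epsilon> where \<epsilon>: "generic (x + \<epsilon> *\<^sub>R (r *\<^sub>R q))" "x + \<epsilon> *\<^sub>R (r *\<^sub>R q) \<in> conic_span V"
      "\<forall>B\<in>?\<B>. \<forall>b\<in>B. 0 < representation B (x + \<epsilon> *\<^sub>R (r *\<^sub>R q)) b \<longleftrightarrow>
      0 < representation B x b \<or> representation B x b = 0 \<and> 0 < r * representation B q b"
      using eventually_happens'[OF trivial_limit_at_right_real] by blast
    have "(B \<in> ?\<B> \<and> x \<in> half_open_cone B {b\<in>B. r * representation B q b < 0}) \<longleftrightarrow>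
      (B \<in> ?\<B> \<and> (\<forall>b\<in>B. 0 < representation B (x + \<epsilon> *\<^sub>R (r *\<^sub>R q)) b))" for B
      using half[of B x r] x(2) r \<epsilon>(3) by auto
    then show ?thesis using unique[OF \<epsilon>(2,1)] by simp
  qed
  show ?thesis
  proof (rule that[of ?\<B> q])
    show "\<exists>c. (\<forall>v\<in>V. 0 < c v) \<and> q = (\<Sum>v\<in>V. c v *\<^sub>R v)" using c(1) q_def by auto
    \<comment> \<open>The cell around \<open>q\<close> is the one from which the closed
      decomposition removes nothing; it accounts for the value at 0.\<close>
    show "\<exists>!B. B \<in> ?\<B> \<and> (\<forall>b\<in>B. 0 < representation B q b)" using unique[OF qC gq] .
  next
    fix x assume x: "x \<in> conic_span V"
    have "eventually (\<lambda>\<epsilon>. x + \<epsilon> *\<^sub>R (1 *\<^sub>R q) \<in> conic_span V) (at_right 0)"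
      using eventually_at_right_less[of "0::real"]
      by eventually_elim (auto intro!: conic_span_add conic_span_scale x qC)
    from pushed[OF this] show "\<exists>!B. B \<in> ?\<B> \<and> x \<in> half_open_cone B {b\<in>B. representation B q b < 0}"
      using x conic_span_subset_span by auto
  next
    fix B assume B: "B \<in> ?\<B>"
    show "half_open_cone B {b\<in>B. representation B q b < 0} \<subseteq> conic_span V"
    proof
      fix x assume "x \<in> half_open_cone B {b\<in>B. representation B q b < 0}"
      then have "x \<in> conic_span B" using cell[OF B] unfolding half_open_cone_def
        by (intro conic_spanI_representation) auto
      then show "x \<in> conic_span V" using conic_span_mono[OF finite_V cell(1)[OF B]] by auto
    qed
  next
    fix x \<epsilon> assume \<epsilon>: "0 < (\<epsilon>::real)" "x - \<epsilon> *\<^sub>R q \<in> conic_span V"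
    have "x - \<epsilon> *\<^sub>R q + \<epsilon> *\<^sub>R q \<in> span V"
      using \<epsilon>(2) qV conic_span_subset_span by (blast intro: span_add span_scale)
    then have xV: "x \<in> span V" by simp
    \<comment> \<open>Every shorter push stays in the cone as well, because it differs from the
      given one by a nonnegative multiple of \<open>q\<close>.\<close>
    have "eventually (\<lambda>\<delta>. \<delta> < \<epsilon>) (at_right 0)"
      using \<epsilon>(1) by (meson eventually_at_right_field)
    then have "eventually (\<lambda>\<delta>. x + \<delta> *\<^sub>R ((-1) *\<^sub>R q) \<in> conic_span V) (at_right 0)"
    proof eventually_elim
      case (elim \<delta>)
      then have "(x - \<epsilon> *\<^sub>R q) + (\<epsilon> - \<delta>) *\<^sub>R q \<in> conic_span V"
        by (intro conic_span_add conic_span_scale \<epsilon> qC) auto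
      then show ?case by (simp add: algebra_simps)
    qed
    from pushed[OF this xV] show "\<exists>!B. B \<in> ?\<B> \<and> x \<in> half_open_cone B {b\<in>B. 0 < representation B q b}"
      by simp
  next
    fix B x assume B: "B \<in> ?\<B>" and x: "x \<in> half_open_cone B {b\<in>B. 0 < representation B q b}"
    then have xV: "x \<in> span V" using cell[OF B] by (auto simp: half_open_cone_def)
    have "eventually (\<lambda>\<epsilon>. 0 < \<epsilon> \<and> (\<forall>b\<in>B. 0 < representation B (x + \<epsilon> *\<^sub>R ((-1) *\<^sub>R q)) b)) (at_right 0)"
      using signs[OF xV, of "-1", simplified] eventually_at_right_less[of "0::real"]
      by eventually_elim (use half[OF B xV, of "-1"] x B in auto)
    then obtain \<epsilon> where \<epsilon>: "0 < \<epsilon>" "\<forall>b\<in>B. 0 < representation B (x + \<epsilon> *\<^sub>R ((-1) *\<^sub>R q)) b"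
      using eventually_happens'[OF trivial_limit_at_right_real] by blast
    have "x + \<epsilon> *\<^sub>R ((-1) *\<^sub>R q) \<in> conic_span B"
      using cell[OF B] \<epsilon>(2) xV qV
      by (intro conic_spanI_representation) (auto intro: less_imp_le span_diff span_scale)
    then have "x - \<epsilon> *\<^sub>R q \<in> conic_span V" using conic_span_mono[OF finite_V cell(1)[OF B]] by auto
    with \<epsilon>(1) show "\<exists>\<epsilon>>0. x - \<epsilon> *\<^sub>R q \<in> conic_span V" by auto
  qed (use cell qnz in auto)
qed

end

subsection \<open>Quasipolynomials\<close>

lemma periodic_multiple:
  fixes f :: "int \<Rightarrow> real"
  assumes "\<And>t. f (t + p) = f t"
  shows "f (t + int n * p) = f t"
proof (induction n)
  case (Suc n)
  have "f (t + int (Suc n) * p) = f ((t + int n * p) + p)" by (simp add: algebra_simps)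
  then show ?case using assms Suc by simp
qed simp

lemma quasipolynomial_sum:
  assumes "finite I" and "\<And>i. i \<in> I \<Longrightarrow> \<exists>c. quasipolynomial D c (f i)"
  shows "\<exists>c. quasipolynomial D c (\<lambda>t. \<Sum>i\<in>I. f i t)"
  using assms
proof (induction I rule: finite_induct)
  case empty
  show ?case by (intro exI[of _ "\<lambda>_ _. 0"]) (auto simp: quasipolynomial_def intro: exI[of _ 1])
next
  case (insert i I)
  obtain c where c: "quasipolynomial D c (f i)" using insert.prems by blast
  obtain d where d: "quasipolynomial D d (\<lambda>t. \<Sum>i\<in>I. f i t)" using insert by blast
  have "quasipolynomial D (\<lambda>k t. c k t + d k t) (\<lambda>t. \<Sum>i\<in>insert i I. f i t)"
    unfolding quasipolynomial_def
  proof (intro conjI allI impI)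
    fix k assume "k \<le> D"
    then have "\<exists>p>0. \<forall>t. c k (t + p) = c k t" "\<exists>p>0. \<forall>t. d k (t + p) = d k t"
      using c d unfolding quasipolynomial_def by blast+
    then obtain p p' where p: "p > 0" "\<And>t. c k (t + p) = c k t" and p': "p' > 0" "\<And>t. d k (t + p') = d k t"
      by blast
    have "c k (t + p' * p) = c k t" "d k (t + p' * p) = d k t" for t
      using periodic_multiple[of "c k" p t "nat p'"] periodic_multiple[of "d k" p' t "nat p"] p p'
      by (auto simp: mult.commute)
    then show "\<exists>q>0. \<forall>t. c k (t + q) + d k (t + q) = c k t + d k t"
      using p(1) p'(1) by (intro exI[of _ "p' * p"]) auto
  next
    fix t show "(\<Sum>i\<in>insert i I. f i t) = (\<Sum>k\<le>D. (c k t + d k t) * of_int t ^ k)"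
      using c d insert(1,2) by (simp add: quasipolynomial_def distrib_right sum.distrib)
  qed
  then show ?case by blast
qed

text \<open>
  The number of points at level \<open>t\<close> of the translates by \<open>\<nat>\<close>-combinations of \<open>D + 1\<close> generators
  of height \<open>N\<close> of a single point of height \<open>k\<close>, extended to all integers \<open>t\<close>.
\<close>

definition residue_binomial :: "nat \<Rightarrow> nat \<Rightarrow> int \<Rightarrow> int \<Rightarrow> real" where
  "residue_binomial D N k t =
     (if int N dvd t - k then (of_int ((t - k) div int N) + real D) gchoose D else 0)"

lemma gbinomial_affine_poly:
  fixes a b :: real
  shows "\<exists>g. degree g \<le> D \<and> (\<forall>x. poly g x = (a * x + b) gchoose D)"
proof -
  let ?g = "smult (1 / fact D) (\<Prod>i=0..<D. [:b - real i, a:])"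
  have "degree (\<Prod>i=0..<D. [:b - real i, a:]) \<le> (\<Sum>i=0..<D. degree [:b - real i, a:])"
    using degree_prod_sum_le[of "{0..<D}" "\<lambda>i. [:b - real i, a:]"] by (simp add: o_def)
  also have "\<dots> \<le> (\<Sum>i=0..<D. 1)" by (rule sum_mono) simp
  finally have "degree ?g \<le> D" using degree_smult_le[of "1 / fact D"] by (simp add: order_trans)
  moreover have "poly ?g x = (a * x + b) gchoose D" for x
    by (simp add: gbinomial_prod_rev poly_prod algebra_simps)
  ultimately show ?thesis by blast
qed

lemma residue_binomial_quasipolynomial:
  assumes N: "N > 0"
  shows "\<exists>c. quasipolynomial D c (residue_binomial D N k)"
proof -
  obtain g :: "real poly" where g: "degree g \<le> D" "\<And>x. poly g x = (1 / N * x + (D - k / N)) gchoose D"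
    using gbinomial_affine_poly[of D "1 / N" "D - k / N"] by auto
  \<comment> \<open>On the residue class of \<open>k\<close> all values come from the single
    polynomial \<open>g\<close>; off the class every coefficient is switched to 0, which makes
    \<open>N\<close> a period.\<close>
  let ?c = "\<lambda>i t. if int N dvd t - k then coeff g i else 0"
  have "quasipolynomial D ?c (residue_binomial D N k)"
    unfolding quasipolynomial_def
  proof (intro conjI allI impI)
    fix i
    have "int N dvd t + int N - k \<longleftrightarrow> int N dvd t - k" for t
      by (metis add_diff_eq diff_add_eq dvd_add_triv_right_iff)
    then show "\<exists>p>0. \<forall>t. ?c i (t + p) = ?c i t" using N by (intro exI[of _ "int N"]) auto
  next
    fix t
    have "poly g t = (\<Sum>i\<le>degree g. coeff g i * of_int t ^ i)" by (rule poly_altdef)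
    also have "\<dots> = (\<Sum>i\<le>D. coeff g i * of_int t ^ i)"
      by (rule sum.mono_neutral_left) (use g(1) in \<open>auto simp: coeff_eq_0\<close>)
    finally have pg: "poly g t = (\<Sum>i\<le>D. coeff g i * of_int t ^ i)" .
    show "residue_binomial D N k t = (\<Sum>i\<le>D. ?c i t * of_int t ^ i)"
    proof (cases "int N dvd t - k")
      case True
      then have "real_of_int ((t - k) div int N) = (t - k) / N" by (simp add: real_of_int_div)
      then have "real_of_int ((t - k) div int N) + real D = 1 / N * t + (D - k / N)"
        by (simp add: diff_divide_distrib)
      then have "residue_binomial D N k t = poly g t"
        unfolding residue_binomial_def g(2) using True by (simp only: if_True)
      then show ?thesis using pg True by simp
    qed (auto simp: residue_binomial_def)
  qed
  then show ?thesis by blast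
qed

text \<open>\<open>N (D + 1) - k\<close> is the level of the reflected point. If
  \<open>t - k = N m\<close>, the quotient belonging to \<open>- t\<close> and the reflected level
  is \<open>- m - D - 1\<close>, so the claim is the upper negation of \<open>m + D\<close> choose
  \<open>D\<close>.\<close>

lemma residue_binomial_reflect:
  assumes N: "N > 0"
  shows "residue_binomial D N (int N * (int D + 1) - k) (- t) = (-1) ^ D * residue_binomial D N k t"
proof -
  have eq: "- t - (int N * (int D + 1) - k) = - (t - k) + (- int D - 1) * int N" by (simp add: algebra_simps)
  have dv: "int N dvd - t - (int N * (int D + 1) - k) \<longleftrightarrow> int N dvd t - k"
    unfolding eq by (subst dvd_add_times_triv_right_iff) (rule dvd_minus_iff)
  show ?thesis
  proof (cases "int N dvd t - k")
    case True
    then obtain m where m: "t - k = int N * m" by auto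
    have "(- t - (int N * (int D + 1) - k)) div int N = (int N * (- m - int D - 1)) div int N"
      unfolding eq m by (simp add: algebra_simps)
    then have d: "(- t - (int N * (int D + 1) - k)) div int N = - m - int D - 1" using N by simp
    have "(t - k) div int N = m" using m N by simp
    then have R: "residue_binomial D N k t = (real_of_int m + real D) gchoose D"
      using True by (simp add: residue_binomial_def)
    have L: "residue_binomial D N (int N * (int D + 1) - k) (- t) =
        (real_of_int (- m - int D - 1) + real D) gchoose D"
      unfolding residue_binomial_def d dv using True by (simp only: if_True)
    have e1: "real_of_int (- m - int D - 1) + real D = - real_of_int m - 1" by simp
    have e2: "real D - (- real_of_int m - 1) - 1 = real_of_int m + real D" by simp
    have "(- real_of_int m - 1) gchoose D = (-1) ^ D * ((real_of_int m + real D) gchoose D)"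
      using gbinomial_negated_upper[of "- real_of_int m - 1" D] unfolding e2 .
    then show ?thesis unfolding R L e1 .
  qed (use dv in \<open>auto simp: residue_binomial_def\<close>)
qed

lemma residue_binomial_nat:
  assumes N: "N > 0" and t: "t = k + int N * m" and m: "- int D \<le> m"
  shows "residue_binomial D N k t = real (nat (m + int D) choose D)"
proof -
  have d: "(t - k) div int N = m" using t N by simp
  have e: "real_of_int m + real D = real (nat (m + int D))" using m by simp
  have "int N dvd t - k" using t by simp
  then show ?thesis unfolding residue_binomial_def d e binomial_gbinomial by (simp only: if_True)
qed

text \<open>Stars and bars, carried over from lists of fixed length along an enumeration
  \<open>xs\<close> of \<open>B\<close>.\<close>

lemma card_PiE_sum_eq:
  assumes "finite B"
  shows "card {m \<in> B \<rightarrow>\<^sub>E (UNIV :: nat set). sum m B = k} = (k + card B - 1) choose k"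
proof -
  obtain xs where xs: "set xs = B" "distinct xs" using finite_distinct_list[OF assms] by auto
  have len: "length xs = card B" using xs distinct_card by force
  have "bij_betw (\<lambda>m. map m xs) {m \<in> B \<rightarrow>\<^sub>E (UNIV :: nat set). sum m B = k}
      {l. length l = card B \<and> sum_list l = k}"
    unfolding bij_betw_def
  proof
    show "inj_on (\<lambda>m. map m xs) {m \<in> B \<rightarrow>\<^sub>E (UNIV :: nat set). sum m B = k}"
      by (rule inj_onI) (auto simp: xs intro: PiE_ext)
    have "l \<in> (\<lambda>m. map m xs) ` {m \<in> B \<rightarrow>\<^sub>E UNIV. sum m B = k}" if l: "length l = card B" "sum_list l = k" for l
    proof -
      define m where "m = restrict (\<lambda>b. the (map_of (zip xs l) b)) B"
      have "map m xs = l"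
      proof (rule nth_equalityI)
        fix i assume i: "i < length (map m xs)"
        then have "xs ! i \<in> B" using xs by force
        then show "map m xs ! i = l ! i" using i l len xs by (simp add: m_def map_of_zip_nth)
      qed (use l len in simp)
      moreover have "sum m B = sum_list (map m xs)" using xs sum_list_distinct_conv_sum_set by metis
      ultimately show ?thesis using l by (intro image_eqI[of _ _ m]) (auto simp: m_def)
    qed
    moreover have "sum_list (map m xs) = sum m B" for m using xs sum_list_distinct_conv_sum_set by metis
    ultimately show "(\<lambda>m. map m xs) ` {m \<in> B \<rightarrow>\<^sub>E (UNIV :: nat set). sum m B = k} =
      {l. length l = card B \<and> sum_list l = k}" using len by auto
  qed
  then have "card {m \<in> B \<rightarrow>\<^sub>E (UNIV :: nat set). sum m B = k} = card {l. length l = card B \<and> sum_list l = k}"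
    by (rule bij_betw_same_card)
  then show ?thesis by (simp add: card_length_sum_list)
qed

text \<open>The bound on \<open>k\<close> says \<open>m \<ge> - D\<close> for the quotient
  \<open>m\<close>. In the range \<open>- D \<le> m < 0\<close> nothing is counted, and the binomial
  agrees because \<open>0 \<le> m + D < D\<close>. At \<open>m = - D - 1\<close> the polynomial
  would take the value \<plusminus>1, so the bound is sharp.\<close>

lemma card_eq_residue_binomial:
  assumes N: "N > 0" and B: "finite B" "card B = Suc D" and t: "k < t + int N * (int D + 1)"
  shows "real (card {m \<in> B \<rightarrow>\<^sub>E (UNIV :: nat set). k + int N * int (sum m B) = t}) = residue_binomial D N k t"
proof (cases "int N dvd t - k")
  case True
  then obtain m0 where m0: "t = k + int N * m0" by (metis add.commute diff_add_cancel dvdE)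
  have "int N * (- int D - 1) < int N * m0" using t m0 by (simp add: algebra_simps)
  then have lower: "- int D \<le> m0" using N by (simp only: mult_less_cancel_left) auto
  have iff: "k + int N * int s = t \<longleftrightarrow> int s = m0" for s using m0 N by auto
  show ?thesis
  proof (cases "m0 \<ge> 0")
    case True
    then obtain j where j: "m0 = int j" using nonneg_int_cases by blast
    have "card {m \<in> B \<rightarrow>\<^sub>E (UNIV :: nat set). k + int N * int (sum m B) = t} = (j + D) choose j"
      unfolding iff j of_nat_eq_iff using card_PiE_sum_eq[OF B(1), of j] B(2) by simp
    also have "(j + D) choose j = (j + D) choose D" using binomial_symmetric[of j "j + D"] by simp
    finally have "card {m \<in> B \<rightarrow>\<^sub>E (UNIV :: nat set). k + int N * int (sum m B) = t} = (j + D) choose D" .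
    moreover have "nat (m0 + int D) = j + D" using j by simp
    ultimately show ?thesis using residue_binomial_nat[OF N m0 lower] by simp
  next
    case False
    then have "int s \<noteq> m0" for s by auto
    then have "{m \<in> B \<rightarrow>\<^sub>E (UNIV :: nat set). k + int N * int (sum m B) = t} = {}" unfolding iff by blast
    moreover have "nat (m0 + int D) < D" using False lower by linarith
    ultimately show ?thesis unfolding residue_binomial_nat[OF N m0 lower] by (simp only: card.empty binomial_eq_0)
  qed
next
  case False
  then have "{m \<in> B \<rightarrow>\<^sub>E (UNIV :: nat set). k + int N * int (sum m B) = t} = {}" by auto
  then show ?thesis using False unfolding residue_binomial_def by (simp only: card.empty if_False of_nat_0)
qed

subsection \<open>Lattice points in half-open simplicial cones\<close>

text \<open>Generators of height 1 need not be lattice points; \<open>N\<close> clears their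
  denominators. All vectors \<open>N v\<close> then have the same height \<open>N\<close>, which
  gives every generator the same period.\<close>

locale lattice_cone = height_cone V h for V :: "'a::euclidean_space set" and h +
  fixes \<Lambda> :: "'a set" and N :: nat
  assumes zero_lattice: "0 \<in> \<Lambda>" and add_lattice: "\<And>x y. x \<in> \<Lambda> \<Longrightarrow> y \<in> \<Lambda> \<Longrightarrow> x + y \<in> \<Lambda>"
    and uminus_lattice: "\<And>x. x \<in> \<Lambda> \<Longrightarrow> - x \<in> \<Lambda>"
    and discrete: "\<And>r. finite {x\<in>\<Lambda>. norm x \<le> r}"
    and h_lattice: "\<And>x. x \<in> \<Lambda> \<Longrightarrow> h x \<in> \<int>"
    and N_pos: "N > 0" and N_V: "\<And>v. v \<in> V \<Longrightarrow> real N *\<^sub>R v \<in> \<Lambda>"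
begin

lemma scale_lattice: "x \<in> \<Lambda> \<Longrightarrow> real n *\<^sub>R x \<in> \<Lambda>"
  by (induction n) (auto simp: zero_lattice scaleR_add_left add_lattice)

lemma sum_lattice: "(\<And>i. i \<in> I \<Longrightarrow> f i \<in> \<Lambda>) \<Longrightarrow> sum f I \<in> \<Lambda>"
  by (induction I rule: infinite_finite_induct) (auto simp: zero_lattice add_lattice)

lemma diff_lattice: "x \<in> \<Lambda> \<Longrightarrow> y \<in> \<Lambda> \<Longrightarrow> x - y \<in> \<Lambda>"
  using add_lattice[of x "- y"] uminus_lattice by simp

text \<open>The side length is \<open>N\<close>, and the half-open side is chosen as in the cone:
  \<open>(0, N]\<close> where the facet is removed, \<open>[0, N)\<close> where it is kept. With
  this choice the translates by multiples of \<open>N b\<close> tile the half-open cone.\<close>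

definition parallelepiped :: "'a set \<Rightarrow> 'a set \<Rightarrow> 'a set" where
  "parallelepiped B A = {p \<in> \<Lambda>. p \<in> span B \<and>
     (\<forall>b\<in>B. if b \<in> A then 0 < representation B p b \<and> representation B p b \<le> real N
            else 0 \<le> representation B p b \<and> representation B p b < real N)}"

definition level :: "'a \<Rightarrow> int" where "level x = \<lfloor>h x\<rfloor>"

lemma of_int_level: "x \<in> \<Lambda> \<Longrightarrow> of_int (level x) = h x"
  using h_lattice by (auto simp: level_def elim: Ints_cases)

lemma translate_unique:
  fixes r s :: real and m m' :: nat
  assumes eq: "r + real N * real m = s + real N * real m'"
    and "if P then 0 < r \<and> r \<le> real N else 0 \<le> r \<and> r < real N"
    and "if P then 0 < s \<and> s \<le> real N else 0 \<le> s \<and> s < real N"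
  shows "m = m'"
proof -
  have "real N * (real m - real m') = s - r" using eq by (simp add: algebra_simps)
  moreover have "\<bar>s - r\<bar> < real N" using assms(2,3) by (auto split: if_splits)
  ultimately have "real N * \<bar>real m - real m'\<bar> < real N * 1" by (metis abs_mult abs_of_nat mult.right_neutral)
  then have "\<bar>real m - real m'\<bar> < 1" using N_pos by simp
  then show ?thesis by linarith
qed

lemma translate_exists:
  fixes r :: real
  assumes "if P then 0 < r else 0 \<le> r"
  shows "\<exists>m::nat. if P then 0 < r - real N * real m \<and> r - real N * real m \<le> real N
     else 0 \<le> r - real N * real m \<and> r - real N * real m < real N"
proof (cases P)
  case True
  have pos: "0 < r / N" using assms True N_pos by simp
  \<comment> \<open>The largest integer strictly below \<open>r / N\<close>, so that the remainder
    falls into \<open>(0, N]\<close> and not into \<open>[0, N)\<close>.\<close>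
  define m where "m = nat (\<lceil>r / N\<rceil> - 1)"
  have "real m = \<lceil>r / N\<rceil> - 1" using pos by (simp add: m_def)
  then have "real m < r / N" "r / N \<le> real m + 1" by linarith+
  then have "real m * N < r" "r \<le> (real m + 1) * N" using N_pos by (auto simp: field_simps)
  then show ?thesis using True by (intro exI[of _ m]) (auto simp: algebra_simps)
next
  case False
  have pos: "0 \<le> r / N" using assms False N_pos by simp
  define m where "m = nat \<lfloor>r / N\<rfloor>"
  have "real m = \<lfloor>r / N\<rfloor>" using pos by (simp add: m_def)
  then have "real m \<le> r / N" "r / N < real m + 1" by linarith+
  then have "real m * N \<le> r" "r < (real m + 1) * N" using N_pos by (auto simp: field_simps)
  then show ?thesis using False by (intro exI[of _ m]) (auto simp: algebra_simps)
qed

context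
  fixes B :: "'a set" and D :: nat
  assumes BV: "B \<subseteq> V" and indep: "independent B" and card_B: "card B = Suc D"
begin

lemma finite_B: "finite B"
  using card_B card.infinite by fastforce

lemma h_span: "x \<in> span B \<Longrightarrow> h x = (\<Sum>b\<in>B. representation B x b)"
  using h_sum[OF BV, of "representation B x"] sum_representation[OF indep finite_B, of x] by simp

lemma representation_translate:
  assumes "p \<in> span B" "b \<in> B"
  shows "representation B (p + (\<Sum>b\<in>B. f b *\<^sub>R b)) b = representation B p b + f b"
proof -
  have "(\<Sum>b\<in>B. f b *\<^sub>R b) \<in> span B" by (intro span_sum span_scale span_base)
  then show ?thesis using assms representation_of_sum[OF indep finite_B, of b f]
    by (simp add: real_vector.representation_add[OF indep])
qed

lemma bounded_coordinates_finite:
  "finite {p \<in> \<Lambda>. p \<in> span B \<and> (\<forall>b\<in>B. \<bar>representation B p b\<bar> \<le> R)}"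
proof (rule finite_subset[OF _ discrete[of "\<Sum>b\<in>B. R * norm b"]], clarify)
  fix p assume p: "p \<in> span B" "\<forall>b\<in>B. \<bar>representation B p b\<bar> \<le> R"
  have "norm p = norm (\<Sum>b\<in>B. representation B p b *\<^sub>R b)" using sum_representation[OF indep finite_B p(1)] by simp
  also have "\<dots> \<le> (\<Sum>b\<in>B. norm (representation B p b *\<^sub>R b))" by (rule norm_sum)
  also have "\<dots> \<le> (\<Sum>b\<in>B. R * norm b)" using p(2) by (intro sum_mono) (simp add: mult_right_mono)
  finally show "norm p \<le> (\<Sum>b\<in>B. R * norm b)" .
qed

lemma finite_parallelepiped: "finite (parallelepiped B A)"
  by (rule finite_subset[OF _ bounded_coordinates_finite[of "real N"]])
    (force simp: parallelepiped_def split: if_splits)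

text \<open>The level is a sum of \<open>Suc D\<close> coordinates between 0 and \<open>N\<close>.
  The weak upper bound suffices to count at \<open>t > 0\<close>; evaluation at \<open>t = 0\<close>
  needs the strict one, which holds once some facet is kept.\<close>

lemma level_parallelepiped:
  assumes p: "p \<in> parallelepiped B A"
  shows "0 \<le> level p" and "level p \<le> int N * (int D + 1)"
    and "b \<in> B \<Longrightarrow> b \<notin> A \<Longrightarrow> level p < int N * (int D + 1)"
    and "level p = 0 \<Longrightarrow> p = 0 \<and> A \<inter> B = {}"
proof -
  have pL: "p \<in> \<Lambda>" "p \<in> span B" and r: "\<And>b. b \<in> B \<Longrightarrow> 0 \<le> representation B p b \<and> representation B p b \<le> N"
    using p by (force simp: parallelepiped_def split: if_splits)+
  have lev: "of_int (level p) = (\<Sum>b\<in>B. representation B p b)" using of_int_level[OF pL(1)] h_span[OF pL(2)] by simp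
  have "0 \<le> real_of_int (level p)" unfolding lev using r by (simp add: sum_nonneg)
  then show "0 \<le> level p" by simp
  have sN: "(\<Sum>b\<in>B. real N) = real_of_int (int N * (int D + 1))" using card_B by (simp add: algebra_simps)
  have "real_of_int (level p) \<le> (\<Sum>b\<in>B. real N)" unfolding lev using r by (intro sum_mono) auto
  then show "level p \<le> int N * (int D + 1)" unfolding sN by linarith
  show "level p < int N * (int D + 1)" if b: "b \<in> B" "b \<notin> A"
  proof -
    have "representation B p b < N" using p b by (force simp: parallelepiped_def)
    then have "real_of_int (level p) < (\<Sum>b\<in>B. real N)" unfolding lev
      using r b finite_B by (intro sum_strict_mono_ex1) auto
    then show ?thesis unfolding sN by linarith
  qed
  show "p = 0 \<and> A \<inter> B = {}" if "level p = 0"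
  proof -
    have "(\<Sum>b\<in>B. representation B p b) = 0" using lev that by simp
    then have z: "\<forall>b\<in>B. representation B p b = 0" using r finite_B by (simp add: sum_nonneg_eq_0_iff)
    then have "p = 0" using sum_representation[OF indep finite_B pL(2)] by simp
    moreover have "A \<inter> B = {}" using z p by (force simp: parallelepiped_def)
    ultimately show ?thesis by simp
  qed
qed

text \<open>Division with remainder by \<open>N\<close> in each coordinate writes a lattice point
  uniquely as a point of the parallelepiped plus a combination of the vectors \<open>N b\<close>,
  and the heights add up.\<close>

lemma card_half_open_level:
  assumes "A \<subseteq> B" and t: "t > 0"
  shows "real (card {x \<in> \<Lambda>. x \<in> half_open_cone B A \<and> h x = of_int t}) =
     (\<Sum>p\<in>parallelepiped B A. residue_binomial D N (level p) t)"
proof -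
  define M where "M = (\<lambda>p. {m \<in> B \<rightarrow>\<^sub>E (UNIV :: nat set). level p + int N * int (sum m B) = t})"
  define \<phi> where "\<phi> = (\<lambda>(p, m). p + (\<Sum>b\<in>B. (real N * real (m b)) *\<^sub>R b))"
  have finM: "finite (M p)" if "p \<in> parallelepiped B A" for p
  proof -
    have "m \<in> B \<rightarrow>\<^sub>E {..nat t}" if "m \<in> M p" for m
    proof
      fix b assume b: "b \<in> B"
      have "m b \<le> sum m B" using b finite_B by (simp add: member_le_sum)
      also have "\<dots> \<le> N * sum m B" using N_pos by simp
      also have "int (N * sum m B) \<le> t" using that level_parallelepiped(1)[OF \<open>p \<in> parallelepiped B A\<close>]
        unfolding M_def by simp
      then have "N * sum m B \<le> nat t" by linarith
      finally show "m b \<in> {..nat t}" by simp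
    qed (use that in \<open>auto simp: M_def\<close>)
    then have "M p \<subseteq> B \<rightarrow>\<^sub>E {..nat t}" by blast
    then show ?thesis using finite_B by (meson finite_PiE finite_atMost finite_subset)
  qed
  have coord: "representation B (\<phi> (p, m)) b = representation B p b + real N * real (m b)"
    if "p \<in> parallelepiped B A" "b \<in> B" for p m b
    using representation_translate[of p b "\<lambda>b. real N * real (m b)"] that by (simp add: \<phi>_def parallelepiped_def)
  have "bij_betw \<phi> (Sigma (parallelepiped B A) M) {x \<in> \<Lambda>. x \<in> half_open_cone B A \<and> h x = of_int t}"
    unfolding bij_betw_def
  proof
    show "inj_on \<phi> (Sigma (parallelepiped B A) M)"
    proof (rule inj_onI, clarify)
      fix p m p' m' assume *: "p \<in> parallelepiped B A" "m \<in> M p" "p' \<in> parallelepiped B A" "m' \<in> M p'"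
        and eq: "\<phi> (p, m) = \<phi> (p', m')"
      have "m b = m' b" if b: "b \<in> B" for b
      proof (rule translate_unique[where P = "b \<in> A"])
        show "representation B p b + real N * real (m b) = representation B p' b + real N * real (m' b)"
          using coord[OF *(1) b, of m] coord[OF *(3) b, of m'] eq by simp
      qed (use * b in \<open>unfold parallelepiped_def, blast+\<close>)
      then have "m = m'" using * by (auto simp: M_def intro: PiE_ext)
      then show "p = p' \<and> m = m'" using eq by (simp add: \<phi>_def)
    qed
    show "\<phi> ` Sigma (parallelepiped B A) M = {x \<in> \<Lambda>. x \<in> half_open_cone B A \<and> h x = of_int t}"
    proof (intro equalityI subsetI)
      fix x assume "x \<in> \<phi> ` Sigma (parallelepiped B A) M"
      then obtain p m where pm: "p \<in> parallelepiped B A" "m \<in> M p" "x = \<phi> (p, m)" by auto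
      have p: "p \<in> \<Lambda>" "p \<in> span B" using pm(1) by (auto simp: parallelepiped_def)
      have "real (m b) *\<^sub>R (real N *\<^sub>R b) \<in> \<Lambda>" if "b \<in> B" for b
        using that BV N_V by (intro scale_lattice[of "real N *\<^sub>R b"]) auto
      then have "(\<Sum>b\<in>B. (real N * real (m b)) *\<^sub>R b) \<in> \<Lambda>"
        by (intro sum_lattice) (simp add: mult.commute)
      then have "x \<in> \<Lambda>" using p pm(3) by (simp add: \<phi>_def add_lattice)
      have xB: "x \<in> span B" unfolding pm(3) \<phi>_def prod.case
        by (intro span_add p(2) span_sum span_scale span_base)
      have half: "x \<in> half_open_cone B A"
        unfolding half_open_cone_def
      proof (intro CollectI conjI xB ballI)
        fix b assume b: "b \<in> B"
        have "0 \<le> representation B p b \<and> (b \<in> A \<longrightarrow> 0 < representation B p b)"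
          using pm(1) b by (force simp: parallelepiped_def split: if_splits)
        then show "0 \<le> representation B x b" "b \<in> A \<longrightarrow> 0 < representation B x b"
          unfolding pm(3) coord[OF pm(1) b] by (auto intro: add_pos_nonneg)
      qed
      have "h x = h p + (\<Sum>b\<in>B. real N * real (m b))"
        using h_sum[OF BV] linear_h pm(3) by (simp add: \<phi>_def linear_add)
      then have "h x = of_int (level p + int N * int (sum m B))"
        using of_int_level[OF p(1)] by (simp add: sum_distrib_left)
      moreover have "level p + int N * int (sum m B) = t" using pm(2) by (simp add: M_def)
      ultimately have "h x = of_int t" by (simp only:)
      then show "x \<in> {x \<in> \<Lambda>. x \<in> half_open_cone B A \<and> h x = of_int t}" using \<open>x \<in> \<Lambda>\<close> half by auto
    next
      fix x assume "x \<in> {x \<in> \<Lambda>. x \<in> half_open_cone B A \<and> h x = of_int t}"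
      then have x: "x \<in> \<Lambda>" "x \<in> half_open_cone B A" "h x = of_int t" by auto
      then have xB: "x \<in> span B" by (simp add: half_open_cone_def)
      have "\<exists>m::nat. if b \<in> A then 0 < representation B x b - real N * real m \<and> representation B x b - real N * real m \<le> real N
         else 0 \<le> representation B x b - real N * real m \<and> representation B x b - real N * real m < real N" if "b \<in> B" for b
        using x(2) that by (intro translate_exists) (auto simp: half_open_cone_def)
      then obtain m0 :: "'a \<Rightarrow> nat" where m0: "\<And>b. b \<in> B \<Longrightarrow>
         if b \<in> A then 0 < representation B x b - real N * real (m0 b) \<and> representation B x b - real N * real (m0 b) \<le> real N
         else 0 \<le> representation B x b - real N * real (m0 b) \<and> representation B x b - real N * real (m0 b) < real N"
        by metis
      define m where "m = restrict m0 B"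
      define p where "p = x + (\<Sum>b\<in>B. (- (real N * real (m b))) *\<^sub>R b)"
      have "real (m b) *\<^sub>R (real N *\<^sub>R b) \<in> \<Lambda>" if "b \<in> B" for b
        using that BV N_V by (intro scale_lattice[of "real N *\<^sub>R b"]) auto
      then have "(\<Sum>b\<in>B. (real N * real (m b)) *\<^sub>R b) \<in> \<Lambda>"
        by (intro sum_lattice) (simp add: mult.commute)
      then have "x - (\<Sum>b\<in>B. (real N * real (m b)) *\<^sub>R b) \<in> \<Lambda>" using x diff_lattice by auto
      then have pL: "p \<in> \<Lambda>" by (simp add: p_def sum_negf)
      have pB: "p \<in> span B" unfolding p_def by (intro span_add xB span_sum span_scale span_base)
      have prep: "representation B p b = representation B x b - real N * real (m0 b)" if "b \<in> B" for b
        unfolding p_def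
        using representation_translate[OF xB that, of "\<lambda>b. - (real N * real (m b))"] that by (simp add: m_def)
      have pP: "p \<in> parallelepiped B A" unfolding parallelepiped_def
      proof (intro CollectI conjI pL pB ballI)
        fix b assume b: "b \<in> B"
        show "if b \<in> A then 0 < representation B p b \<and> representation B p b \<le> real N
            else 0 \<le> representation B p b \<and> representation B p b < real N"
          unfolding prep[OF b] by (rule m0[OF b])
      qed
      have x_eq: "x = \<phi> (p, m)" by (simp add: \<phi>_def p_def sum_negf)
      have "h x = h p + (\<Sum>b\<in>B. real N * real (m b))"
        unfolding x_eq using h_sum[OF BV] linear_h by (simp add: \<phi>_def linear_add)
      then have "real_of_int t = of_int (level p + int N * int (sum m B))"
        using of_int_level[OF pL] x(3) by (simp add: sum_distrib_left)
      then have "level p + int N * int (sum m B) = t" by (simp only: of_int_eq_iff)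
      moreover have "m \<in> B \<rightarrow>\<^sub>E UNIV" by (simp add: m_def)
      ultimately have "m \<in> M p" unfolding M_def by blast
      then show "x \<in> \<phi> ` Sigma (parallelepiped B A) M" using x_eq pP by auto
    qed
  qed
  then have "card {x \<in> \<Lambda>. x \<in> half_open_cone B A \<and> h x = of_int t} = card (Sigma (parallelepiped B A) M)"
    by (simp add: bij_betw_same_card)
  also have "\<dots> = (\<Sum>p\<in>parallelepiped B A. card (M p))"
    using finite_parallelepiped finM by (simp add: card_SigmaI)
  finally have "real (card {x \<in> \<Lambda>. x \<in> half_open_cone B A \<and> h x = of_int t}) =
      (\<Sum>p\<in>parallelepiped B A. real (card (M p)))" by simp
  also have "\<dots> = (\<Sum>p\<in>parallelepiped B A. residue_binomial D N (level p) t)"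
  proof (rule sum.cong[OF refl])
    fix p assume "p \<in> parallelepiped B A"
    from level_parallelepiped(2)[OF this] t
    show "real (card (M p)) = residue_binomial D N (level p) t"
      unfolding M_def by (intro card_eq_residue_binomial N_pos finite_B card_B) linarith
  qed
  finally show ?thesis .
qed

lemma sum_residue_binomial_reflect:
  assumes "A \<subseteq> B"
  shows "(\<Sum>p\<in>parallelepiped B A. residue_binomial D N (level p) (- t)) =
     (-1) ^ D * (\<Sum>p\<in>parallelepiped B (B - A). residue_binomial D N (level p) t)"
proof -
  \<comment> \<open>Each coordinate goes from \<open>r\<close> to \<open>N - r\<close>, which
    exchanges \<open>(0, N]\<close> and \<open>[0, N)\<close>: removed and kept facets change
    places.\<close>
  define \<psi> where "\<psi> = (\<lambda>p. (\<Sum>b\<in>B. real N *\<^sub>R b) - p)"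
  have top: "(\<Sum>b\<in>B. real N *\<^sub>R b) \<in> \<Lambda>" "(\<Sum>b\<in>B. real N *\<^sub>R b) \<in> span B"
    using BV N_V by (auto intro!: sum_lattice span_sum intro: span_scale span_base)
  have map: "\<psi> p \<in> parallelepiped B (B - A')" if "A' \<subseteq> B" "p \<in> parallelepiped B A'" for p A'
  proof -
    have p: "p \<in> \<Lambda>" "p \<in> span B" using that by (auto simp: parallelepiped_def)
    have "representation B (\<psi> p) b = real N - representation B p b" if "b \<in> B" for b
      using representation_of_sum[OF indep finite_B that, of "\<lambda>_. real N"] top p
      by (simp add: \<psi>_def real_vector.representation_diff[OF indep])
    then show ?thesis using that p top diff_lattice span_diff
      by (auto simp: parallelepiped_def \<psi>_def split: if_splits)
  qed
  have lev: "level (\<psi> p) = int N * (int D + 1) - level p" if "p \<in> parallelepiped B A'" for p A'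
  proof -
    have p: "p \<in> \<Lambda>" using that by (auto simp: parallelepiped_def)
    have "h (\<psi> p) = (\<Sum>b\<in>B. real N) - h p"
      using h_sum[OF BV, of "\<lambda>_. real N"] linear_h by (simp add: \<psi>_def linear_diff)
    then have "h (\<psi> p) = of_int (int N * (int D + 1) - level p)"
      using of_int_level[OF p] card_B by (simp add: algebra_simps)
    then show ?thesis by (simp only: level_def floor_of_int)
  qed
  have inv: "\<psi> (\<psi> p) = p" for p by (simp add: \<psi>_def)
  have "B - (B - A) = A" using assms by auto
  have "(\<Sum>p\<in>parallelepiped B A. residue_binomial D N (level p) (- t)) =
      (\<Sum>p\<in>parallelepiped B (B - A). residue_binomial D N (level (\<psi> p)) (- t))"
    by (rule sum.reindex_bij_witness[of _ \<psi> \<psi>])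
      (use map[of A] map[of "B - A"] assms inv \<open>B - (B - A) = A\<close> in auto)
  also have "\<dots> = (\<Sum>p\<in>parallelepiped B (B - A). (-1) ^ D * residue_binomial D N (level p) t)"
    by (rule sum.cong[OF refl]) (simp add: lev residue_binomial_reflect[OF N_pos])
  finally show ?thesis by (simp add: sum_distrib_left)
qed

text \<open>For a nonzero point on level \<open>N m\<close> the strict bound gives
  \<open>0 < m \<le> D\<close>, and \<open>D - m\<close> choose \<open>D\<close> vanishes. Only the
  apex contributes, and it is present exactly if no facet is removed.\<close>

lemma sum_residue_binomial_0:
  assumes A: "A \<subset> B"
  shows "(\<Sum>p\<in>parallelepiped B A. residue_binomial D N (level p) 0) = (if A = {} then 1 else 0)"
proof -
  obtain b where b: "b \<in> B" "b \<notin> A" using A by auto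
  have zero: "residue_binomial D N (level p) 0 = 0" if p: "p \<in> parallelepiped B A" "p \<noteq> 0" for p
  proof (cases "int N dvd 0 - level p")
    case True
    then obtain m where m: "level p = int N * m" by auto
    have "level p > 0" using level_parallelepiped(1,4)[OF p(1)] p(2) by force
    then have "m > 0" using m N_pos by (simp add: zero_less_mult_iff)
    moreover have "int N * m < int N * (int D + 1)" using level_parallelepiped(3)[OF p(1) b] m by simp
    then have "m < int D + 1" using N_pos by simp
    ultimately have "nat (- m + int D) < D" "- int D \<le> - m" by linarith+
    then show ?thesis using residue_binomial_nat[OF N_pos, of 0 "level p" "- m" D] m by simp
  qed (simp add: residue_binomial_def)
  have l0: "level 0 = 0" using linear_h by (simp add: level_def linear_0)
  show ?thesis
  proof (cases "A = {}")
    case True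
    have "0 \<in> parallelepiped B A" using True N_pos
      by (auto simp: parallelepiped_def zero_lattice span_zero real_vector.representation_zero)
    then have "(\<Sum>p\<in>parallelepiped B A. residue_binomial D N (level p) 0) = residue_binomial D N (level 0) 0"
      using zero finite_parallelepiped by (simp add: sum.remove[of _ 0])
    also have "\<dots> = 1" using residue_binomial_nat[OF N_pos, of 0 0 0 D] l0 by simp
    finally show ?thesis using True by simp
  next
    case False
    then have "0 \<notin> parallelepiped B A" using A by (auto simp: parallelepiped_def real_vector.representation_zero)
    then have "\<forall>p\<in>parallelepiped B A. residue_binomial D N (level p) 0 = 0" using zero by metis
    then show ?thesis using False by simp
  qed
qed

lemma finite_half_open_level: "finite {x \<in> \<Lambda>. x \<in> half_open_cone B A \<and> h x = t}"
proof (rule finite_subset[OF _ bounded_coordinates_finite[of t]], clarify)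
  fix x assume x: "x \<in> half_open_cone B A" "t = h x"
  then have xB: "x \<in> span B" "\<forall>b\<in>B. 0 \<le> representation B x b" by (auto simp: half_open_cone_def)
  have "\<bar>representation B x b\<bar> \<le> h x" if "b \<in> B" for b
    unfolding h_span[OF xB(1)] using xB(2) that finite_B member_le_sum[OF that, of "representation B x"]
    by simp
  then show "x \<in> span B \<and> (\<forall>b\<in>B. \<bar>representation B x b\<bar> \<le> h x)" using xB by auto
qed

end

text \<open>The condition on \<open>x - \<epsilon> *\<^sub>R q\<close> stands for the relative
  interior of the cone; the translation to the polytope follows after homogenization.\<close>

theorem cone_ehrhart:
  assumes ne: "V \<noteq> {}" and dimV: "dim V = Suc D"
  shows "\<exists>Q c q a. quasipolynomial D c Q \<and> (\<forall>v\<in>V. 0 < a v) \<and> q = (\<Sum>v\<in>V. a v *\<^sub>R v) \<and>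
    (\<forall>t>0. Q t = real (card {x\<in>\<Lambda>. h x = of_int t \<and> (\<exists>\<epsilon>>0. x - \<epsilon> *\<^sub>R q \<in> conic_span V)})) \<and>
    (\<forall>t>0. (-1) ^ D * Q (- t) = real (card {x\<in>\<Lambda>. h x = of_int t \<and> x \<in> conic_span V})) \<and>
    (-1) ^ D * Q 0 = 1"
proof (rule half_open_decomposition)
  fix \<B> q
  assume cells: "\<And>B. B \<in> \<B> \<Longrightarrow> B \<subseteq> V \<and> independent B \<and> span B = span V"
    and qnz: "\<And>B b. B \<in> \<B> \<Longrightarrow> b \<in> B \<Longrightarrow> representation B q b \<noteq> 0"
    and q: "\<exists>c. (\<forall>v\<in>V. 0 < c v) \<and> q = (\<Sum>v\<in>V. c v *\<^sub>R v)"
    and closed1: "\<And>x. x \<in> conic_span V \<Longrightarrow> \<exists>!B. B \<in> \<B> \<and> x \<in> half_open_cone B {b\<in>B. representation B q b < 0}"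
    and closed2: "\<And>B. B \<in> \<B> \<Longrightarrow> half_open_cone B {b\<in>B. representation B q b < 0} \<subseteq> conic_span V"
    and open1: "\<And>x \<epsilon>. 0 < \<epsilon> \<Longrightarrow> x - \<epsilon> *\<^sub>R q \<in> conic_span V \<Longrightarrow>
       \<exists>!B. B \<in> \<B> \<and> x \<in> half_open_cone B {b\<in>B. 0 < representation B q b}"
    and open2: "\<And>B x. B \<in> \<B> \<Longrightarrow> x \<in> half_open_cone B {b\<in>B. 0 < representation B q b} \<Longrightarrow>
       \<exists>\<epsilon>>0. x - \<epsilon> *\<^sub>R q \<in> conic_span V"
    and qcell: "\<exists>!B. B \<in> \<B> \<and> (\<forall>b\<in>B. 0 < representation B q b)"
  define neg where "neg = (\<lambda>B. {b\<in>B. representation B q b < 0})"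
  define pos where "pos = (\<lambda>B. {b\<in>B. 0 < representation B q b})"
  \<comment> \<open>No coordinate of \<open>q\<close> is zero, so the facets removed for the
    interior and those removed for the closed cone are complementary, as the reflection
    requires.\<close>
  have compl: "B - pos B = neg B" if "B \<in> \<B>" for B
    using qnz[OF that] by (auto simp: pos_def neg_def not_less order_le_less)
  have BV: "B \<subseteq> V" and indep: "independent B" and spanB: "span B = span V" if "B \<in> \<B>" for B
    using cells[OF that] by auto
  have cardB: "card B = Suc D" if "B \<in> \<B>" for B
    using indep[OF that] spanB[OF that] dimV by (metis dim_eq_card dim_span)
  note B = BV indep cardB
  have fin\<B>: "finite \<B>" by (rule finite_subset[of _ "Pow V"]) (use BV finite_V in auto)
  \<comment> \<open>Kept general in the set \<open>C\<close> and in the removed facets, so that it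
    applies to the interior and to the closed cone alike.\<close>
  have count: "real (card {x\<in>\<Lambda>. h x = of_int t \<and> x \<in> C}) =
      (\<Sum>B\<in>\<B>. \<Sum>p\<in>parallelepiped B (A B). residue_binomial D N (level p) t)"
    if t: "t > 0" and A: "\<And>B. B \<in> \<B> \<Longrightarrow> A B \<subseteq> B"
      and C: "\<And>x. x \<in> C \<Longrightarrow> \<exists>!B. B \<in> \<B> \<and> x \<in> half_open_cone B (A B)"
        "\<And>B x. B \<in> \<B> \<Longrightarrow> x \<in> half_open_cone B (A B) \<Longrightarrow> x \<in> C" for t C A
  proof -
    have "x \<in> C \<longleftrightarrow> (\<exists>B\<in>\<B>. x \<in> half_open_cone B (A B))" for x
      using ex1_implies_ex[OF C(1)[of x]] C(2)[of _ x] by auto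
    then have "{x\<in>\<Lambda>. h x = of_int t \<and> x \<in> C} =
        (\<Union>B\<in>\<B>. {x \<in> \<Lambda>. x \<in> half_open_cone B (A B) \<and> h x = of_int t})"
      by auto
    then have "card {x\<in>\<Lambda>. h x = of_int t \<and> x \<in> C} =
        card (\<Union>B\<in>\<B>. {x \<in> \<Lambda>. x \<in> half_open_cone B (A B) \<and> h x = of_int t})" by simp
    also have "\<dots> = (\<Sum>B\<in>\<B>. card {x \<in> \<Lambda>. x \<in> half_open_cone B (A B) \<and> h x = of_int t})"
    proof (rule card_UN_disjoint[OF fin\<B>])
      show "\<forall>B\<in>\<B>. finite {x \<in> \<Lambda>. x \<in> half_open_cone B (A B) \<and> h x = of_int t}"
        using finite_half_open_level B by blast
      show "\<forall>B\<in>\<B>. \<forall>B'\<in>\<B>. B \<noteq> B' \<longrightarrow> {x \<in> \<Lambda>. x \<in> half_open_cone B (A B) \<and> h x = of_int t} \<inter>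
          {x \<in> \<Lambda>. x \<in> half_open_cone B' (A B') \<and> h x = of_int t} = {}"
      proof (intro ballI impI equals0I)
        fix B B' x assume *: "B \<in> \<B>" "B' \<in> \<B>" "B \<noteq> B'"
          "x \<in> {x \<in> \<Lambda>. x \<in> half_open_cone B (A B) \<and> h x = of_int t} \<inter>
            {x \<in> \<Lambda>. x \<in> half_open_cone B' (A B') \<and> h x = of_int t}"
        then have "x \<in> C" using C(2)[of B x] by auto
        from C(1)[OF this] * show False by auto
      qed
    qed
    finally show ?thesis using card_half_open_level[OF B A t] by simp
  qed
  \<comment> \<open>Built from the interior decomposition; the closed count is reached only through
    the reflection at \<open>- t\<close>.\<close>
  define Q where "Q = (\<lambda>t. \<Sum>B\<in>\<B>. \<Sum>p\<in>parallelepiped B (pos B). residue_binomial D N (level p) t)"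
  have Qneg: "(-1) ^ D * Q (- t) = (\<Sum>B\<in>\<B>. \<Sum>p\<in>parallelepiped B (neg B). residue_binomial D N (level p) t)" for t
  proof -
    have "(\<Sum>p\<in>parallelepiped B (pos B). residue_binomial D N (level p) (- t)) =
        (-1) ^ D * (\<Sum>p\<in>parallelepiped B (neg B). residue_binomial D N (level p) t)" if "B \<in> \<B>" for B
      using sum_residue_binomial_reflect[OF BV[OF that] indep[OF that] cardB[OF that], of "pos B" t] compl[OF that] by (auto simp: pos_def)
    then have "Q (- t) = (-1) ^ D * (\<Sum>B\<in>\<B>. \<Sum>p\<in>parallelepiped B (neg B). residue_binomial D N (level p) t)"
      by (simp add: Q_def sum_distrib_left)
    then show ?thesis by (simp flip: mult.assoc power_add mult_2)
  qed
  have "\<exists>c. quasipolynomial D c Q"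
    unfolding Q_def
    using fin\<B> finite_parallelepiped B
    by (intro quasipolynomial_sum residue_binomial_quasipolynomial N_pos) auto
  then obtain c where c: "quasipolynomial D c Q" by blast
  obtain a where a: "\<forall>v\<in>V. 0 < a v" "q = (\<Sum>v\<in>V. a v *\<^sub>R v)" using q by blast
  have Qpos: "Q t = real (card {x\<in>\<Lambda>. h x = of_int t \<and> (\<exists>\<epsilon>>0. x - \<epsilon> *\<^sub>R q \<in> conic_span V)})" if "t > 0" for t
  proof -
    have "real (card {x\<in>\<Lambda>. h x = of_int t \<and> x \<in> {x. \<exists>\<epsilon>>0. x - \<epsilon> *\<^sub>R q \<in> conic_span V}}) = Q t"
      unfolding Q_def
    proof (rule count[OF that])
      show "\<exists>!B. B \<in> \<B> \<and> x \<in> half_open_cone B (pos B)" if "x \<in> {x. \<exists>\<epsilon>>0. x - \<epsilon> *\<^sub>R q \<in> conic_span V}" for x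
        using that open1[of _ x] unfolding pos_def by fastforce
      show "x \<in> {x. \<exists>\<epsilon>>0. x - \<epsilon> *\<^sub>R q \<in> conic_span V}" if "B \<in> \<B>" "x \<in> half_open_cone B (pos B)" for B x
        using open2[of B x] that unfolding pos_def by blast
    qed (auto simp: pos_def)
    then show ?thesis by simp
  qed
  have Qneg': "(-1) ^ D * Q (- t) = real (card {x\<in>\<Lambda>. h x = of_int t \<and> x \<in> conic_span V})" if "t > 0" for t
    unfolding Qneg
  proof (rule count[OF that, symmetric])
    show "\<exists>!B. B \<in> \<B> \<and> x \<in> half_open_cone B (neg B)" if "x \<in> conic_span V" for x
      using closed1[OF that] unfolding neg_def .
    show "x \<in> conic_span V" if "B \<in> \<B>" "x \<in> half_open_cone B (neg B)" for B x
      using closed2[of B] that unfolding neg_def by blast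
  qed (auto simp: neg_def)
  \<comment> \<open>Positive height gives \<open>q\<close> a positive coordinate in every cell, so
    no cell loses all its facets; the evaluation at 0 assumes this.\<close>
  have "h q = (\<Sum>v\<in>V. a v)" using h_sum[of V a] a(2) by simp
  also have "\<dots> > 0" using a(1) ne finite_V by (intro sum_pos) auto
  finally have hq: "h q > 0" .
  have qspan: "q \<in> span V" unfolding a(2) by (intro span_sum span_scale span_base)
  have "neg B \<subset> B" if BB: "B \<in> \<B>" for B
  proof (rule psubsetI)
    show "neg B \<noteq> B"
    proof
      assume "neg B = B"
      then have "representation B q b < 0" if "b \<in> B" for b using that unfolding neg_def by blast
      then have "(\<Sum>b\<in>B. representation B q b) \<le> 0" by (intro sum_nonpos) (simp add: less_imp_le)
      then show False using h_span[OF BV[OF BB] indep[OF BB] cardB[OF BB], of q] hq qspan spanB[OF BB] by auto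
    qed
  qed (auto simp: neg_def)
  \<comment> \<open>The closed side is evaluated at 0, where each cell contributes 1 or 0 according
    to whether it keeps the apex.\<close>
  then have "(-1) ^ D * Q (- 0) = (\<Sum>B\<in>\<B>. if neg B = {} then 1 else 0)"
    unfolding Qneg using sum_residue_binomial_0[OF B] by simp
  also have "\<dots> = real (card {B\<in>\<B>. neg B = {}})"
    using fin\<B> by (simp add: sum.If_cases Int_def)
  also have "{B\<in>\<B>. neg B = {}} = {B. B \<in> \<B> \<and> (\<forall>b\<in>B. 0 < representation B q b)}"
    using qnz by (force simp: neg_def not_less order_le_less)
  also have "\<dots> = {THE B. B \<in> \<B> \<and> (\<forall>b\<in>B. 0 < representation B q b)}"
    using theI'[OF qcell] the1_equality[OF qcell] by blast
  finally have "(-1) ^ D * Q 0 = 1" by simp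
  then show ?thesis using c a Qpos Qneg' by blast
qed

end

subsection \<open>Ehrhart theory of rational polytopes\<close>

lemma rationals_common_denominator:
  assumes "finite S" "S \<subseteq> (\<rat> :: real set)"
  shows "\<exists>N::nat. N > 0 \<and> (\<forall>x\<in>S. real N * x \<in> \<int>)"
  using assms
proof (induction S rule: finite_induct)
  case (insert x S)
  then obtain N where N: "N > 0" "\<forall>x\<in>S. real N * x \<in> \<int>" by auto
  obtain m n where mn: "n \<noteq> 0" "\<bar>x\<bar> = real m / real n" using insert.prems Rats_abs_nat_div_natE by (metis insert_subset)
  have "real n * \<bar>x\<bar> = real m" using mn by simp
  then have "real n * x = real m \<or> real n * x = - real m" by (auto simp: abs_if split: if_splits)
  then have "real n * x \<in> \<int>" by auto
  then have "real N * (real n * x) \<in> \<int>" by (intro Ints_mult[of "real N"]) auto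
  moreover have "real n * (real N * y) \<in> \<int>" if "y \<in> S" for y using N that by (intro Ints_mult[of "real n"]) auto
  ultimately show ?case using N mn by (intro exI[of _ "N * n"]) (auto simp: algebra_simps)
qed (auto intro: exI[of _ 1])

lemma common_denominator:
  fixes V :: "(real ^ 'n) set"
  assumes "finite V" "\<And>v i. v \<in> V \<Longrightarrow> v $ i \<in> \<rat>"
  shows "\<exists>N::nat. N > 0 \<and> (\<forall>v\<in>V. real N *\<^sub>R v \<in> integer_points)"
proof -
  have "finite (\<Union>v\<in>V. range (($) v))" "(\<Union>v\<in>V. range (($) v)) \<subseteq> \<rat>" using assms by auto
  from rationals_common_denominator[OF this] show ?thesis by (force simp: integer_points_def)
qed

lemma integer_points_0: "0 \<in> integer_points"
  by (simp add: integer_points_def)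

lemma integer_points_add: "x \<in> integer_points \<Longrightarrow> y \<in> integer_points \<Longrightarrow> x + y \<in> integer_points"
  by (simp add: integer_points_def)

lemma integer_points_uminus: "x \<in> integer_points \<Longrightarrow> - x \<in> integer_points"
  by (simp add: integer_points_def)

lemma integer_points_diff: "x \<in> integer_points \<Longrightarrow> y \<in> integer_points \<Longrightarrow> x - y \<in> integer_points"
  by (simp add: integer_points_def)

lemma integer_points_scale: "x \<in> integer_points \<Longrightarrow> of_int k *\<^sub>R x \<in> integer_points"
  by (simp add: integer_points_def)

lemma integer_points_sum: "(\<And>i. i \<in> I \<Longrightarrow> f i \<in> integer_points) \<Longrightarrow> sum f I \<in> integer_points"
  by (induction I rule: infinite_finite_induct) (auto simp: integer_points_0 integer_points_add)

lemma finite_bounded_integer_points: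
  assumes "bounded S"
  shows "finite (integer_points \<inter> S :: (real ^ 'n) set)"
proof -
  obtain r where r: "\<And>x. x \<in> S \<Longrightarrow> norm x \<le> r" using assms by (auto simp: bounded_iff)
  define R where "R = \<lceil>r\<rceil>"
  have "integer_points \<inter> S \<subseteq> (\<lambda>f. \<chi> i. of_int (f i)) ` (UNIV \<rightarrow>\<^sub>E {-R..R})"
  proof clarify
    fix x assume x: "x \<in> integer_points" "x \<in> S"
    then have "\<forall>i. \<exists>k. x $ i = of_int k" by (auto simp: integer_points_def elim: Ints_cases)
    then obtain f where f: "\<And>i. x $ i = of_int (f i)" by metis
    have "\<bar>real_of_int (f i)\<bar> \<le> r" for i using component_le_norm_cart[of x i] r[OF x(2)] f[of i] by simp
    then have "f i \<in> {-R..R}" for i using abs_le_iff[of "real_of_int (f i)" r] by (auto simp: R_def) linarith+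
    then show "x \<in> (\<lambda>f. \<chi> i. of_int (f i)) ` (UNIV \<rightarrow>\<^sub>E {-R..R})"
      using f by (intro image_eqI[of _ _ f]) (auto simp: vec_eq_iff)
  qed
  then show ?thesis by (rule finite_subset) (auto intro!: finite_imageI finite_PiE)
qed

definition homogenize :: "(real ^ 'n) set \<Rightarrow> ((real ^ 'n) \<times> real) set" where
  "homogenize V = (\<lambda>v. (v, 1)) ` V"

lemma conic_span_homogenize:
  fixes V :: "(real ^ 'n) set"
  assumes V: "finite V" and t: "t > 0"
  shows "(x, t) \<in> conic_span (homogenize V) \<longleftrightarrow> (1 / t) *\<^sub>R x \<in> convex hull V"
proof -
  have sum: "(\<Sum>v\<in>homogenize V. c v *\<^sub>R v) = (\<Sum>v\<in>V. c (v, 1) *\<^sub>R (v, 1))" for c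
    unfolding homogenize_def by (subst sum.reindex) (auto simp: inj_on_def)
  have split: "(\<Sum>v\<in>V. u v *\<^sub>R (v, 1)) = (\<Sum>v\<in>V. u v *\<^sub>R v, sum u V)" for u :: "_ \<Rightarrow> real"
    by (induction V rule: infinite_finite_induct) (auto simp: zero_prod_def)
  show ?thesis
  proof
    assume "(x, t) \<in> conic_span (homogenize V)"
    then obtain c where c0: "(x, t) = (\<Sum>v\<in>V. c (v, 1) *\<^sub>R (v, 1))" "\<forall>v\<in>homogenize V. 0 \<le> c v"
      unfolding conic_span_def sum by blast
    then have c: "\<forall>v\<in>V. 0 \<le> c (v, 1)" "(x, t) = (\<Sum>v\<in>V. c (v, 1) *\<^sub>R (v, 1))"
      by (auto simp: homogenize_def)
    define u where "u = (\<lambda>v. c (v, 1) / t)"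
    have "x = (\<Sum>v\<in>V. c (v, 1) *\<^sub>R v)" "t = (\<Sum>v\<in>V. c (v, 1))" using c(2) split[of "\<lambda>v. c (v, 1)"] by auto
    then have "sum u V = 1" "(\<Sum>v\<in>V. u v *\<^sub>R v) = (1 / t) *\<^sub>R x"
      using t by (auto simp: u_def scaleR_sum_right simp flip: sum_divide_distrib)
    moreover have "\<forall>v\<in>V. 0 \<le> u v" using c t by (auto simp: u_def)
    ultimately show "(1 / t) *\<^sub>R x \<in> convex hull V" unfolding convex_hull_finite[OF V] by blast
  next
    assume "(1 / t) *\<^sub>R x \<in> convex hull V"
    then obtain u where u: "\<forall>v\<in>V. 0 \<le> u v" "sum u V = 1" "(\<Sum>v\<in>V. u v *\<^sub>R v) = (1 / t) *\<^sub>R x"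
      unfolding convex_hull_finite[OF V] by blast
    define c where "c = (\<lambda>v :: (real ^ 'n) \<times> real. t * u (fst v))"
    have "x = t *\<^sub>R ((1 / t) *\<^sub>R x)" using t by simp
    then have "x = (\<Sum>v\<in>V. (t * u v) *\<^sub>R v)" unfolding u(3)[symmetric] by (simp add: scaleR_sum_right)
    moreover have "t = (\<Sum>v\<in>V. t * u v)" using u(2) by (simp flip: sum_distrib_left)
    ultimately have "(x, t) = (\<Sum>v\<in>homogenize V. c v *\<^sub>R v)"
      unfolding sum c_def fst_conv split by simp
    moreover have "\<forall>v\<in>homogenize V. 0 \<le> c v" using u t by (auto simp: c_def homogenize_def)
    ultimately show "(x, t) \<in> conic_span (homogenize V)" unfolding conic_span_def by blast
  qed
qed

lemma snd_conic_span_homogenize: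
  assumes "y \<in> conic_span (homogenize V)"
  shows "0 \<le> snd y"
proof -
  obtain c where c: "\<forall>v\<in>homogenize V. 0 \<le> c v" "y = (\<Sum>v\<in>homogenize V. c v *\<^sub>R v)"
    using assms by (auto simp: conic_span_def)
  have "snd y = (\<Sum>v\<in>homogenize V. c v * snd v)" by (simp add: c(2) snd_sum)
  also have "\<dots> \<ge> 0" using c(1) by (intro sum_nonneg) (auto simp: homogenize_def)
  finally show ?thesis .
qed

text \<open>Normalized to height 1, \<open>q\<close> becomes a convex combination \<open>c\<close>
  with all weights positive, hence a relative interior point. Subtracting a multiple of
  \<open>q\<close> means prolonging the segment from \<open>c\<close> through
  \<open>(1 / t) *\<^sub>R x\<close> within the polytope, and this prolongation characterizes the
  relative interior.\<close>

lemma conic_interior_homogenize: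
  assumes V: "finite V" "V \<noteq> {}" and t: "t > 0"
    and a: "\<forall>v\<in>homogenize V. 0 < a v" and q: "q = (\<Sum>v\<in>homogenize V. a v *\<^sub>R v)"
  shows "(\<exists>\<epsilon>>0. (x, t) - \<epsilon> *\<^sub>R q \<in> conic_span (homogenize V)) \<longleftrightarrow>
     (1 / t) *\<^sub>R x \<in> rel_interior (convex hull V)"
proof -
  let ?P = "convex hull V"
  obtain q0 k where qk: "q = (q0, k)" by (cases q)
  have "q = (\<Sum>v\<in>V. a (v, 1) *\<^sub>R (v, 1))"
    unfolding q homogenize_def by (subst sum.reindex) (auto simp: inj_on_def)
  then have q0: "q0 = (\<Sum>v\<in>V. a (v, 1) *\<^sub>R v)" and k: "k = (\<Sum>v\<in>V. a (v, 1))"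
    using qk by (auto simp: prod_eq_iff fst_sum snd_sum)
  have apos: "\<forall>v\<in>V. 0 < a (v, 1)" using a by (auto simp: homogenize_def)
  have kpos: "k > 0" unfolding k using V apos by (intro sum_pos) auto
  define c where "c = (1 / k) *\<^sub>R q0"
  have "\<forall>v\<in>V. 0 < a (v, 1) / k" "(\<Sum>v\<in>V. a (v, 1) / k) = 1" "(\<Sum>v\<in>V. (a (v, 1) / k) *\<^sub>R v) = c"
    using apos kpos k by (auto simp: c_def q0 scaleR_sum_right simp flip: sum_divide_distrib)
  then have c: "c \<in> rel_interior ?P"
    by (intro subsetD[OF explicit_subset_rel_interior_convex_hull_minimal[OF V(1)]] CollectI
        exI[of _ "\<lambda>v. a (v, 1) / k"]) auto
  have q0c: "q0 = k *\<^sub>R c" using kpos by (simp add: c_def)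
  have qC: "q \<in> conic_span (homogenize V)" unfolding q conic_span_def using a by (auto intro: less_imp_le)
  show ?thesis
  proof
    assume "\<exists>\<epsilon>>0. (x, t) - \<epsilon> *\<^sub>R q \<in> conic_span (homogenize V)"
    then obtain \<epsilon> where \<epsilon>: "\<epsilon> > 0" "(x, t) - \<epsilon> *\<^sub>R q \<in> conic_span (homogenize V)" by auto
    \<comment> \<open>At \<epsilon> itself the height \<open>t - \<epsilon> * k\<close> may be 0,
      where no slice exists; half of it leaves a positive height.\<close>
    define \<delta> where "\<delta> = \<epsilon> / 2"
    have "((x, t) - \<epsilon> *\<^sub>R q) + \<delta> *\<^sub>R q \<in> conic_span (homogenize V)"
      using \<epsilon> by (intro conic_span_add conic_span_scale qC) (auto simp: \<delta>_def)
    moreover have "((x, t) - \<epsilon> *\<^sub>R q) + \<delta> *\<^sub>R q = (x - \<delta> *\<^sub>R q0, t - \<delta> * k)"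
      by (simp add: qk \<delta>_def algebra_simps flip: scaleR_add_left)
    ultimately have in_C: "(x - \<delta> *\<^sub>R q0, t - \<delta> * k) \<in> conic_span (homogenize V)" by simp
    have "0 \<le> t - \<epsilon> * k" using snd_conic_span_homogenize[OF \<epsilon>(2)] by (simp add: qk)
    moreover have "\<delta> * k > 0" "\<epsilon> * k = \<delta> * k + \<delta> * k" using \<epsilon>(1) kpos by (auto simp: \<delta>_def)
    ultimately have pos: "0 < t - \<delta> * k" by linarith
    define y where "y = (1 / (t - \<delta> * k)) *\<^sub>R (x - \<delta> *\<^sub>R q0)"
    have y: "y \<in> ?P" using in_C conic_span_homogenize[OF V(1) pos] by (simp add: y_def)
    have xe: "x = (t - \<delta> * k) *\<^sub>R y + \<delta> *\<^sub>R q0" using pos by (simp add: y_def)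
    have "(1 / t) *\<^sub>R x = ((t - \<delta> * k) / t) *\<^sub>R y + (\<delta> * k / t) *\<^sub>R c"
      unfolding xe q0c by (simp add: scaleR_add_right)
    also have "\<dots> = y - (\<delta> * k / t) *\<^sub>R (y - c)"
      using t by (simp add: diff_divide_distrib algebra_simps)
    also have "\<dots> \<in> rel_interior ?P"
      using \<open>\<delta> * k > 0\<close> t pos y c by (intro rel_interior_convex_shrink) auto
    finally show "(1 / t) *\<^sub>R x \<in> rel_interior ?P" .
  next
    assume rel: "(1 / t) *\<^sub>R x \<in> rel_interior ?P"
    have "c \<in> ?P" using c rel_interior_subset by auto
    then obtain e where e: "e > 1" "(1 - e) *\<^sub>R c + e *\<^sub>R (1 / t) *\<^sub>R x \<in> ?P"
      using convex_rel_interior_iff[of ?P "(1 / t) *\<^sub>R x"] rel V by auto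
    \<comment> \<open>Chosen so that the remaining height \<open>t - \<epsilon> * k\<close> equals
      \<open>t / e\<close>, where the slice point is the prolonged point of the polytope.\<close>
    define \<epsilon> where "\<epsilon> = t * (1 - 1 / e) / k"
    have \<epsilon>: "\<epsilon> > 0" using t e kpos by (auto simp: \<epsilon>_def)
    have ek: "\<epsilon> * k = t - t / e" using kpos by (simp add: \<epsilon>_def right_diff_distrib)
    have te: "t / e > 0" using t e by simp
    have "(1 / (t / e)) *\<^sub>R (x - \<epsilon> *\<^sub>R q0) = (e / t) *\<^sub>R x - (e / t * (\<epsilon> * k)) *\<^sub>R c"
      by (simp add: q0c scaleR_diff_right)
    also have "e / t * (\<epsilon> * k) = e - 1" unfolding ek using t e by (simp add: field_simps)
    finally have "(1 / (t / e)) *\<^sub>R (x - \<epsilon> *\<^sub>R q0) = (1 - e) *\<^sub>R c + e *\<^sub>R (1 / t) *\<^sub>R x"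
      by (simp add: algebra_simps)
    then have "(x - \<epsilon> *\<^sub>R q0, t / e) \<in> conic_span (homogenize V)"
      using conic_span_homogenize[OF V(1) te] e(2) by simp
    moreover have "(x, t) - \<epsilon> *\<^sub>R q = (x - \<epsilon> *\<^sub>R q0, t / e)" using ek by (simp add: qk)
    ultimately show "\<exists>\<epsilon>>0. (x, t) - \<epsilon> *\<^sub>R q \<in> conic_span (homogenize V)" using \<epsilon> by auto
  qed
qed

text \<open>At height 1 the affine hull misses the origin, so adjoining 0 raises the affine
  dimension by one and turns it into the linear dimension.\<close>

lemma dim_homogenize:
  fixes V :: "(real ^ 'n) set"
  shows "int (dim (homogenize V)) = aff_dim V + 1"
proof -
  have eq: "homogenize V = (+) (0, 1) ` (\<lambda>v. (v, 0)) ` V" by (auto simp: homogenize_def image_image)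
  have lin: "linear (\<lambda>v :: real ^ 'n. (v, 0 :: real))" by (intro linearI) auto
  have inj: "inj (\<lambda>v :: real ^ 'n. (v, 0 :: real))" by (auto simp: inj_def)
  have dimV: "aff_dim (homogenize V) = aff_dim V"
    unfolding eq aff_dim_translation_eq aff_dim_injective_linear_image[OF lin inj] ..
  have "affine {y :: (real ^ 'n) \<times> real. snd y = 1}"
    by (auto simp: affine_def)
  then have "affine hull (homogenize V) \<subseteq> {y. snd y = 1}"
    by (intro hull_minimal) (auto simp: homogenize_def)
  then have notin: "0 \<notin> affine hull (homogenize V)" by auto
  have "int (dim (insert 0 (homogenize V))) = aff_dim (insert 0 (homogenize V))"
    by (rule aff_dim_zero[symmetric]) (simp add: hull_inc)
  then show ?thesis using notin dimV by (simp add: aff_dim_insert dim_insert span_zero)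
qed

lemma card_scaled_slice:
  fixes S :: "(real ^ 'n) set"
  assumes t: "t > (0 :: nat)"
  shows "card {y \<in> integer_points \<times> (\<int> :: real set). snd y = of_int (int t) \<and> (1 / real t) *\<^sub>R fst y \<in> S} =
     card (integer_points \<inter> (\<lambda>y. real t *\<^sub>R y) ` S)"
proof -
  have "x \<in> (\<lambda>y. real t *\<^sub>R y) ` S \<longleftrightarrow> (1 / real t) *\<^sub>R x \<in> S" for x
    using t by (auto simp: image_iff intro: bexI[of _ "(1 / real t) *\<^sub>R x"])
  then have "{y \<in> integer_points \<times> (\<int> :: real set). snd y = of_int (int t) \<and> (1 / real t) *\<^sub>R fst y \<in> S} =
    (\<lambda>x. (x, real t)) ` (integer_points \<inter> (\<lambda>y. real t *\<^sub>R y) ` S)"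
    by force
  then show ?thesis by (simp add: card_image inj_on_def)
qed

text \<open>The closed Ehrhart function is \<open>t \<mapsto> (-1) ^ D * Q (- t)\<close>; the last
  clause is its value at 0.\<close>

theorem ehrhart_reciprocity:
  fixes V :: "(real ^ 'n) set"
  assumes V: "finite V" "V \<noteq> {}" "\<And>v i. v \<in> V \<Longrightarrow> v $ i \<in> \<rat>" and D: "D = nat (aff_dim V)"
  shows "\<exists>Q c. quasipolynomial D c Q \<and>
    (\<forall>t::nat. t > 0 \<longrightarrow> Q (int t) =
       real (card (integer_points \<inter> (\<lambda>y. real t *\<^sub>R y) ` rel_interior (convex hull V)))) \<and>
    (\<forall>t::nat. t > 0 \<longrightarrow> (-1) ^ D * Q (- int t) =
       real (card (integer_points \<inter> (\<lambda>y. real t *\<^sub>R y) ` (convex hull V)))) \<and>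
    (-1) ^ D * Q 0 = 1"
proof -
  obtain N where N: "N > 0" "\<And>v. v \<in> V \<Longrightarrow> real N *\<^sub>R v \<in> integer_points"
    using common_denominator[OF V(1,3)] by auto
  have fin: "finite (homogenize V)" using V by (simp add: homogenize_def)
  interpret lattice_cone "homogenize V" snd "integer_points \<times> \<int>" N
  proof (intro lattice_cone.intro height_cone.intro lattice_cone_axioms.intro)
    show "linear (snd :: (real ^ 'n) \<times> real \<Rightarrow> real)" by (rule linear_snd)
    show "finite {x \<in> (integer_points :: (real ^ 'n) set) \<times> (\<int> :: real set). norm x \<le> r}" for r
    proof (rule finite_subset)
      show "{x \<in> (integer_points :: (real ^ 'n) set) \<times> (\<int> :: real set). norm x \<le> r} \<subseteq>
          (integer_points \<inter> cball 0 r) \<times> {x \<in> \<int>. \<bar>x\<bar> \<le> r}"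
        using norm_fst_le norm_snd_le order_trans by (fastforce simp: dist_norm)
      show "finite ((integer_points \<inter> cball 0 r) \<times> {x \<in> \<int>. \<bar>x\<bar> \<le> r} :: ((real ^ 'n) \<times> real) set)"
        using finite_abs_int_segment[of r] by (intro finite_cartesian_product finite_bounded_integer_points) auto
    qed
  qed (use fin N in \<open>auto simp: homogenize_def integer_points_0 integer_points_add integer_points_uminus zero_prod_def\<close>)
  have "aff_dim V \<ge> 0" using V(2) aff_dim_geq[of V] aff_dim_empty[of V] by linarith
  then have dim: "dim (homogenize V) = Suc D" using dim_homogenize[of V] D by linarith
  have "homogenize V \<noteq> {}" using V by (simp add: homogenize_def)
  from cone_ehrhart[OF this dim] obtain Q c q a where Q: "quasipolynomial D c Q"
    "\<forall>v\<in>homogenize V. 0 < a v" "q = (\<Sum>v\<in>homogenize V. a v *\<^sub>R v)"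
    "\<And>t. t > 0 \<Longrightarrow> Q t = real (card {x\<in>integer_points \<times> \<int>. snd x = of_int t \<and>
        (\<exists>\<epsilon>>0. x - \<epsilon> *\<^sub>R q \<in> conic_span (homogenize V))})"
    "\<And>t. t > 0 \<Longrightarrow> (-1) ^ D * Q (- t) = real (card {x\<in>integer_points \<times> \<int>. snd x = of_int t \<and>
        x \<in> conic_span (homogenize V)})"
    "(-1) ^ D * Q 0 = 1" by blast
  have "Q (int t) = real (card (integer_points \<inter> (\<lambda>y. real t *\<^sub>R y) ` rel_interior (convex hull V)))" if t: "t > 0" for t
  proof -
    have "(\<exists>\<epsilon>>0. x - \<epsilon> *\<^sub>R q \<in> conic_span (homogenize V)) \<longleftrightarrow>
        (1 / real t) *\<^sub>R fst x \<in> rel_interior (convex hull V)" if "snd x = real t" for x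
      using conic_interior_homogenize[OF V(1,2) _ Q(2,3), of "real t" "fst x"] t that by (metis of_nat_0_less_iff prod.collapse)
    then have "{x\<in>integer_points \<times> \<int>. snd x = of_int (int t) \<and> (\<exists>\<epsilon>>0. x - \<epsilon> *\<^sub>R q \<in> conic_span (homogenize V))} =
      {x\<in>integer_points \<times> \<int>. snd x = of_int (int t) \<and> (1 / real t) *\<^sub>R fst x \<in> rel_interior (convex hull V)}"
      by (intro Collect_cong) auto
    then show ?thesis using Q(4)[of "int t"] t card_scaled_slice[OF t] by simp
  qed
  moreover have "(-1) ^ D * Q (- int t) = real (card (integer_points \<inter> (\<lambda>y. real t *\<^sub>R y) ` (convex hull V)))" if t: "t > 0" for t
  proof -
    have "x \<in> conic_span (homogenize V) \<longleftrightarrow> (1 / real t) *\<^sub>R fst x \<in> convex hull V" if "snd x = real t" for x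
      using conic_span_homogenize[OF V(1), of "real t" "fst x"] t that by (metis of_nat_0_less_iff prod.collapse)
    then have "{x\<in>integer_points \<times> \<int>. snd x = of_int (int t) \<and> x \<in> conic_span (homogenize V)} =
      {x\<in>integer_points \<times> \<int>. snd x = of_int (int t) \<and> (1 / real t) *\<^sub>R fst x \<in> convex hull V}"
      by (intro Collect_cong) auto
    then show ?thesis using Q(5)[of "int t"] t card_scaled_slice[OF t] by simp
  qed
  ultimately show ?thesis using Q(1,6) by blast
qed

subsection \<open>Cutting a rational polytope by coordinate inequalities\<close>

lemma conic_span_sum: "(\<And>i. i \<in> I \<Longrightarrow> f i \<in> conic_span V) \<Longrightarrow> sum f I \<in> conic_span V"
proof (induction I rule: infinite_finite_induct)
  case (insert i I)
  then show ?case by (simp add: conic_span_add)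
qed (auto simp: conic_span_def intro: exI[of _ "\<lambda>_. 0"])

lemma conic_span_base: "finite V \<Longrightarrow> v \<in> V \<Longrightarrow> v \<in> conic_span V"
  unfolding conic_span_def
  by (intro CollectI exI[of _ "\<lambda>w. if w = v then 1 else 0"]) (auto simp: if_distrib[of "\<lambda>c. c *\<^sub>R _"] cong: if_cong)

text \<open>A positive and a negative vertex contribute the point where their segment crosses \<open>l = 0\<close>.\<close>

lemma convex_hull_Int_halfspace:
  fixes V :: "(real ^ 'n) set" and l :: "real ^ 'n \<Rightarrow> real"
  assumes V: "finite V" and l: "linear l"
  defines "W \<equiv> {v\<in>V. l v \<le> 0} \<union>
     (\<lambda>(v, v'). (1 / (l v - l v')) *\<^sub>R (l v *\<^sub>R v' - l v' *\<^sub>R v)) ` ({v\<in>V. 0 < l v} \<times> {v\<in>V. l v < 0})"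
  shows "convex hull V \<inter> {x. l x \<le> 0} = convex hull W"
proof
  have finW: "finite W" using V unfolding W_def by auto
  define cr where "cr = (\<lambda>v v'. (1 / (l v - l v')) *\<^sub>R (l v *\<^sub>R v' - l v' *\<^sub>R v))"
  have W: "W = {v\<in>V. l v \<le> 0} \<union> (\<lambda>(v, v'). cr v v') ` ({v\<in>V. 0 < l v} \<times> {v\<in>V. l v < 0})"
    unfolding W_def cr_def ..
  have cr_in: "cr v v' \<in> convex hull V" "l (cr v v') = 0" if "v \<in> V" "v' \<in> V" "0 < l v" "l v' < 0" for v v'
  proof -
    have eq: "cr v v' = (- l v' / (l v - l v')) *\<^sub>R v + (l v / (l v - l v')) *\<^sub>R v'"
      using that by (simp add: cr_def algebra_simps)
    have "l v - l v' \<noteq> 0" using that by simp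
    then have "- l v' / (l v - l v') + l v / (l v - l v') = 1"
      by (simp only: add_divide_distrib[symmetric]) simp
    then show "cr v v' \<in> convex hull V" unfolding eq
      using that by (intro convexD[OF convex_convex_hull] hull_inc) (auto intro: divide_nonpos_pos)
    show "l (cr v v') = 0" using l by (simp add: cr_def linear_cmul linear_diff)
  qed
  have conv: "convex {x. l x \<le> 0}"
  proof (rule convexI)
    fix x y u v assume xy: "x \<in> {x. l x \<le> 0}" "y \<in> {x. l x \<le> 0}" "0 \<le> u" "0 \<le> v" "u + v = (1 :: real)"
    have "l (u *\<^sub>R x + v *\<^sub>R y) = u * l x + v * l y" using l by (simp add: linear_add linear_cmul)
    also have "\<dots> \<le> 0" using xy by (auto intro!: add_nonpos_nonpos mult_nonneg_nonpos)
    finally show "u *\<^sub>R x + v *\<^sub>R y \<in> {x. l x \<le> 0}" by simp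
  qed
  show "convex hull W \<subseteq> convex hull V \<inter> {x. l x \<le> 0}"
    unfolding W using cr_in by (intro hull_minimal convex_Int conv convex_convex_hull) (auto intro: hull_inc)
  show "convex hull V \<inter> {x. l x \<le> 0} \<subseteq> convex hull W"
  proof clarify
    fix x assume "x \<in> convex hull V" and lx: "l x \<le> 0"
    then obtain u where u: "\<forall>v\<in>V. 0 \<le> u v" "sum u V = 1" "(\<Sum>v\<in>V. u v *\<^sub>R v) = x"
      unfolding convex_hull_finite[OF V] by blast
    \<comment> \<open>In the homogenized cone the weights need no normalization, so sums of
      contributions can be handled separately.\<close>
    define C where "C = conic_span (homogenize W)"
    have gen: "(w, 1) \<in> C" if "w \<in> W" for w
      unfolding C_def using finW that by (intro conic_span_base) (auto simp: homogenize_def)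
    define e where "e = (\<lambda>v :: real ^ 'n. (v, 1 :: real))"
    let ?P = "{v\<in>V. 0 < l v}" and ?N = "{v\<in>V. l v < 0}" and ?Z = "{v\<in>V. l v = 0}"
    have split: "sum f V = sum f ?P + sum f ?N + sum f ?Z" for f :: "_ \<Rightarrow> 'b::comm_monoid_add"
    proof -
      have "V = ?P \<union> ?N \<union> ?Z" by auto
      then have "sum f V = sum f (?P \<union> ?N \<union> ?Z)" by simp
      also have "\<dots> = sum f ?P + sum f ?N + sum f ?Z"
        using V by (subst sum.union_disjoint; (subst sum.union_disjoint)?) auto
      finally show ?thesis .
    qed
    \<comment> \<open>Total excess of \<open>l\<close> on the positive side, against the total
      deficit \<open>n\<close> on the negative side; \<open>l x \<le> 0\<close> says that the
      deficit covers the excess.\<close>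
    define p where "p = (\<Sum>v\<in>?P. u v * l v)"
    define n where "n = (\<Sum>v\<in>?N. u v * (- l v))"
    have p0: "p \<ge> 0" unfolding p_def using u(1) by (intro sum_nonneg) auto
    have "l x = (\<Sum>v\<in>V. u v * l v)" unfolding u(3)[symmetric] using l by (simp add: linear_sum linear_cmul)
    also have "\<dots> = p - n" unfolding split p_def n_def by (simp add: sum_negf)
    finally have pn: "p \<le> n" using lx by simp
    have xe: "(x, 1) = (\<Sum>v\<in>V. u v *\<^sub>R e v)"
      using u by (simp add: prod_eq_iff fst_sum snd_sum e_def)
    have neg_in: "e v \<in> C" if "v \<in> ?N" for v unfolding e_def using that by (intro gen) (auto simp: W)
    have zero_in: "e v \<in> C" if "v \<in> ?Z" for v unfolding e_def using that by (intro gen) (auto simp: W)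
    have Z_in: "(\<Sum>v\<in>?Z. u v *\<^sub>R e v) \<in> C"
      using zero_in u(1) unfolding C_def by (intro conic_span_sum conic_span_scale) auto
    have "(\<Sum>v\<in>?P. u v *\<^sub>R e v) + (\<Sum>v\<in>?N. u v *\<^sub>R e v) \<in> C"
    proof (cases "n = 0")
      case True
      then have "p = 0" using pn p0 by simp
      then have "\<forall>v\<in>?P. u v * l v = 0" unfolding p_def using u(1) V
        by (subst (asm) sum_nonneg_eq_0_iff) auto
      then have "(\<Sum>v\<in>?P. u v *\<^sub>R e v) = 0" by (intro sum.neutral) auto
      moreover have "(\<Sum>v\<in>?N. u v *\<^sub>R e v) \<in> C"
        using neg_in u(1) unfolding C_def by (intro conic_span_sum conic_span_scale) auto
      ultimately show ?thesis by simp
    next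
      case False
      then have n: "n > 0" using pn p0 by simp
      let ?S = "\<Sum>v\<in>?N. u v *\<^sub>R e v"
      \<comment> \<open>A transport plan: each positive vertex is matched with all negative ones in
        proportion to their deficits. This uses up the positive vertices and the fraction
        \<open>p / n\<close> of each negative one; the rest stays at vertices that survive the
        cut.\<close>
      have pair: "(u v * u v' / n * (l v - l v')) *\<^sub>R (cr v v', 1) =
          (u v * l v / n) *\<^sub>R (u v' *\<^sub>R e v') + (u v' * (- l v') / n) *\<^sub>R (u v *\<^sub>R e v)" if "v \<in> ?P" "v' \<in> ?N" for v v'
      proof -
        have "l v - l v' \<noteq> 0" using that by auto
        then have "(u v * u v' / n * (l v - l v')) *\<^sub>R (cr v v', 1) =
            ((u v * u v' / n) *\<^sub>R (l v *\<^sub>R v' - l v' *\<^sub>R v), u v * u v' / n * (l v - l v'))"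
          by (simp add: cr_def)
        also have "\<dots> = (u v * l v / n) *\<^sub>R (u v' *\<^sub>R e v') + (u v' * (- l v') / n) *\<^sub>R (u v *\<^sub>R e v)"
          by (simp add: e_def scaleR_diff_right right_diff_distrib diff_divide_distrib mult_ac)
        finally show ?thesis .
      qed
      have "(\<Sum>v\<in>?P. \<Sum>v'\<in>?N. (u v * u v' / n * (l v - l v')) *\<^sub>R (cr v v', 1)) =
        (\<Sum>v\<in>?P. \<Sum>v'\<in>?N. (u v * l v / n) *\<^sub>R (u v' *\<^sub>R e v') + (u v' * (- l v') / n) *\<^sub>R (u v *\<^sub>R e v))"
        by (intro sum.cong refl pair)
      also have "\<dots> = (\<Sum>v\<in>?P. (u v * l v / n) *\<^sub>R ?S + (\<Sum>v'\<in>?N. u v' * (- l v') / n) *\<^sub>R (u v *\<^sub>R e v))"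
        by (simp only: sum.distrib scaleR_sum_left scaleR_sum_right)
      also have "\<dots> = (\<Sum>v\<in>?P. u v * l v / n) *\<^sub>R ?S + (\<Sum>v'\<in>?N. u v' * (- l v') / n) *\<^sub>R (\<Sum>v\<in>?P. u v *\<^sub>R e v)"
        by (simp only: sum.distrib scaleR_sum_left[where A = "?P"] scaleR_sum_right[where A = "?P"])
      also have "(\<Sum>v\<in>?P. u v * l v / n) = p / n" by (simp only: p_def sum_divide_distrib)
      also have "(\<Sum>v'\<in>?N. u v' * (- l v') / n) = 1" using n by (simp only: n_def flip: sum_divide_distrib) simp
      finally have eq: "(\<Sum>v\<in>?P. u v *\<^sub>R e v) + ?S =
          (\<Sum>v\<in>?P. \<Sum>v'\<in>?N. (u v * u v' / n * (l v - l v')) *\<^sub>R (cr v v', 1)) + (1 - p / n) *\<^sub>R ?S"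
        by (simp add: scaleR_diff_left)
      have "(\<Sum>v\<in>?P. \<Sum>v'\<in>?N. (u v * u v' / n * (l v - l v')) *\<^sub>R (cr v v', 1)) \<in> C"
        unfolding C_def
      proof (intro conic_span_sum conic_span_scale)
        fix v v' assume vv': "v \<in> ?P" "v' \<in> ?N"
        show "(cr v v', 1) \<in> conic_span (homogenize W)" using gen[of "cr v v'"] vv' by (auto simp: W C_def)
        show "0 \<le> u v * u v' / n * (l v - l v')" using vv' u(1) n by (intro mult_nonneg_nonneg divide_nonneg_pos) auto
      qed
      moreover have "(1 - p / n) *\<^sub>R ?S \<in> C" unfolding C_def
        using pn n neg_in u(1) by (intro conic_span_scale conic_span_sum) (auto simp: C_def)
      ultimately show ?thesis unfolding eq unfolding C_def by (rule conic_span_add)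
    qed
    then have "(x, 1) \<in> C" unfolding xe split using Z_in unfolding C_def by (rule conic_span_add)
    then show "x \<in> convex hull W" using conic_span_homogenize[OF finW, of 1 x] by (simp add: C_def)
  qed
qed

text \<open>The inequalities are imposed one at a time; crossing points stay rational because
  \<open>l\<close> takes rational values on rational points.\<close>

lemma rational_convex_hull_Int_order:
  fixes V :: "(real ^ 'n) set"
  assumes V: "finite V" "\<And>v i. v \<in> V \<Longrightarrow> v $ i \<in> \<rat>" and S: "finite S"
  shows "\<exists>W. finite W \<and> (\<forall>v\<in>W. \<forall>i. v $ i \<in> \<rat>) \<and>
    convex hull V \<inter> {x. \<forall>(j, k)\<in>S. x $ j \<le> x $ k} = convex hull W"
  using S
proof (induction S rule: finite_induct)
  case empty
  then show ?case using V by (intro exI[of _ V]) auto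
next
  case (insert jk S)
  obtain j k where jk: "jk = (j, k)" by (cases jk)
  obtain W where W: "finite W" "\<forall>v\<in>W. \<forall>i. v $ i \<in> \<rat>"
    "convex hull V \<inter> {x. \<forall>(j, k)\<in>S. x $ j \<le> x $ k} = convex hull W" using insert.IH by blast
  define l where "l = (\<lambda>x :: real ^ 'n. x $ j - x $ k)"
  have l: "linear l" unfolding l_def by (intro linearI) (auto simp: algebra_simps)
  have lQ: "l v \<in> \<rat>" if "v \<in> W" for v using W(2) that by (auto simp: l_def intro: Rats_diff)
  let ?W = "{v\<in>W. l v \<le> 0} \<union>
     (\<lambda>(v, v'). (1 / (l v - l v')) *\<^sub>R (l v *\<^sub>R v' - l v' *\<^sub>R v)) ` ({v\<in>W. 0 < l v} \<times> {v\<in>W. l v < 0})"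
  have "convex hull V \<inter> {x. \<forall>(j, k)\<in>insert jk S. x $ j \<le> x $ k} = convex hull W \<inter> {x. l x \<le> 0}"
    unfolding W(3)[symmetric] by (auto simp: jk l_def)
  also have "\<dots> = convex hull ?W" by (rule convex_hull_Int_halfspace[OF W(1) l])
  finally have "convex hull V \<inter> {x. \<forall>(j, k)\<in>insert jk S. x $ j \<le> x $ k} = convex hull ?W" .
  moreover have "finite ?W" using W(1) by auto
  moreover have "\<forall>v\<in>?W. \<forall>i. v $ i \<in> \<rat>"
    using W(2) lQ by (auto intro!: Rats_divide Rats_diff Rats_mult)
  ultimately show ?case by blast
qed

subsection \<open>Lattice bases\<close>

text \<open>Modulo \<open>span E\<close> the integer points are determined by their coordinate at
  \<open>e\<close>, and these coordinates form a discrete group. A point \<open>b\<close> with the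
  least positive one generates it and extends a basis of the smaller lattice.\<close>

lemma lattice_basis_integer_points_Int_span:
  fixes E :: "(real ^ 'n) set"
  assumes "finite E" "independent E" "E \<subseteq> integer_points"
  shows "\<exists>B. lattice_basis (integer_points \<inter> span E) B"
  using assms
proof (induction E rule: finite_induct)
  case empty
  have "lattice_basis (integer_points \<inter> span {}) ({} :: (real ^ 'n) set)"
    by (auto simp: lattice_basis_def integer_points_0 independent_empty)
  then show ?case by blast
next
  case (insert e E)
  let ?E = "insert e E"
  have indE: "independent E" using insert.prems(1) by (rule independent_mono) auto
  then obtain B where B: "lattice_basis (integer_points \<inter> span E) B" using insert by auto
  have finE: "finite ?E" using insert by auto
  note ind = insert.prems(1)
  let ?r = "representation ?E"
  \<comment> \<open>The box makes the candidates finitely many, and \<open>e\<close> is one of them.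
    Subtracting integer multiples of \<open>E\<close> moves any integer point with
    \<open>e\<close>-coordinate in \<open>(0, 1]\<close> into the box without changing that
    coordinate, so a minimum over \<open>M\<close> is a minimum over all of them.\<close>
  define M where "M = {x \<in> integer_points \<inter> span ?E. (\<forall>f\<in>E. 0 \<le> ?r x f \<and> ?r x f < 1) \<and> 0 < ?r x e \<and> ?r x e \<le> 1}"
  have "M \<subseteq> integer_points \<inter> cball 0 (\<Sum>f\<in>?E. norm f)"
  proof
    fix x assume x: "x \<in> M"
    then have "x = (\<Sum>f\<in>?E. ?r x f *\<^sub>R f)" using sum_representation[OF ind finE] by (auto simp: M_def)
    then have "norm x \<le> (\<Sum>f\<in>?E. norm (?r x f *\<^sub>R f))" by (metis norm_sum)
    also have "\<dots> \<le> (\<Sum>f\<in>?E. norm f)"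
      using x by (intro sum_mono) (auto simp: M_def intro!: mult_left_le_one_le)
    finally show "x \<in> integer_points \<inter> cball 0 (\<Sum>f\<in>?E. norm f)" using x by (auto simp: M_def)
  qed
  then have finM: "finite M" using finite_bounded_integer_points[OF bounded_cball] finite_subset by blast
  have "e \<in> M" using insert real_vector.representation_basis[OF ind, of e]
    by (auto simp: M_def span_base)
  then have "M \<noteq> {}" by auto
  then obtain b where b: "b \<in> M" and bmin: "\<And>x. x \<in> M \<Longrightarrow> ?r b e \<le> ?r x e"
    using arg_min_if_finite[OF finM, of "\<lambda>x. ?r x e"] by (metis linorder_not_less)
  have bI: "b \<in> integer_points" "b \<in> span ?E" "0 < ?r b e" "?r b e \<le> 1" using b by (auto simp: M_def)
  have spanE: "x \<in> span E \<longleftrightarrow> ?r x e = 0" if "x \<in> span ?E" for x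
  proof
    assume "x \<in> span E"
    then have "?r x = representation E x" using real_vector.representation_extend[OF ind] by blast
    then show "?r x e = 0" using real_vector.representation_ne_zero[of E x e] insert.hyps by auto
  next
    assume "?r x e = 0"
    then have "(\<Sum>f\<in>E. ?r x f *\<^sub>R f) = x" using sum_representation[OF ind finE that] insert.hyps by simp
    moreover have "(\<Sum>f\<in>E. ?r x f *\<^sub>R f) \<in> span E" by (intro span_sum span_scale span_base)
    ultimately show "x \<in> span E" by simp
  qed
  have finB: "finite B" "independent B" using B by (auto simp: lattice_basis_def)
  have Bsub: "B \<subseteq> integer_points \<inter> span E" 
  proof
    fix c assume c: "c \<in> B"
    have "c = (\<Sum>d\<in>B. of_int (if d = c then 1 else 0) *\<^sub>R d)"
      using c finB(1) by (simp add: sum.remove[of B c])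
    then have "c \<in> range (\<lambda>m :: _ \<Rightarrow> int. \<Sum>d\<in>B. of_int (m d) *\<^sub>R d)"
      by (rule range_eqI[where x = "\<lambda>d. if d = c then 1 else 0"])
    moreover have "integer_points \<inter> span E = range (\<lambda>m :: _ \<Rightarrow> int. \<Sum>d\<in>B. of_int (m d) *\<^sub>R d)"
      using B by (simp add: lattice_basis_def)
    ultimately show "c \<in> integer_points \<inter> span E" by simp
  qed
  have bnot: "b \<notin> span E" using spanE[OF bI(2)] bI(3) by auto
  have "span B \<subseteq> span E" using Bsub by (intro span_minimal) auto
  with bnot have bB: "b \<notin> B" "b \<notin> span B" using Bsub by auto
  have red: "\<exists>k :: int. x - of_int k *\<^sub>R b \<in> integer_points \<inter> span E" if x: "x \<in> integer_points" "x \<in> span ?E" for x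
  proof -
    define k where "k = \<lfloor>?r x e / ?r b e\<rfloor>"
    define y where "y = x - of_int k *\<^sub>R b"
    have y: "y \<in> integer_points" "y \<in> span ?E"
      using x bI by (auto simp: y_def integer_points_diff integer_points_scale span_diff span_scale)
    have ry: "?r y e = ?r x e - of_int k * ?r b e"
      using x bI by (simp add: y_def real_vector.representation_diff[OF ind] real_vector.representation_scale[OF ind] span_scale)
    have "of_int k \<le> ?r x e / ?r b e" "?r x e / ?r b e < of_int k + 1" unfolding k_def by linarith+
    then have y01: "0 \<le> ?r y e" "?r y e < ?r b e" unfolding ry using bI(3) by (auto simp: field_simps)
    have "?r y e = 0"
    proof (rule ccontr)
      assume "?r y e \<noteq> 0"
      then have ypos: "0 < ?r y e" using y01 by simp
      \<comment> \<open>Moves the remainder \<open>y\<close> into the box; its smaller positive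
        \<open>e\<close>-coordinate then contradicts the choice of \<open>b\<close>.\<close>
      define z where "z = y - (\<Sum>f\<in>E. of_int \<lfloor>?r y f\<rfloor> *\<^sub>R f)"
      have sE: "(\<Sum>f\<in>E. of_int \<lfloor>?r y f\<rfloor> *\<^sub>R f) = (\<Sum>f\<in>?E. (if f = e then 0 else of_int \<lfloor>?r y f\<rfloor>) *\<^sub>R f)"
        by (rule sum.mono_neutral_cong_left) (use insert.hyps in auto)
      have sin: "(\<Sum>f\<in>E. of_int \<lfloor>?r y f\<rfloor> *\<^sub>R f) \<in> span ?E"
        by (intro span_sum span_scale span_base) auto
      have "z \<in> integer_points" unfolding z_def using y insert.prems
        by (intro integer_points_diff integer_points_sum integer_points_scale) auto
      moreover have "z \<in> span ?E" unfolding z_def using y(2) sin by (rule span_diff)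
      moreover have rz: "?r z f = ?r y f - (if f = e then 0 else of_int \<lfloor>?r y f\<rfloor>)" if "f \<in> ?E" for f
        unfolding z_def using real_vector.representation_diff[OF ind sin y(2)]
          representation_of_sum[OF ind finE that, of "\<lambda>f. if f = e then 0 else of_int \<lfloor>?r y f\<rfloor>"] sE by simp
      ultimately have "z \<in> M" unfolding M_def using ypos y01 bI(4) insert.hyps
        by (auto simp: less_le_trans) linarith+
      from bmin[OF this] rz[of e] y01 show False by simp
    qed
    then have "y \<in> span E" using spanE[OF y(2)] by simp
    then show ?thesis using y(1) unfolding y_def by (intro exI[of _ k]) auto
  qed
  have "lattice_basis (integer_points \<inter> span ?E) (insert b B)"
    unfolding lattice_basis_def
  proof (intro conjI)
    show "finite (insert b B)" using finB by simp
    show "independent (insert b B)" using finB bB by (simp add: independent_insert)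
    show "integer_points \<inter> span ?E = range (\<lambda>m :: _ \<Rightarrow> int. \<Sum>b\<in>insert b B. of_int (m b) *\<^sub>R b)"
    proof (intro equalityI subsetI)
      fix x assume "x \<in> integer_points \<inter> span ?E"
      then obtain k :: int where k: "x - of_int k *\<^sub>R b \<in> integer_points \<inter> span E" using red by auto
      then obtain m where m: "x - of_int k *\<^sub>R b = (\<Sum>b\<in>B. of_int (m b) *\<^sub>R b)"
        using B unfolding lattice_basis_def by auto
      have "(\<Sum>c\<in>insert b B. of_int ((m(b := k)) c) *\<^sub>R c) = of_int k *\<^sub>R b + (\<Sum>c\<in>B. of_int ((m(b := k)) c) *\<^sub>R c)"
        using finB bB by simp
      also have "(\<Sum>c\<in>B. of_int ((m(b := k)) c) *\<^sub>R c) = (\<Sum>c\<in>B. of_int (m c) *\<^sub>R c)"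
        by (rule sum.cong) (use bB in auto)
      finally have "x = (\<Sum>c\<in>insert b B. of_int ((m(b := k)) c) *\<^sub>R c)" using m by (simp add: algebra_simps)
      then show "x \<in> range (\<lambda>m :: _ \<Rightarrow> int. \<Sum>b\<in>insert b B. of_int (m b) *\<^sub>R b)" by blast
    next
      fix x assume "x \<in> range (\<lambda>m :: _ \<Rightarrow> int. \<Sum>b\<in>insert b B. of_int (m b) *\<^sub>R b)"
      then obtain m :: "_ \<Rightarrow> int" where x: "x = (\<Sum>b\<in>insert b B. of_int (m b) *\<^sub>R b)" by blast
      have "c \<in> integer_points \<and> c \<in> span ?E" if "c \<in> insert b B" for c
        using that bI Bsub span_mono[of E ?E] by auto
      then show "x \<in> integer_points \<inter> span ?E" unfolding x
        by (auto intro!: integer_points_sum integer_points_scale span_sum intro: span_scale simp del: sum.insert)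
    qed
  qed
  then show ?case by blast
qed

subsection \<open>The leading coefficient\<close>

text \<open>Fubini with the coordinate \<open>b0\<close> innermost: with the others fixed, the
  equation admits a single value of it, a null set of the line.\<close>

lemma AE_PiM_lborel_hyperplane:
  fixes c :: "'b \<Rightarrow> real"
  assumes "finite B" "b0 \<in> B" "c b0 \<noteq> 0"
  shows "AE a in (\<Pi>\<^sub>M b\<in>B. lborel). (\<Sum>b\<in>B. c b * a b) \<noteq> k"
proof -
  interpret product_sigma_finite "\<lambda>_::'b. lborel :: real measure" by standard
  let ?B = "B - {b0}"
  have ins: "B = insert b0 ?B" and fin: "finite ?B" and nin: "b0 \<notin> ?B" using assms by auto
  let ?M = "\<Pi>\<^sub>M b\<in>B. (lborel :: real measure)"
  have meas [measurable]: "(\<lambda>a. \<Sum>b\<in>B. c b * a b) \<in> borel_measurable ?M" by measurable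
  define N where "N = {a \<in> space ?M. (\<Sum>b\<in>B. c b * a b) = k}"
  have N: "N \<in> sets ?M" unfolding N_def by measurable
  have inner: "(\<integral>\<^sup>+ y. indicator N (x(b0 := y)) \<partial>lborel) = 0" for x
  proof -
    have "(\<integral>\<^sup>+ y. indicator N (x(b0 := y)) \<partial>lborel) \<le>
        (\<integral>\<^sup>+ y. indicator {(k - (\<Sum>b\<in>?B. c b * x b)) / c b0} y \<partial>(lborel :: real measure))"
    proof (rule nn_integral_mono)
      fix y :: real
      have "y = (k - (\<Sum>b\<in>?B. c b * x b)) / c b0" if "x(b0 := y) \<in> N"
      proof -
        have "k = (\<Sum>b\<in>B. c b * (x(b0 := y)) b)" using that by (simp add: N_def)
        also have "\<dots> = c b0 * y + (\<Sum>b\<in>?B. c b * (x(b0 := y)) b)"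
          using assms by (simp add: sum.remove[of B b0])
        also have "(\<Sum>b\<in>?B. c b * (x(b0 := y)) b) = (\<Sum>b\<in>?B. c b * x b)"
          by (rule sum.cong) auto
        finally show ?thesis using assms(3) by (simp add: field_simps)
      qed
      then show "indicator N (x(b0 := y)) \<le>
          (indicator {(k - (\<Sum>b\<in>?B. c b * x b)) / c b0} y :: ennreal)" by (auto split: split_indicator)
    qed
    also have "\<dots> = 0" by simp
    finally show ?thesis by simp
  qed
  have ind: "indicator N \<in> borel_measurable (\<Pi>\<^sub>M b\<in>insert b0 ?B. (lborel :: real measure))"
    using N ins by simp
  have "emeasure ?M N = (\<integral>\<^sup>+ a. indicator N a \<partial>(\<Pi>\<^sub>M b\<in>insert b0 ?B. lborel))" using N ins by simp
  also have "\<dots> = 0" unfolding product_nn_integral_insert[OF fin nin ind] inner by simp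
  finally have "emeasure ?M N = 0" .
  then show ?thesis by (intro AE_I[OF _ _ N]) (auto simp: N_def)
qed

text \<open>\<open>p\<close> is an arbitrary point of the affine hull, so lattice points of a dilate
  have integer coordinates only after a shift, which depends on the dilate.\<close>

locale lattice_coordinates =
  fixes P :: "(real ^ 'n) set" and B :: "(real ^ 'n) set" and p :: "real ^ 'n"
  assumes polytope_P: "polytope P" and finite_B: "finite B" and independent_B: "independent B"
    and hull_P: "affine hull P = (+) p ` span B"
    and lattice_B: "integer_points \<inter> span B = range (\<lambda>m :: _ \<Rightarrow> int. \<Sum>b\<in>B. of_int (m b) *\<^sub>R b)"
    and distinct_P: "\<And>j k. j \<noteq> k \<Longrightarrow> \<exists>x\<in>P. x $ j \<noteq> x $ k"
begin

definition point :: "(real ^ 'n \<Rightarrow> real) \<Rightarrow> real ^ 'n" where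
  "point a = p + (\<Sum>b\<in>B. a b *\<^sub>R b)"

abbreviation \<mu> :: "(real ^ 'n \<Rightarrow> real) measure" where "\<mu> \<equiv> \<Pi>\<^sub>M b\<in>B. lborel"

lemma point_in_hull: "point a \<in> affine hull P"
  unfolding hull_P point_def by (intro imageI span_sum span_scale span_base)

lemma in_hull_point: "x \<in> affine hull P \<Longrightarrow> \<exists>a. x = point a"
proof -
  assume "x \<in> affine hull P"
  then have "x - p \<in> span B" unfolding hull_P by auto
  from sum_representation[OF independent_B finite_B this] show ?thesis
    by (intro exI[of _ "representation B (x - p)"]) (simp add: point_def)
qed

lemma point_measurable [measurable]: "point \<in> borel_measurable \<mu>"
  unfolding point_def by measurable

lemma AE_point_not_in_hyperplane:
  assumes "x \<in> affine hull P" "inner n x \<noteq> \<beta>"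
  shows "AE a in \<mu>. inner n (point a) \<noteq> \<beta>"
proof -
  have eq: "inner n (point a) = inner n p + (\<Sum>b\<in>B. inner n b * a b)" for a
    by (simp add: point_def inner_add_right inner_sum_right mult.commute)
  show ?thesis
  proof (cases "\<exists>b\<in>B. inner n b \<noteq> 0")
    case True
    then obtain b0 where b0: "b0 \<in> B" "inner n b0 \<noteq> 0" by auto
    from AE_PiM_lborel_hyperplane[OF finite_B b0(1), of "\<lambda>b. inner n b" "\<beta> - inner n p", OF b0(2)]
    show ?thesis unfolding eq by eventually_elim auto
  next
    \<comment> \<open>The form is constant on the affine hull, so its value at \<open>x\<close>
      decides everywhere.\<close>
    case False
    obtain a where "x = point a" using in_hull_point assms(1) by blast
    then have "inner n p \<noteq> \<beta>" using assms(2) False eq[of a] by simp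
    then show ?thesis unfolding eq using False by simp
  qed
qed

definition good :: "(real ^ 'n) set" where
  "good = {y \<in> rel_interior P. inj (($) y)}"

text \<open>What \<open>good\<close> misses of \<open>P\<close> lies in the facets and in the
  hyperplanes of two equal coordinates. These are finitely many sections by hyperplanes that do not
  contain \<open>P\<close>, hence null.\<close>

lemma AE_point_good: "AE a in \<mu>. point a \<in> P \<longrightarrow> point a \<in> good"
proof -
  have poly: "polyhedron P" using polytope_P by (rule polytope_imp_polyhedron)
  have facet: "AE a in \<mu>. point a \<notin> F" if F: "F facet_of P" for F
  proof -
    obtain n \<beta> where n: "n \<noteq> 0" "P \<subseteq> {x. n \<bullet> x \<le> \<beta>}" "F = P \<inter> {x. n \<bullet> x = \<beta>}"
      using facet_of_polyhedron[OF poly F] by blast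
    have "F \<noteq> P" using F by (auto simp: facet_of_def)
    then obtain x where "x \<in> P" "n \<bullet> x \<noteq> \<beta>" using n by auto
    then have "AE a in \<mu>. n \<bullet> point a \<noteq> \<beta>" by (intro AE_point_not_in_hyperplane[of x]) (auto intro: hull_inc)
    then show ?thesis by eventually_elim (use n in auto)
  qed
  have "AE a in \<mu>. \<forall>F\<in>{F. F facet_of P}. point a \<notin> F"
    using finite_polyhedron_facets[OF poly] facet by (intro AE_finite_allI) auto
  moreover have "AE a in \<mu>. point a $ j \<noteq> point a $ k" if jk: "j \<noteq> k" for j k
  proof -
    obtain x where x: "x \<in> P" "x $ j \<noteq> x $ k" using distinct_P[OF jk] by auto
    have eq: "(axis j 1 - axis k 1) \<bullet> y = y $ j - y $ k" for y :: "real ^ 'n"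
      by (simp add: inner_diff_left inner_axis')
    have "AE a in \<mu>. (axis j 1 - axis k 1) \<bullet> point a \<noteq> 0"
      using x by (intro AE_point_not_in_hyperplane[of x]) (auto simp: eq intro: hull_inc)
    then show ?thesis by eventually_elim (simp add: eq)
  qed
  then have "AE a in \<mu>. \<forall>jk\<in>{(j, k). j \<noteq> k}. point a $ fst jk \<noteq> point a $ snd jk"
    by (intro AE_finite_allI) auto
  ultimately show ?thesis
  proof eventually_elim
    case (elim a)
    have "point a \<in> rel_interior P" if "point a \<in> P"
    proof (rule ccontr)
      assume "point a \<notin> rel_interior P"
      then have "point a \<in> rel_frontier P" using that closure_subset by (auto simp: rel_frontier_def)
      then show False using elim(1) rel_frontier_of_polyhedron[OF poly] by auto
    qed
    moreover have "inj (($) (point a))" using elim(2) by (force simp: inj_def)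
    ultimately show ?case by (simp add: good_def)
  qed
qed

lemma independent_coordinates:
  assumes "(\<Sum>b\<in>B. f b *\<^sub>R b) = (\<Sum>b\<in>B. g b *\<^sub>R b)" "b \<in> B"
  shows "f b = g b"
  using representation_of_sum[OF independent_B finite_B assms(2), of f]
    representation_of_sum[OF independent_B finite_B assms(2), of g] assms(1) by simp

lemma good_scaled_iff:
  assumes "t > (0 :: nat)"
  shows "x \<in> (\<lambda>y. real t *\<^sub>R y) ` rel_interior P \<and> inj (\<lambda>i. x $ i) \<longleftrightarrow> (1 / real t) *\<^sub>R x \<in> good"
proof -
  have "x \<in> (\<lambda>y. real t *\<^sub>R y) ` rel_interior P \<longleftrightarrow> (1 / real t) *\<^sub>R x \<in> rel_interior P"
    using assms by (auto simp: image_iff intro: bexI[of _ "(1 / real t) *\<^sub>R x"])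
  moreover have "inj (\<lambda>i. x $ i) \<longleftrightarrow> inj (($) ((1 / real t) *\<^sub>R x))" using assms by (simp add: inj_def)
  ultimately show ?thesis by (simp add: good_def)
qed

definition grid_round :: "nat \<Rightarrow> (real ^ 'n \<Rightarrow> real) \<Rightarrow> (real ^ 'n \<Rightarrow> real) \<Rightarrow> (real ^ 'n \<Rightarrow> real)" where
  "grid_round t u a = (\<lambda>b. u b + of_int \<lfloor>real t * (a b - u b)\<rfloor> / real t)"

lemma grid_round_close:
  assumes "t > 0"
  shows "\<bar>grid_round t u a b - a b\<bar> \<le> 1 / real t"
proof -
  have "grid_round t u a b - a b = (of_int \<lfloor>real t * (a b - u b)\<rfloor> - real t * (a b - u b)) / real t"
    using assms by (simp add: grid_round_def field_simps)
  moreover have "\<bar>of_int \<lfloor>real t * (a b - u b)\<rfloor> - real t * (a b - u b)\<bar> \<le> 1" by linarith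
  ultimately show ?thesis using assms by (simp add: divide_right_mono)
qed

text \<open>
  The count is the integral of the step function that is constant on the cells of the scaled
  lattice; \<open>u\<close> records the offset of the lattice in the dilated affine hull.
\<close>

lemma open_count_as_integral:
  assumes t: "t > (0 :: nat)" and x0: "x0 \<in> affine hull P" "real t *\<^sub>R x0 \<in> integer_points"
  shows "\<exists>u g. g \<in> borel_measurable \<mu> \<and> integral\<^sup>L \<mu> g = real (open_count P t) / real t ^ card B \<and>
    (\<forall>a\<in>space \<mu>. g a = indicator good (point (grid_round t u a)))"
proof -
  interpret product_sigma_finite "\<lambda>_::real ^ 'n. lborel :: real measure" by standard
  obtain u where u: "x0 = point u" using in_hull_point[OF x0(1)] by auto
  define z where "z = real t *\<^sub>R x0"
  \<comment> \<open>Starting from the known lattice point \<open>z\<close>, integer coordinates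
    enumerate all lattice points of the dilated affine hull.\<close>
  define vec where "vec = (\<lambda>m :: real ^ 'n \<Rightarrow> int. z + (\<Sum>b\<in>B. of_int (m b) *\<^sub>R b))"
  define X where "X = {x \<in> integer_points \<inter> (\<lambda>y. real t *\<^sub>R y) ` rel_interior P. inj (\<lambda>i. x $ i)}"
  define M where "M = {m \<in> B \<rightarrow>\<^sub>E UNIV. (1 / real t) *\<^sub>R vec m \<in> good}"
  have X: "X = {x \<in> integer_points. (1 / real t) *\<^sub>R x \<in> good}"
    unfolding X_def using good_scaled_iff[OF t] by blast
  have "inj_on vec M"
  proof (rule inj_onI)
    fix m m' assume m: "m \<in> M" "m' \<in> M" "vec m = vec m'"
    then have "m b = m' b" if "b \<in> B" for b
      using independent_coordinates[of "\<lambda>b. of_int (m b)" "\<lambda>b. of_int (m' b)" b] that by (simp add: vec_def)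
    then show "m = m'" using m by (auto simp: M_def intro: PiE_ext)
  qed
  moreover have "vec ` M = X"
  proof (intro equalityI subsetI)
    fix x assume "x \<in> vec ` M"
    then obtain m where m: "m \<in> M" "x = vec m" by auto
    have "(\<Sum>b\<in>B. of_int (m b) *\<^sub>R b) \<in> integer_points \<inter> span B" unfolding lattice_B by blast
    then have "x \<in> integer_points" using x0(2) m(2) by (auto simp: vec_def z_def intro: integer_points_add)
    then show "x \<in> X" using m unfolding X M_def by blast
  next
    fix x assume x: "x \<in> X"
    then have xg: "x \<in> integer_points" "(1 / real t) *\<^sub>R x \<in> good" unfolding X by auto
    then have "(1 / real t) *\<^sub>R x \<in> affine hull P"
      using rel_interior_subset[of P] hull_subset[of P affine] by (auto simp: good_def)
    then obtain w w' where "(1 / real t) *\<^sub>R x = p + w" "w \<in> span B" "x0 = p + w'" "w' \<in> span B"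
      using x0(1) unfolding hull_P by auto
    then have "(1 / real t) *\<^sub>R x - x0 \<in> span B" by (simp add: span_diff)
    then have "real t *\<^sub>R ((1 / real t) *\<^sub>R x - x0) \<in> span B" by (rule span_scale)
    then have "x - z \<in> integer_points \<inter> span B"
      using t x0(2) xg(1) by (auto simp: z_def scaleR_diff_right intro: integer_points_diff)
    then obtain m :: "_ \<Rightarrow> int" where m: "x - z = (\<Sum>b\<in>B. of_int (m b) *\<^sub>R b)" unfolding lattice_B by blast
    have "vec (restrict m B) = x" unfolding vec_def using m by (simp add: algebra_simps)
    moreover from this have "restrict m B \<in> M" using xg by (auto simp: M_def)
    ultimately show "x \<in> vec ` M" by blast
  qed
  ultimately have bij: "bij_betw vec M X" by (simp add: bij_betw_def)
  have "bounded ((\<lambda>y. real t *\<^sub>R y) ` rel_interior P)"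
    using polytope_P by (intro bounded_scaling bounded_subset[OF polytope_imp_bounded rel_interior_subset])
  then have "finite X" using finite_bounded_integer_points unfolding X_def by (auto intro: finite_subset[rotated])
  then have finM: "finite M" using bij bij_betw_finite by blast
  have cardM: "card M = open_count P t" using bij_betw_same_card[OF bij] by (simp add: open_count_def X_def)
  \<comment> \<open>Cells of volume \<open>(1 / t) ^ card B\<close>, closed below and open above so
    that each point lies in exactly one.\<close>
  define box where "box = (\<lambda>m :: real ^ 'n \<Rightarrow> int. \<Pi>\<^sub>E b\<in>B. {u b + of_int (m b) / real t ..< u b + (of_int (m b) + 1) / real t})"
  have box_sets: "box m \<in> sets \<mu>" for m unfolding box_def using finite_B by (intro sets_PiM_I_finite) auto
  have "emeasure \<mu> (box m) = (\<Prod>b\<in>B. ennreal (1 / real t))" for m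
    unfolding box_def using finite_B t
    by (subst emeasure_PiM) (auto simp: divide_right_mono add_divide_distrib)
  then have box_em: "emeasure \<mu> (box m) = ennreal ((1 / real t) ^ card B)" for m
    by (simp add: ennreal_power)
  define g where "g = (\<lambda>a. \<Sum>m\<in>M. indicator (box m) a :: real)"
  have "integral\<^sup>L \<mu> g = (\<Sum>m\<in>M. integral\<^sup>L \<mu> (indicator (box m)))"
    unfolding g_def using box_sets box_em by (intro Bochner_Integration.integral_sum integrable_real_indicator) auto
  also have "\<dots> = (\<Sum>m\<in>M. (1 / real t) ^ card B)"
  proof (rule sum.cong[OF refl])
    fix m
    have "box m \<inter> space \<mu> = box m" using box_sets[of m] sets.sets_into_space by blast
    then show "integral\<^sup>L \<mu> (indicator (box m)) = (1 / real t) ^ card B"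
      using box_em[of m] by (simp add: measure_def)
  qed
  also have "\<dots> = real (open_count P t) / real t ^ card B" by (simp add: cardM power_divide)
  finally have int: "integral\<^sup>L \<mu> g = real (open_count P t) / real t ^ card B" .
  have "g a = indicator good (point (grid_round t u a))" if a: "a \<in> space \<mu>" for a
  proof -
    \<comment> \<open>Index of the one cell that contains \<open>a\<close>; restriction to
      \<open>B\<close> makes it comparable with the extensional functions in
      \<open>M\<close>.\<close>
    define ma where "ma = restrict (\<lambda>b. \<lfloor>real t * (a b - u b)\<rfloor>) B"
    have floor: "a b \<in> {u b + of_int k / real t ..< u b + (of_int k + 1) / real t} \<longleftrightarrow> \<lfloor>real t * (a b - u b)\<rfloor> = k" for b k
    proof -
      have "a b \<in> {u b + of_int k / real t ..< u b + (of_int k + 1) / real t} \<longleftrightarrow>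
          of_int k \<le> real t * (a b - u b) \<and> real t * (a b - u b) < of_int k + 1"
        using t by (simp add: field_simps)
      then show ?thesis by (simp add: floor_eq_iff)
    qed
    have "a \<in> B \<rightarrow>\<^sub>E UNIV" using a by (simp add: space_PiM)
    then have box_iff: "a \<in> box m \<longleftrightarrow> m = ma" if "m \<in> B \<rightarrow>\<^sub>E UNIV" for m
      using that unfolding box_def PiE_iff floor ma_def by (auto simp: PiE_iff fun_eq_iff extensional_def)
    have "g a = (\<Sum>m\<in>M. if m = ma then 1 else 0)"
      unfolding g_def by (rule sum.cong) (auto simp: M_def box_iff indicator_def)
    also have "\<dots> = (if ma \<in> M then 1 else 0)" using finM by simp
    also have "ma \<in> M \<longleftrightarrow> (1 / real t) *\<^sub>R vec ma \<in> good" by (simp add: M_def ma_def)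
    also have "(1 / real t) *\<^sub>R vec ma = point (grid_round t u a)"
    proof -
      have "(1 / real t) *\<^sub>R vec ma = x0 + (\<Sum>b\<in>B. (of_int \<lfloor>real t * (a b - u b)\<rfloor> / real t) *\<^sub>R b)"
        using t by (simp add: vec_def z_def ma_def scaleR_add_right scaleR_sum_right)
      then show ?thesis unfolding u by (simp add: point_def grid_round_def scaleR_add_left sum.distrib)
    qed
    finally show ?thesis by (simp add: indicator_def)
  qed
  moreover have "g \<in> borel_measurable \<mu>" unfolding g_def using box_sets by measurable
  ultimately show ?thesis using int by blast
qed

text \<open>The step functions converge almost everywhere to the indicator of \<open>P\<close>:
  inside, because \<open>good\<close> is relatively open and rounding stays in the affine hull;
  outside, because \<open>P\<close> is closed; the remaining points are null.\<close>

theorem open_count_limit: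
  assumes \<tau>: "filterlim \<tau> at_top sequentially"
    and pos: "\<And>i. \<tau> i > (0 :: nat)"
    and int: "\<And>i. \<exists>x\<in>affine hull P. real (\<tau> i) *\<^sub>R x \<in> integer_points"
  shows "(\<lambda>i. real (open_count P (\<tau> i)) / real (\<tau> i) ^ card B) \<longlonglongrightarrow>
    measure \<mu> {a \<in> B \<rightarrow>\<^sub>E UNIV. point a \<in> P}"
proof -
  interpret product_sigma_finite "\<lambda>_::real ^ 'n. lborel :: real measure" by standard
  have "\<exists>u g. g \<in> borel_measurable \<mu> \<and> integral\<^sup>L \<mu> g = real (open_count P (\<tau> i)) / real (\<tau> i) ^ card B \<and>
    (\<forall>a\<in>space \<mu>. g a = indicator good (point (grid_round (\<tau> i) u a)))" for i
    using int[of i] open_count_as_integral[OF pos[of i]] by blast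
  then obtain u g where g: "\<And>i. g i \<in> borel_measurable \<mu>"
    "\<And>i. integral\<^sup>L \<mu> (g i) = real (open_count P (\<tau> i)) / real (\<tau> i) ^ card B"
    "\<And>i a. a \<in> space \<mu> \<Longrightarrow> g i a = indicator good (point (grid_round (\<tau> i) (u i) a))"
    by metis
  define F where "F = {a \<in> space \<mu>. point a \<in> P}"
  have closedP: "closed P" using polytope_P by (rule polytope_imp_closed)
  have F: "F \<in> sets \<mu>" using measurable_sets[OF point_measurable borel_closed[OF closedP]]
    by (simp add: F_def vimage_def Int_def conj_commute)
  obtain r where r: "\<And>y. y \<in> P \<Longrightarrow> norm y \<le> r" using polytope_imp_bounded[OF polytope_P] by (auto simp: bounded_iff)
  have "\<exists>R. \<forall>a. point a \<in> P \<longrightarrow> \<bar>a b\<bar> \<le> R" if b: "b \<in> B" for b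
  proof -
    \<comment> \<open>The coordinate at \<open>b\<close> extends to a linear, hence bounded,
      functional on the whole space, which bounds it on \<open>P\<close>.\<close>
    obtain l where l: "linear l" "\<And>x. x \<in> B \<Longrightarrow> l x = (if x = b then 1 else 0 :: real)"
      using linear_independent_extend[OF independent_B, of "\<lambda>x. if x = b then 1 else 0"] by blast
    obtain K where K: "K > 0" "\<And>x. norm (l x) \<le> K * norm x" using linear_bounded_pos[OF l(1)] by blast
    have "\<bar>a b\<bar> \<le> K * (r + norm p)" if a: "point a \<in> P" for a
    proof -
      have "l (point a - p) = (\<Sum>x\<in>B. a x * l x)" using l(1) by (simp add: point_def linear_sum linear_cmul)
      also have "\<dots> = (\<Sum>x\<in>B. if x = b then a x else 0)" by (rule sum.cong) (auto simp: l(2))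
      also have "\<dots> = a b" using b finite_B by simp
      finally have "\<bar>a b\<bar> \<le> K * norm (point a - p)" using K(2)[of "point a - p"] by simp
      also have "norm (point a - p) \<le> r + norm p" using norm_triangle_ineq4[of "point a" p] r[OF a] by linarith
      finally show ?thesis using K(1) by simp
    qed
    then show ?thesis by blast
  qed
  then obtain R where R: "\<And>b a. b \<in> B \<Longrightarrow> point a \<in> P \<Longrightarrow> \<bar>a b\<bar> \<le> R b" by metis
  \<comment> \<open>The margin 1 absorbs the rounding error \<open>1 / \<tau> i\<close>, so one box
    dominates all step functions.\<close>
  define W where "W = (\<Pi>\<^sub>E b\<in>B. {- (R b + 1) .. R b + 1})"
  have W: "W \<in> sets \<mu>" unfolding W_def using finite_B by (intro sets_PiM_I_finite) auto
  have "emeasure \<mu> W = (\<Prod>b\<in>B. emeasure lborel {- (R b + 1) .. R b + 1})"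
    unfolding W_def using finite_B by (intro emeasure_PiM) auto
  also have "\<dots> < \<infinity>" by (simp add: less_top[symmetric] ennreal_prod_eq_top emeasure_lborel_Icc_eq)
  finally have intW: "integrable \<mu> (indicator W :: _ \<Rightarrow> real)" using W by (intro integrable_real_indicator)
  have good_P: "good \<subseteq> P" using rel_interior_subset by (auto simp: good_def)
  have "(\<lambda>i. integral\<^sup>L \<mu> (g i)) \<longlonglongrightarrow> integral\<^sup>L \<mu> (indicator F)"
  proof (rule integral_dominated_convergence[OF _ g(1) intW])
    show "indicator F \<in> borel_measurable \<mu>" using F by simp
    show "AE a in \<mu>. norm (g i a) \<le> indicator W a" for i
    proof (rule AE_I2)
      fix a assume a: "a \<in> space \<mu>"
      show "norm (g i a) \<le> indicator W a"
      proof (cases "point (grid_round (\<tau> i) (u i) a) \<in> good")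
        case True
        have "\<bar>a b\<bar> \<le> R b + 1" if "b \<in> B" for b
        proof -
          have "\<bar>grid_round (\<tau> i) (u i) a b\<bar> \<le> R b" using R[OF that] True good_P by blast
          moreover have "\<bar>grid_round (\<tau> i) (u i) a b - a b\<bar> \<le> 1 / real (\<tau> i)" using grid_round_close[OF pos] .
          moreover have "1 / real (\<tau> i) \<le> 1" using pos[of i] by simp
          ultimately show ?thesis by linarith
        qed
        then have "a b \<in> {- (R b + 1) .. R b + 1}" if "b \<in> B" for b using that by (fastforce simp: abs_le_iff)
        then have "a \<in> W" using a by (auto simp: W_def space_PiM PiE_iff)
        then show ?thesis using g(3)[OF a] by (simp add: indicator_def)
      qed (use g(3)[OF a] in simp)
    qed
    show "AE a in \<mu>. (\<lambda>i. g i a) \<longlonglongrightarrow> indicator F a"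
      using AE_point_good AE_space
    proof eventually_elim
      case (elim a)
      have "(\<lambda>i. 1 / real (\<tau> i)) \<longlonglongrightarrow> 0"
        using filterlim_compose[OF filterlim_real_sequentially \<tau>]
        by (intro tendsto_divide_0[OF tendsto_const] filterlim_at_top_imp_at_infinity)
      then have "(\<lambda>i. grid_round (\<tau> i) (u i) a b - a b) \<longlonglongrightarrow> 0" for b
        by (rule Lim_null_comparison[rotated]) (simp add: grid_round_close pos)
      then have "(\<lambda>i. grid_round (\<tau> i) (u i) a b) \<longlonglongrightarrow> a b" for b
        using Lim_null by blast
      then have lim: "(\<lambda>i. point (grid_round (\<tau> i) (u i) a)) \<longlonglongrightarrow> point a"
        unfolding point_def by (intro tendsto_intros)
      show ?case
      proof (cases "point a \<in> P")
        case True
        then have pg: "point a \<in> good" using elim by simp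
        obtain T where T: "open T" "rel_interior P = affine hull P \<inter> T"
          using openin_rel_interior[of P] by (auto simp: openin_open)
        have "eventually (\<lambda>i. point (grid_round (\<tau> i) (u i) a) \<in> T) sequentially"
          using lim T pg by (intro topological_tendstoD) (auto simp: good_def)
        moreover have "eventually (\<lambda>i. \<forall>jk\<in>{(j, k). j \<noteq> k}. point (grid_round (\<tau> i) (u i) a) $ fst jk -
            point (grid_round (\<tau> i) (u i) a) $ snd jk \<noteq> 0) sequentially"
        proof (rule eventually_ball_finite)
          show "\<forall>jk\<in>{(j, k). j \<noteq> k}. eventually (\<lambda>i. point (grid_round (\<tau> i) (u i) a) $ fst jk -
            point (grid_round (\<tau> i) (u i) a) $ snd jk \<noteq> 0) sequentially"
          proof
            fix jk :: "'n \<times> 'n" assume "jk \<in> {(j, k). j \<noteq> k}"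
            then have "point a $ fst jk - point a $ snd jk \<noteq> 0" using pg by (auto simp: good_def inj_def)
            moreover have "(\<lambda>i. point (grid_round (\<tau> i) (u i) a) $ fst jk - point (grid_round (\<tau> i) (u i) a) $ snd jk)
                \<longlonglongrightarrow> point a $ fst jk - point a $ snd jk"
              by (intro tendsto_diff tendsto_vec_nth lim)
            ultimately show "eventually (\<lambda>i. point (grid_round (\<tau> i) (u i) a) $ fst jk -
                point (grid_round (\<tau> i) (u i) a) $ snd jk \<noteq> 0) sequentially"
              by (rule tendsto_imp_eventually_ne[rotated])
          qed
        qed simp
        ultimately have "eventually (\<lambda>i. g i a = indicator F a) sequentially"
        proof eventually_elim
          case (elim i)
          then have "point (grid_round (\<tau> i) (u i) a) \<in> good"
            unfolding good_def using point_in_hull T(2) by (force simp: inj_def)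
          then show ?case using g(3) \<open>a \<in> space \<mu>\<close> True by (simp add: F_def)
        qed
        then show ?thesis by (rule tendsto_eventually)
      next
        case False
        have "eventually (\<lambda>i. point (grid_round (\<tau> i) (u i) a) \<in> - P) sequentially"
          using lim False closedP by (intro topological_tendstoD) auto
        then have "eventually (\<lambda>i. g i a = indicator F a) sequentially"
        proof eventually_elim
          case (elim i)
          then show ?case using g(3)[OF \<open>a \<in> space \<mu>\<close>, of i] good_P False by (auto simp: F_def indicator_def)
        qed
        then show ?thesis by (rule tendsto_eventually)
      qed
    qed
  qed
  moreover have "F = {a \<in> B \<rightarrow>\<^sub>E UNIV. point a \<in> P}" by (auto simp: F_def space_PiM)
  moreover have "F \<inter> space \<mu> = F" by (auto simp: F_def)
  ultimately show ?thesis by (simp add: g(2))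
qed

end

section \<open>Direction lattices of rational polytopes and the normalized volume\<close>

lemma rational_polytope_vertices:
  assumes "rational_polytope P"
  shows "\<exists>V. finite V \<and> V \<noteq> {} \<and> (\<forall>v\<in>V. \<forall>i. v $ i \<in> \<rat>) \<and> P = convex hull V"
proof -
  let ?V = "{v. v extreme_point_of P}"
  have P: "polytope P" "P \<noteq> {}" "\<forall>v. v extreme_point_of P \<longrightarrow> (\<forall>i. v $ i \<in> \<rat>)"
    using assms by (auto simp: rational_polytope_def)
  have "P = convex hull ?V"
    using P(1) by (intro Krein_Milman_Minkowski polytope_imp_compact polytope_imp_convex)
  moreover from this have "?V \<noteq> {}" using P(2) by auto
  moreover have "finite ?V" using P(1) by (intro finite_polyhedron_extreme_points polytope_imp_polyhedron)
  ultimately show ?thesis using P(3) by blast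
qed

text \<open>Differences of vertices, scaled by a common denominator, are integer vectors that span
  the direction space, so the lattice has full rank there. The later clauses hold for every lattice
  basis because \<open>lattice_volume\<close> chooses one arbitrarily.\<close>

lemma direction_lattice_basis:
  assumes P: "rational_polytope P"
  shows "\<exists>B. lattice_basis (direction_lattice P) B"
    and "lattice_basis (direction_lattice P) B \<Longrightarrow> direction_lattice P = integer_points \<inter> span B"
    and "lattice_basis (direction_lattice P) B \<Longrightarrow> int (card B) = aff_dim P"
    and "lattice_basis (direction_lattice P) B \<Longrightarrow> p \<in> affine hull P \<Longrightarrow> affine hull P = (+) p ` span B"
proof -
  obtain V where V: "finite V" "V \<noteq> {}" "\<forall>v\<in>V. \<forall>i. v $ i \<in> \<rat>" "P = convex hull V"
    using rational_polytope_vertices[OF P] by blast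
  obtain v0 where v0: "v0 \<in> V" using V by auto
  define T0 where "T0 = (\<lambda>x. - v0 + x) ` V"
  have hullV: "affine hull P = affine hull V" using V(4) by (simp add: affine_hull_convex_hull)
  have hull0: "affine hull P = (+) v0 ` span T0"
    unfolding T0_def hullV using v0 by (intro affine_hull_span_gen hull_inc)
  have dirU: "{x - y | x y. x \<in> affine hull P \<and> y \<in> affine hull P} = span T0"
  proof (intro equalityI subsetI)
    fix z assume "z \<in> {x - y | x y. x \<in> affine hull P \<and> y \<in> affine hull P}"
    then obtain w w' where "w \<in> span T0" "w' \<in> span T0" "z = (v0 + w) - (v0 + w')" unfolding hull0 by blast
    then show "z \<in> span T0" by (simp add: span_diff)
  next
    fix z assume z: "z \<in> span T0"
    have "z = (v0 + z) - (v0 + 0)" by simp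
    moreover have "v0 + z \<in> affine hull P" "v0 + 0 \<in> affine hull P"
      unfolding hull0 using z span_zero by blast+
    ultimately show "z \<in> {x - y | x y. x \<in> affine hull P \<and> y \<in> affine hull P}" by blast
  qed
  have L: "direction_lattice P = integer_points \<inter> span T0" unfolding direction_lattice_def dirU ..
  obtain N where N: "N > 0" "\<forall>v\<in>V. real N *\<^sub>R v \<in> integer_points" using common_denominator[OF V(1)] V(3) by auto
  define T where "T = (\<lambda>x. real N *\<^sub>R x) ` T0"
  have finT0: "finite T0" using V(1) by (simp add: T0_def)
  have spanT: "span T = span T0" unfolding T_def using finT0 N(1) by (intro real_vector.span_image_scale) auto
  have TI: "T \<subseteq> integer_points" unfolding T_def T0_def using N v0
    by (auto simp: scaleR_diff_right intro!: integer_points_diff)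
  obtain E where E: "E \<subseteq> T" "independent E" "T \<subseteq> span E" using real_vector.maximal_independent_subset[of T] by blast
  have spanE: "span E = span T0" unfolding spanT[symmetric] using E by (intro span_eq[THEN iffD2]) (auto intro: span_base)
  have "finite E" using E(1) finT0 finite_subset by (auto simp: T_def)
  then show "\<exists>B. lattice_basis (direction_lattice P) B"
    using lattice_basis_integer_points_Int_span[of E] E TI unfolding L spanE by auto
  assume B: "lattice_basis (direction_lattice P) B"
  then have B': "finite B" "independent B"
    and LB: "direction_lattice P = range (\<lambda>m :: _ \<Rightarrow> int. \<Sum>b\<in>B. of_int (m b) *\<^sub>R b)"
    by (auto simp: lattice_basis_def)
  have spanB: "span B = span T0"
  proof
    have "b \<in> span T0" if "b \<in> B" for b
    proof -
      have "b = (\<Sum>d\<in>B. of_int (if d = b then 1 else 0) *\<^sub>R d)"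
        using that B'(1) by (simp add: sum.remove[of B b])
      then have "b \<in> direction_lattice P" unfolding LB by (rule range_eqI[where x = "\<lambda>d. if d = b then 1 else 0"])
      then show ?thesis by (simp add: L)
    qed
    then show "span B \<subseteq> span T0" by (intro span_minimal) auto
    have "x \<in> span B" if "x \<in> T" for x
    proof -
      have "x \<in> direction_lattice P" unfolding L using that TI spanT by (auto intro: span_base)
      then show ?thesis unfolding LB by (auto intro!: span_sum intro: span_scale span_base)
    qed
    then show "span T0 \<subseteq> span B" unfolding spanT[symmetric] by (intro span_minimal) auto
  qed
  show "direction_lattice P = integer_points \<inter> span B" unfolding L spanB ..
  have "aff_dim P = aff_dim V" using V(4) by (simp add: aff_dim_convex_hull)
  also have "\<dots> = int (dim T0)" unfolding T0_def using v0 by (intro aff_dim_eq_dim hull_inc)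
  also have "dim T0 = card B" using spanB B'(2) by (metis dim_eq_card dim_span)
  finally show "int (card B) = aff_dim P" ..
  assume p: "p \<in> affine hull P"
  then obtain w where w: "p = v0 + w" "w \<in> span B" unfolding hull0 spanB by auto
  show "affine hull P = (+) p ` span B"
    unfolding hull0 spanB[symmetric]
  proof (intro equalityI subsetI)
    fix z assume "z \<in> (+) v0 ` span B"
    then obtain y where "z = v0 + y" "y \<in> span B" by auto
    then have "z = p + (y - w)" "y - w \<in> span B" using w by (auto intro: span_diff)
    then show "z \<in> (+) p ` span B" by blast
  next
    fix z assume "z \<in> (+) p ` span B"
    then obtain y where "z = p + y" "y \<in> span B" by auto
    then have "z = v0 + (w + y)" "w + y \<in> span B" using w by (auto intro: span_add)
    then show "z \<in> (+) v0 ` span B" by blast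
  qed
qed

lemma open_count_limit_lattice_volume:
  fixes P :: "(real ^ 'n) set"
  assumes P: "rational_polytope P" and D: "D = nat (aff_dim P)"
    and distinct: "\<And>j k. j \<noteq> k \<Longrightarrow> \<exists>x\<in>P. x $ j \<noteq> x $ k"
    and \<tau>: "filterlim \<tau> at_top sequentially" "\<And>i. \<tau> i > (0 :: nat)"
      "\<And>i. \<exists>x\<in>affine hull P. real (\<tau> i) *\<^sub>R x \<in> integer_points"
  shows "(\<lambda>i. real (open_count P (\<tau> i)) / real (\<tau> i) ^ D) \<longlonglongrightarrow> lattice_volume P"
proof -
  define B where "B = (SOME B. lattice_basis (direction_lattice P) B)"
  define p where "p = (SOME p. p \<in> affine hull P)"
  have B: "lattice_basis (direction_lattice P) B"
    unfolding B_def using direction_lattice_basis(1)[OF P] by (rule someI_ex)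
  obtain x where "x \<in> P" using P by (auto simp: rational_polytope_def)
  then have "x \<in> affine hull P" by (rule hull_inc)
  then have p: "p \<in> affine hull P" unfolding p_def by (rule someI)
  interpret lattice_coordinates P B p
  proof
    show "integer_points \<inter> span B = range (\<lambda>m :: _ \<Rightarrow> int. \<Sum>b\<in>B. of_int (m b) *\<^sub>R b)"
      using B direction_lattice_basis(2)[OF P B] by (simp add: lattice_basis_def)
    show "affine hull P = (+) p ` span B" by (rule direction_lattice_basis(4)[OF P B p])
  qed (use P B distinct in \<open>auto simp: rational_polytope_def lattice_basis_def\<close>)
  have "card B = D" using direction_lattice_basis(3)[OF P B] D by simp
  moreover have "measure \<mu> {a \<in> B \<rightarrow>\<^sub>E UNIV. point a \<in> P} = lattice_volume P"
    unfolding lattice_volume_def Let_def point_def B_def[symmetric] p_def[symmetric] ..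
  ultimately show ?thesis using open_count_limit[OF \<tau>] by simp
qed

section \<open>Periodicity and the leading coefficient on each residue class\<close>

lemma quasipolynomial_common_period:
  assumes "quasipolynomial D c Q"
  shows "\<exists>p::nat. p > 0 \<and> (\<forall>k\<le>D. \<forall>t. c k (t + int p) = c k t)"
proof -
  have "\<exists>p::nat. p > 0 \<and> (\<forall>k<n. \<forall>t. c k (t + int p) = c k t)" if "n \<le> Suc D" for n
    using that
  proof (induction n)
    case (Suc n)
    then obtain p where p: "p > 0" "\<forall>k<n. \<forall>t. c k (t + int p) = c k t" by auto
    have "\<exists>q>0. \<forall>t. c n (t + q) = c n t" using assms Suc.prems by (auto simp: quasipolynomial_def)
    then obtain q where q: "q > 0" "\<And>t. c n (t + q) = c n t" by blast
    have "c k (t + int (p * nat q)) = c k t" if "k < Suc n" for k t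
    proof (cases "k = n")
      case True
      then show ?thesis using periodic_multiple[of "c n" q t p] q by simp
    next
      case False
      then show ?thesis using periodic_multiple[of "c k" "int p" t "nat q"] p that by (simp add: mult.commute)
    qed
    then show ?case using p(1) q(1) by (intro exI[of _ "p * nat q"]) auto
  qed (auto intro: exI[of _ 1])
  from this[of "Suc D"] show ?thesis by (auto simp: less_Suc_eq_le)
qed

lemma quasipolynomial_leading_limit:
  assumes Q: "quasipolynomial D c Q" and \<tau>: "filterlim \<tau> at_top sequentially" "\<And>i. \<tau> i > (0 :: nat)"
    and per: "\<And>i k. k \<le> D \<Longrightarrow> c k (int (\<tau> i)) = c k t"
  shows "(\<lambda>i. Q (int (\<tau> i)) / real (\<tau> i) ^ D) \<longlonglongrightarrow> c D t"
proof -
  have inv: "(\<lambda>i. inverse (real (\<tau> i))) \<longlonglongrightarrow> 0"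
    using filterlim_compose[OF filterlim_real_sequentially \<tau>(1)] by (rule tendsto_inverse_0_at_top)
  have "Q (int (\<tau> i)) / real (\<tau> i) ^ D = (\<Sum>k\<le>D. c k t * inverse (real (\<tau> i)) ^ (D - k))" for i
  proof -
    have "Q (int (\<tau> i)) / real (\<tau> i) ^ D = (\<Sum>k\<le>D. c k (int (\<tau> i)) * real (\<tau> i) ^ k / real (\<tau> i) ^ D)"
      using Q by (simp add: quasipolynomial_def sum_divide_distrib)
    also have "\<dots> = (\<Sum>k\<le>D. c k t * inverse (real (\<tau> i)) ^ (D - k))"
    proof (rule sum.cong[OF refl])
      fix k assume "k \<in> {..D}"
      then have k: "k \<le> D" by simp
      have "real (\<tau> i) ^ D = real (\<tau> i) ^ k * real (\<tau> i) ^ (D - k)" using k by (simp flip: power_add)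
      then show "c k (int (\<tau> i)) * real (\<tau> i) ^ k / real (\<tau> i) ^ D = c k t * inverse (real (\<tau> i)) ^ (D - k)"
        using per[OF k] \<tau>(2)[of i] by (simp add: field_simps power_inverse)
    qed
    finally show ?thesis .
  qed
  \<comment> \<open>The limit uses \<open>0 ^ 0 = 1\<close>: only the summand \<open>k = D\<close>
    survives.\<close>
  moreover have "(\<lambda>i. \<Sum>k\<le>D. c k t * inverse (real (\<tau> i)) ^ (D - k)) \<longlonglongrightarrow> (\<Sum>k\<le>D. c k t * 0 ^ (D - k))"
    by (intro tendsto_intros inv)
  moreover have "(\<Sum>k\<le>D. c k t * 0 ^ (D - k)) = (\<Sum>k\<le>D. if k = D then c k t else 0)"
    by (rule sum.cong) auto
  ultimately show ?thesis by simp
qed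

text \<open>Adding \<open>of_int m *\<^sub>R (real N *\<^sub>R v)\<close> to a lattice point at
  level \<open>t\<close> gives one at level \<open>t + N m\<close>; dividing by the new level is an
  affine combination of \<open>x\<close> and \<open>v\<close>. Level 0 has to be treated apart, and
  there the origin is the lattice point.\<close>

lemma meets_lattice_periodic:
  fixes s :: "(real ^ 'n) set"
  assumes s: "affine s" and v: "v \<in> s" "real N *\<^sub>R v \<in> integer_points"
    and x: "\<exists>x\<in>s. of_int t *\<^sub>R x \<in> integer_points"
  shows "\<exists>x\<in>s. of_int (t + int N * m) *\<^sub>R x \<in> integer_points"
proof (cases "t + int N * m = 0")
  case True
  then show ?thesis using v(1) by (intro bexI[of _ v]) (auto simp: integer_points_0 simp del: of_int_add of_int_mult)
next
  case False
  obtain x where x: "x \<in> s" "of_int t *\<^sub>R x \<in> integer_points" using x by auto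
  define t' where "t' = real_of_int (t + int N * m)"
  have t': "t' \<noteq> 0" "t' = of_int t + real N * of_int m" using False by (auto simp: t'_def) (metis of_int_eq_0_iff of_int_add of_int_mult of_int_of_nat_eq)
  define y where "y = (of_int t / t') *\<^sub>R x + (real N * of_int m / t') *\<^sub>R v"
  have "of_int t / t' + real N * of_int m / t' = 1" using t' by (simp flip: add_divide_distrib)
  then have "y \<in> s" unfolding y_def using s x(1) v(1) by (simp add: mem_affine)
  moreover have "t' *\<^sub>R y = of_int t *\<^sub>R x + of_int m *\<^sub>R (real N *\<^sub>R v)"
    using t'(1) by (simp add: y_def scaleR_add_right mult.commute)
  then have "t' *\<^sub>R y \<in> integer_points" using x(2) v(2) by (simp add: integer_points_add integer_points_scale del: scaleR_scaleR)
  ultimately show ?thesis unfolding t'_def by blast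
qed

text \<open>Along a sequence in the class of \<open>t\<close>, both the coefficients and the
  question whether the dilated affine hull meets the lattice are constant. The limit of the
  normalized count is then the coefficient on one side and the volume, or 0 for an empty count, on
  the other.\<close>

theorem open_count_leading_coefficient:
  fixes P :: "(real ^ 'n) set"
  assumes P: "rational_polytope P" and D: "D = nat (aff_dim P)"
    and distinct: "\<And>j k. j \<noteq> k \<Longrightarrow> \<exists>x\<in>P. x $ j \<noteq> x $ k"
    and Q: "quasipolynomial D c Q" and count: "\<And>t::nat. t > 0 \<Longrightarrow> Q (int t) = real (open_count P t)"
  shows "c D t = (if \<exists>x\<in>affine hull P. of_int t *\<^sub>R x \<in> integer_points then lattice_volume P else 0)"
proof -
  let ?g = "\<lambda>t :: int. \<exists>x\<in>affine hull P. of_int t *\<^sub>R x \<in> integer_points"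
  obtain q where q: "q > 0" "\<And>k t. k \<le> D \<Longrightarrow> c k (t + int q) = c k t"
    using quasipolynomial_common_period[OF Q] by blast
  obtain V where V: "finite V" "V \<noteq> {}" "\<forall>v\<in>V. \<forall>i. v $ i \<in> \<rat>" "P = convex hull V"
    using rational_polytope_vertices[OF P] by blast
  obtain v where v: "v \<in> V" using V by auto
  obtain N where N: "N > 0" "\<forall>v\<in>V. real N *\<^sub>R v \<in> integer_points" using common_denominator[OF V(1)] V(3) by auto
  have vs: "v \<in> affine hull P" unfolding V(4) using v by (simp add: hull_inc affine_hull_convex_hull)
  have vN: "real N *\<^sub>R v \<in> integer_points" using N(2) v by blast
  \<comment> \<open>A multiple of \<open>q * N\<close> preserves both the period of the coefficients
    and that of the lattice condition; the summand \<open>\<bar>t\<bar> + 1\<close> makes the values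
    positive and unbounded even for negative \<open>t\<close>.\<close>
  define \<tau> where "\<tau> = (\<lambda>i. nat (t + int (q * N) * (int i + \<bar>t\<bar> + 1)))"
  have "1 \<le> q * N" using q(1) N(1) by (simp add: Suc_le_eq)
  then have qN: "1 \<le> int (q * N)" by linarith
  have ge: "int i < t + int (q * N) * (int i + \<bar>t\<bar> + 1)" for i
  proof -
    have "int i + \<bar>t\<bar> + 1 \<le> int (q * N) * (int i + \<bar>t\<bar> + 1)"
      using mult_right_mono[OF qN, of "int i + \<bar>t\<bar> + 1"] by simp
    then show ?thesis by linarith
  qed
  have \<tau>int: "int (\<tau> i) = t + int (q * N) * (int i + \<bar>t\<bar> + 1)" for i
    unfolding \<tau>_def using ge[of i] by linarith
  have \<tau>gt: "i < \<tau> i" for i using ge[of i] \<tau>int[of i] by linarith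
  then have \<tau>pos: "\<tau> i > 0" for i by (metis gr_zeroI less_nat_zero_code)
  have \<tau>lim: "filterlim \<tau> at_top sequentially"
    using \<tau>gt by (intro filterlim_at_top_mono[OF filterlim_ident] always_eventually) (auto intro: less_imp_le)
  have per: "c k (int (\<tau> i)) = c k t" if "k \<le> D" for k i
  proof -
    have "int (\<tau> i) = t + int (nat (int N * (int i + \<bar>t\<bar> + 1))) * int q" unfolding \<tau>int by (simp add: algebra_simps)
    then show ?thesis using periodic_multiple[of "c k" "int q"] q(2)[OF that] by metis
  qed
  have gper: "?g (int (\<tau> i)) \<longleftrightarrow> ?g t" for i
  proof
    assume "?g t"
    from meets_lattice_periodic[OF affine_affine_hull vs vN this, of "int q * (int i + \<bar>t\<bar> + 1)"]
    show "?g (int (\<tau> i))" unfolding \<tau>int by (simp add: algebra_simps)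
  next
    assume "?g (int (\<tau> i))"
    from meets_lattice_periodic[OF affine_affine_hull vs vN this, of "- (int q * (int i + \<bar>t\<bar> + 1))"]
    show "?g t" unfolding \<tau>int by (simp add: algebra_simps)
  qed
  have lim: "(\<lambda>i. real (open_count P (\<tau> i)) / real (\<tau> i) ^ D) \<longlonglongrightarrow> c D t"
    using quasipolynomial_leading_limit[OF Q \<tau>lim \<tau>pos per] count[OF \<tau>pos] by simp
  show ?thesis
  proof (cases "?g t")
    case True
    then have "\<exists>x\<in>affine hull P. real (\<tau> i) *\<^sub>R x \<in> integer_points" for i using gper[of i] by simp
    from open_count_limit_lattice_volume[OF P D distinct \<tau>lim \<tau>pos this] lim
    show ?thesis using True LIMSEQ_unique by auto
  next
    case False
    have "open_count P (\<tau> i) = 0" for i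
    proof -
      have "y \<in> affine hull P" if "y \<in> rel_interior P" for y
        using that rel_interior_subset[of P] hull_subset[of P affine] by blast
      then have "integer_points \<inter> (\<lambda>y. real (\<tau> i) *\<^sub>R y) ` rel_interior P = {}"
        using False gper[of i] by auto
      then show ?thesis by (simp add: open_count_def)
    qed
    then show ?thesis using lim False LIMSEQ_unique[OF lim, of 0] by simp
  qed
qed

subsection \<open>Permutations and regions\<close>

lemma strict_mono_wellorder_ge:
  fixes f :: "'n::wellorder \<Rightarrow> 'n"
  assumes "strict_mono f"
  shows "i \<le> f i"
proof (induction i rule: less_induct)
  case (less i)
  show ?case
  proof (rule ccontr)
    assume "\<not> i \<le> f i"
    then have "f i < i" by simp
    then have "f i \<le> f (f i)" "f (f i) < f i" using less assms by (auto simp: strict_mono_def)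
    then show False by simp
  qed
qed

text \<open>Two sorting permutations differ by a strictly increasing bijection. Both it and its
  inverse lie above the identity, so it is the identity.\<close>

lemma sorting_permutation_unique:
  fixes x :: "real ^ 'n::{finite,wellorder}"
  assumes "\<tau> permutes UNIV" "strict_mono (\<lambda>i. x $ \<tau> i)" "\<tau>' permutes UNIV" "strict_mono (\<lambda>i. x $ \<tau>' i)"
  shows "\<tau> = \<tau>'"
proof
  have mono: "strict_mono (\<lambda>i. inv \<beta> (\<alpha> i))"
    if "\<alpha> permutes UNIV" "strict_mono (\<lambda>i. x $ \<alpha> i)" "\<beta> permutes UNIV" "strict_mono (\<lambda>i. x $ \<beta> i)" for \<alpha> \<beta> :: "'n \<Rightarrow> 'n"
  proof (rule strict_monoI)
    fix i j :: 'n assume "i < j"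
    then have "x $ \<beta> (inv \<beta> (\<alpha> i)) < x $ \<beta> (inv \<beta> (\<alpha> j))"
      using that by (simp add: permutes_inverses strict_mono_def)
    then show "inv \<beta> (\<alpha> i) < inv \<beta> (\<alpha> j)" using strict_mono_less[OF that(4)] by simp
  qed
  fix i
  have "i \<le> inv \<tau>' (\<tau> i)" using strict_mono_wellorder_ge[OF mono[OF assms]] .
  moreover have "inv \<tau>' (\<tau> i) \<le> inv \<tau> (\<tau>' (inv \<tau>' (\<tau> i)))"
    using strict_mono_wellorder_ge[OF mono[OF assms(3,4,1,2)]] .
  then have "inv \<tau>' (\<tau> i) \<le> i" using assms by (simp add: permutes_inverses)
  ultimately have "inv \<tau>' (\<tau> i) = i" by simp
  then show "\<tau> i = \<tau>' i" using assms by (metis permutes_inverses(1))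
qed

text \<open>The rank of a coordinate, sent through the increasing enumeration \<open>h\<close> of
  the index type, is the place of that coordinate in sorted order; the inverse of this placement
  sorts.\<close>

lemma sorting_permutation_exists:
  fixes x :: "real ^ 'n::{finite,wellorder}"
  assumes inj: "inj (\<lambda>i. x $ i)"
  shows "\<exists>\<tau>. \<tau> permutes UNIV \<and> strict_mono (\<lambda>i. x $ \<tau> i)"
proof -
  obtain h :: "nat \<Rightarrow> 'n" where h: "bij_betw h {..<card (UNIV :: 'n set)} UNIV"
      "strict_mono_on {..<card (UNIV :: 'n set)} h"
    using ex_bij_betw_strict_mono_card[of "UNIV :: 'n set"] by auto
  define rk where "rk = (\<lambda>i. card {j. x $ j < x $ i})"
  have rk_less: "rk i < rk j" if "x $ i < x $ j" for i j
    unfolding rk_def using that by (intro psubset_card_mono) auto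
  have rk_bound: "rk i \<in> {..<card (UNIV :: 'n set)}" for i
    unfolding rk_def lessThan_iff by (rule psubset_card_mono) auto
  define \<sigma> where "\<sigma> = (\<lambda>i. h (rk i))"
  have \<sigma>_less: "\<sigma> i < \<sigma> j" if "x $ i < x $ j" for i j
    unfolding \<sigma>_def using h(2) rk_less[OF that] rk_bound by (simp add: strict_mono_on_def)
  have "inj \<sigma>"
  proof (rule injI)
    fix i j assume "\<sigma> i = \<sigma> j"
    then have "\<not> x $ i < x $ j" "\<not> x $ j < x $ i" using \<sigma>_less by force+
    then have "x $ i = x $ j" by simp
    then show "i = j" using inj by (simp add: inj_def)
  qed
  then have "bij \<sigma>" by (simp add: bij_def finite_UNIV_inj_surj)
  then have perm: "\<sigma> permutes UNIV" by (intro bij_imp_permutes) auto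
  have "strict_mono (\<lambda>i. x $ inv \<sigma> i)"
  proof (rule strict_monoI, rule ccontr)
    fix i j :: 'n assume ij: "i < j" "\<not> x $ inv \<sigma> i < x $ inv \<sigma> j"
    then consider "x $ inv \<sigma> j < x $ inv \<sigma> i" | "x $ inv \<sigma> j = x $ inv \<sigma> i" by linarith
    then show False
    proof cases
      case 1
      then have "\<sigma> (inv \<sigma> j) < \<sigma> (inv \<sigma> i)" by (rule \<sigma>_less)
      then show False using ij(1) perm by (simp add: permutes_inverses)
    next
      case 2
      then have "inv \<sigma> j = inv \<sigma> i" using inj by (simp add: inj_def)
      then have "j = i" using perm by (metis permutes_inverses(1))
      then show False using ij by simp
    qed
  qed
  then show ?thesis using permutes_inv[OF perm] by blast
qed

definition order_region :: "('n::{finite,wellorder} \<Rightarrow> 'n) \<Rightarrow> (real ^ 'n::{finite,wellorder}) set" where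
  "order_region \<tau> = {y. compatible y \<tau>}"

lemma order_region_eq: "order_region \<tau> = {y. \<forall>(j, k)\<in>{(\<tau> i, \<tau> i') | i i'. i \<le> i'}. y $ j \<le> y $ k}"
  unfolding order_region_def compatible_def mono_def by auto

lemma convex_order_region: "convex (order_region \<tau>)"
  unfolding order_region_def compatible_def mono_def
  by (auto simp: convex_def intro!: add_mono mult_left_mono)

text \<open>Each inequality between two different coordinates cuts out a half-space with nonzero
  normal, and passing to the interior makes it strict.\<close>

lemma interior_order_region:
  fixes \<tau> :: "'n::{finite,wellorder} \<Rightarrow> 'n"
  assumes "\<tau> permutes UNIV"
  shows "interior (order_region \<tau>) = {y. realizes y \<tau>}"
proof
  let ?O = "\<Inter>(i, i')\<in>{(i, i'). i < i'}. {y :: (real, 'n) vec. y $ \<tau> i < y $ \<tau> i'}"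
  have eq: "{y. realizes y \<tau>} = ?O" by (auto simp: realizes_def strict_mono_def)
  have "open ?O" by (intro open_INT) (auto intro!: open_Collect_less continuous_intros)
  then show "{y. realizes y \<tau>} \<subseteq> interior (order_region \<tau>)"
    unfolding eq by (rule interior_maximal[rotated])
      (auto simp: order_region_def compatible_def mono_def le_less)
  show "interior (order_region \<tau>) \<subseteq> {y. realizes y \<tau>}"
  proof clarify
    fix y assume y: "y \<in> interior (order_region \<tau>)"
    show "realizes y \<tau>" unfolding realizes_def
    proof (rule strict_monoI)
      fix i i' :: 'n assume ii': "i < i'"
      let ?a = "axis (\<tau> i) 1 - axis (\<tau> i') 1 :: (real, 'n) vec"
      have dot: "?a \<bullet> z = z $ \<tau> i - z $ \<tau> i'" for z by (simp add: inner_diff_left inner_axis')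
      have "\<tau> i \<noteq> \<tau> i'" using assms ii' by (metis less_irrefl permutes_inverses(2))
      then have "?a \<noteq> 0" by (auto simp: axis_eq_axis)
      have "order_region \<tau> \<subseteq> {z. ?a \<bullet> z \<le> 0}"
        unfolding dot using ii' by (auto simp: order_region_def compatible_def mono_def)
      then have "y \<in> interior {z. ?a \<bullet> z \<le> 0}" using y interior_mono by blast
      then have "?a \<bullet> y < 0" using interior_halfspace_le[OF \<open>?a \<noteq> 0\<close>] by auto
      then show "y $ \<tau> i < y $ \<tau> i'" by (simp add: dot)
    qed
  qed
qed

text \<open>A point of \<open>P\<close> that realizes \<tau> is interior to the order region, and
  the relative interior of \<open>P\<close> is dense in \<open>P\<close>. Hence the two relative
  interiors meet, the relative interior of the intersection is their intersection, and no dimension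
  is lost.\<close>

lemma region_polytope:
  fixes P :: "(real ^ 'n::{finite,wellorder}) set"
  assumes P: "rational_polytope P" and \<tau>: "\<tau> permutes UNIV" "realizable_in \<tau> P"
  shows "rel_interior (P \<inter> order_region \<tau>) = rel_interior P \<inter> {y. realizes y \<tau>}"
    and "aff_dim (P \<inter> order_region \<tau>) = aff_dim P"
    and "\<exists>W. finite W \<and> W \<noteq> {} \<and> (\<forall>v\<in>W. \<forall>i. v $ i \<in> \<rat>) \<and> P \<inter> order_region \<tau> = convex hull W"
proof -
  have conv: "convex P" using P by (simp add: rational_polytope_def polytope_imp_convex)
  let ?O = "{y. realizes y \<tau>}"
  have int: "interior (order_region \<tau>) = ?O" by (rule interior_order_region[OF \<tau>(1)])
  obtain x where x: "x \<in> P" "realizes x \<tau>" using \<tau>(2) by (auto simp: realizable_in_def)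
  have ne: "?O \<noteq> {}" "P \<inter> interior (order_region \<tau>) \<noteq> {}" using x unfolding int by auto
  have rel: "rel_interior (order_region \<tau>) = ?O" using ne int rel_interior_nonempty_interior by metis
  have "open ?O" using int by (metis open_interior)
  moreover have "x \<in> closure (rel_interior P)" using x(1) convex_closure_rel_interior[OF conv] closure_subset by blast
  ultimately have "rel_interior P \<inter> ?O \<noteq> {}" using x(2) by (auto simp: closure_iff_nhds_not_empty)
  then show "rel_interior (P \<inter> order_region \<tau>) = rel_interior P \<inter> ?O"
    using convex_rel_interior_inter_two[OF conv convex_order_region] rel by simp
  show "aff_dim (P \<inter> order_region \<tau>) = aff_dim P"
    using aff_dim_convex_Int_nonempty_interior[OF conv ne(2)] .
  obtain V where V: "finite V" "V \<noteq> {}" "\<forall>v\<in>V. \<forall>i. v $ i \<in> \<rat>" "P = convex hull V"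
    using rational_polytope_vertices[OF P] by blast
  have "finite {(\<tau> i, \<tau> i') | i i'. i \<le> i'}" by (rule finite_subset[of _ UNIV]) auto
  then have "\<exists>W. finite W \<and> (\<forall>v\<in>W. \<forall>i. v $ i \<in> \<rat>) \<and> P \<inter> order_region \<tau> = convex hull W"
    unfolding order_region_eq V(4) by (rule rational_convex_hull_Int_order[OF V(1), rotated]) (use V(3) in auto)
  then obtain W where W: "finite W" "\<forall>v\<in>W. \<forall>i. v $ i \<in> \<rat>" "P \<inter> order_region \<tau> = convex hull W"
    by (elim exE conjE)
  have "P \<inter> order_region \<tau> \<noteq> {}" using ne(2) interior_subset by blast
  then have "W \<noteq> {}" using W(3) by auto
  then show "\<exists>W. finite W \<and> W \<noteq> {} \<and> (\<forall>v\<in>W. \<forall>i. v $ i \<in> \<rat>) \<and> P \<inter> order_region \<tau> = convex hull W"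
    using W by blast
qed

section \<open>Both counts as sums over realizable permutations\<close>

lemma open_count_eq_sum:
  fixes P :: "(real ^ 'n::{finite,wellorder}) set"
  assumes P: "rational_polytope P" and t: "t > 0"
  shows "open_count P t = (\<Sum>\<tau> | \<tau> permutes UNIV \<and> realizable_in \<tau> P.
    card (integer_points \<inter> (\<lambda>y. real t *\<^sub>R y) ` rel_interior (P \<inter> order_region \<tau>)))"
proof -
  let ?T = "{\<tau> :: 'n \<Rightarrow> 'n. \<tau> permutes UNIV \<and> realizable_in \<tau> P}"
  let ?X = "\<lambda>\<tau>. integer_points \<inter> (\<lambda>y. real t *\<^sub>R y) ` rel_interior (P \<inter> order_region \<tau>)"
  have finT: "finite ?T" using finite_permutations[of "UNIV :: 'n set"] by (rule rev_finite_subset) auto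
  have scale: "realizes (real t *\<^sub>R y) \<tau> \<longleftrightarrow> realizes y \<tau>" for y \<tau>
    using t by (simp add: realizes_def strict_mono_def)
  have X: "?X \<tau> = {x \<in> integer_points \<inter> (\<lambda>y. real t *\<^sub>R y) ` rel_interior P. realizes x \<tau>}" if "\<tau> \<in> ?T" for \<tau>
    using region_polytope(1)[OF P, of \<tau>] that scale by auto
  have bdd: "bounded P" using P by (simp add: rational_polytope_def polytope_imp_bounded)
  have fin: "finite (?X \<tau>)" for \<tau>
    by (intro finite_bounded_integer_points bounded_scaling bounded_subset[OF bdd])
      (use rel_interior_subset in blast)
  \<comment> \<open>A point with distinct coordinates belongs to the piece of its sorting
    permutation, which is realizable because the rescaled point lies in \<open>P\<close>.\<close>
  have "{x \<in> integer_points \<inter> (\<lambda>y. real t *\<^sub>R y) ` rel_interior P. inj (\<lambda>i. x $ i)} = (\<Union>\<tau>\<in>?T. ?X \<tau>)"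
  proof (intro equalityI subsetI)
    fix x assume x: "x \<in> {x \<in> integer_points \<inter> (\<lambda>y. real t *\<^sub>R y) ` rel_interior P. inj (\<lambda>i. x $ i)}"
    then obtain \<tau> where \<tau>: "\<tau> permutes UNIV" "realizes x \<tau>"
      using sorting_permutation_exists[of x] by (auto simp: realizes_def)
    obtain y where y: "y \<in> rel_interior P" "x = real t *\<^sub>R y" using x by auto
    have "realizable_in \<tau> P" unfolding realizable_in_def
      using y \<tau>(2) scale rel_interior_subset by blast
    then have T: "\<tau> \<in> ?T" using \<tau> by simp
    then have "x \<in> ?X \<tau>" using X[OF T] x \<tau>(2) by simp
    then show "x \<in> (\<Union>\<tau>\<in>?T. ?X \<tau>)" using T by blast
  next
    fix x assume "x \<in> (\<Union>\<tau>\<in>?T. ?X \<tau>)"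
    then obtain \<tau> where \<tau>: "\<tau> \<in> ?T" "x \<in> ?X \<tau>" by blast
    then have x: "x \<in> integer_points \<inter> (\<lambda>y. real t *\<^sub>R y) ` rel_interior P" "realizes x \<tau>"
      using X by auto
    have perm: "\<tau> permutes UNIV" using \<tau>(1) by simp
    have "inj (\<lambda>i. x $ i)"
    proof (rule injI)
      fix i j assume "x $ i = x $ j"
      then have "x $ \<tau> (inv \<tau> i) = x $ \<tau> (inv \<tau> j)" using perm by (simp add: permutes_inverses)
      then have "inv \<tau> i = inv \<tau> j" using x(2) strict_mono_eq unfolding realizes_def by blast
      then show "i = j" using perm by (metis permutes_inverses(1))
    qed
    then show "x \<in> {x \<in> integer_points \<inter> (\<lambda>y. real t *\<^sub>R y) ` rel_interior P. inj (\<lambda>i. x $ i)}"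
      using x(1) by simp
  qed
  then have "open_count P t = card (\<Union>\<tau>\<in>?T. ?X \<tau>)" by (simp add: open_count_def)
  also have "\<dots> = (\<Sum>\<tau>\<in>?T. card (?X \<tau>))"
  proof (rule card_UN_disjoint[OF finT])
    show "\<forall>\<tau>\<in>?T. finite (?X \<tau>)" using fin by blast
    show "\<forall>\<tau>\<in>?T. \<forall>\<tau>'\<in>?T. \<tau> \<noteq> \<tau>' \<longrightarrow> ?X \<tau> \<inter> ?X \<tau>' = {}"
    proof (intro ballI impI equals0I)
      fix \<tau> \<tau>' x assume *: "\<tau> \<in> ?T" "\<tau>' \<in> ?T" "\<tau> \<noteq> \<tau>'" "x \<in> ?X \<tau> \<inter> ?X \<tau>'"
      then have "realizes x \<tau>" "realizes x \<tau>'" using X by auto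
      then show False using sorting_permutation_unique[of \<tau> x \<tau>'] * by (auto simp: realizes_def)
    qed
  qed
  finally show ?thesis .
qed

text \<open>The closed pieces overlap where coordinates coincide. A pair remembers the piece along
  with the point, so the pairs are the disjoint union of the pieces.\<close>

lemma closed_count_eq_sum:
  fixes P :: "(real ^ 'n::{finite,wellorder}) set"
  assumes P: "rational_polytope P" and t: "t > 0"
  shows "closed_count P t = (\<Sum>\<tau> | \<tau> permutes UNIV \<and> realizable_in \<tau> P.
    card (integer_points \<inter> (\<lambda>y. real t *\<^sub>R y) ` (P \<inter> order_region \<tau>)))"
proof -
  let ?T = "{\<tau> :: 'n \<Rightarrow> 'n. \<tau> permutes UNIV \<and> realizable_in \<tau> P}"
  let ?X = "\<lambda>\<tau>. integer_points \<inter> (\<lambda>y. real t *\<^sub>R y) ` (P \<inter> order_region \<tau>)"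
  have finT: "finite ?T" using finite_permutations[of "UNIV :: 'n set"] by (rule rev_finite_subset) auto
  have bdd: "bounded P" using P by (simp add: rational_polytope_def polytope_imp_bounded)
  have fin: "finite (?X \<tau>)" for \<tau>
    by (intro finite_bounded_integer_points bounded_scaling bounded_subset[OF bdd]) blast
  have "compatible (real t *\<^sub>R y) \<tau> \<longleftrightarrow> compatible y \<tau>" for y :: "(real, 'n) vec" and \<tau>
    using t by (simp add: compatible_def mono_def)
  then have "{(x, \<sigma>). x \<in> integer_points \<inter> (\<lambda>y. real t *\<^sub>R y) ` P \<and>
      \<sigma> permutes UNIV \<and> compatible x \<sigma> \<and> realizable_in \<sigma> P} = prod.swap ` Sigma ?T ?X"
    by (force simp: order_region_def)
  then have "closed_count P t = card (Sigma ?T ?X)"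
    by (simp add: closed_count_def card_image)
  then show ?thesis using finT fin by (simp add: card_SigmaI)
qed

text \<open>Dilates of \<open>s\<close> without integer points have count 0, so the leading
  coefficient equals the volume only for those \<open>t\<close> whose dilate meets the lattice.
  \<open>R\<close> is the closed count as a quasipolynomial; its degree-zero coefficient is itself
  periodic, and the constant term is its value at \<open>t = 0\<close>.\<close>

theorem theorem3p1:
  fixes P s :: "(real ^ 'n::{finite,wellorder}) set" and D :: nat
  assumes "rational_polytope P"
    and "transverse_to P complete_graph_arrangement"
    and "s = affine hull P"
    and "D = nat (aff_dim s)"
  shows "\<exists>Q c R e.
    quasipolynomial D c Q \<and>
    (\<forall>t::nat. t > 0 \<longrightarrow> Q (int t) = real (open_count P t)) \<and>
    (\<forall>t. c D t = (if \<exists>x\<in>s. of_int t *\<^sub>R x \<in> integer_points then lattice_volume P else 0)) \<and>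
    (\<forall>t::nat. t > 0 \<longrightarrow> (-1) ^ D * Q (- int t) = real (closed_count P t)) \<and>
    quasipolynomial D e R \<and>
    (\<forall>t::nat. t > 0 \<longrightarrow> R (int t) = real (closed_count P t)) \<and>
    e 0 0 = real (card {\<tau>. \<tau> permutes (UNIV :: 'n set) \<and> realizable_in \<tau> P})"
proof -
  let ?T = "{\<tau> :: 'n \<Rightarrow> 'n. \<tau> permutes UNIV \<and> realizable_in \<tau> P}"
  note P = assms(1)
  have D: "D = nat (aff_dim P)" using assms(3,4) by simp
  have finT: "finite ?T" using finite_permutations[of "UNIV :: 'n set"] by (rule rev_finite_subset) auto
  have ex: "\<exists>Q. (\<exists>c. quasipolynomial D c Q) \<and>
    (\<forall>t::nat. t > 0 \<longrightarrow> Q (int t) =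
       real (card (integer_points \<inter> (\<lambda>y. real t *\<^sub>R y) ` rel_interior (P \<inter> order_region \<tau>)))) \<and>
    (\<forall>t::nat. t > 0 \<longrightarrow> (-1) ^ D * Q (- int t) =
       real (card (integer_points \<inter> (\<lambda>y. real t *\<^sub>R y) ` (P \<inter> order_region \<tau>)))) \<and>
    (-1) ^ D * Q 0 = 1" if \<tau>: "\<tau> \<in> ?T" for \<tau>
  proof -
    obtain W where W: "finite W" "W \<noteq> {}" "\<forall>v\<in>W. \<forall>i. v $ i \<in> \<rat>" "P \<inter> order_region \<tau> = convex hull W"
      using region_polytope(3)[OF P, of \<tau>] \<tau> by auto
    \<comment> \<open>All pieces have the dimension of \<open>P\<close>, so the reciprocity sign is
      the same for each and can be taken out of the sum.\<close>
    have "D = nat (aff_dim W)" using region_polytope(2)[OF P, of \<tau>] \<tau> D W(4) by (simp add: aff_dim_convex_hull)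
    from ehrhart_reciprocity[OF W(1,2) _ this] W(3) show ?thesis unfolding W(4) by blast
  qed
  obtain q where "\<forall>\<tau>\<in>?T. (\<exists>c. quasipolynomial D c (q \<tau>)) \<and>
    (\<forall>t::nat. t > 0 \<longrightarrow> q \<tau> (int t) =
       real (card (integer_points \<inter> (\<lambda>y. real t *\<^sub>R y) ` rel_interior (P \<inter> order_region \<tau>)))) \<and>
    (\<forall>t::nat. t > 0 \<longrightarrow> (-1) ^ D * q \<tau> (- int t) =
       real (card (integer_points \<inter> (\<lambda>y. real t *\<^sub>R y) ` (P \<inter> order_region \<tau>)))) \<and>
    (-1) ^ D * q \<tau> 0 = 1"
    using bchoice[OF ballI[OF ex]] by (rule exE)
  note q = conjunct1[OF bspec[OF this]] conjunct2[OF bspec[OF this]]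
  define Q where "Q = (\<lambda>t. \<Sum>\<tau>\<in>?T. q \<tau> t)"
  obtain c where c: "quasipolynomial D c Q"
    unfolding Q_def using quasipolynomial_sum[OF finT, of D q] q(1) by blast
  have open_Q: "Q (int t) = real (open_count P t)" if "t > 0" for t
    unfolding Q_def open_count_eq_sum[OF P that] of_nat_sum by (rule sum.cong[OF refl]) (use q(2) that in blast)
  have closed_Q: "(-1) ^ D * Q (- int t) = real (closed_count P t)" if "t > 0" for t
    unfolding Q_def closed_count_eq_sum[OF P that] of_nat_sum sum_distrib_left
    by (rule sum.cong[OF refl]) (use q(2) that in blast)
  have Q0: "(-1) ^ D * Q 0 = real (card ?T)"
    unfolding Q_def sum_distrib_left using q(2) by simp
  have "\<exists>x\<in>P. x $ j \<noteq> x $ k" if "j \<noteq> k" for j k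
  proof -
    \<comment> \<open>The arrangement names each hyperplane by an increasing pair of
      indices.\<close>
    have "{x. x $ min j k = x $ max j k} \<in> (complete_graph_arrangement :: ((real, 'n) vec) set set)"
      unfolding complete_graph_arrangement_def using that by (intro CollectI exI[of _ "min j k"] exI[of _ "max j k"]) (auto simp: min_def max_def)
    then have "\<not> P \<subseteq> {x. x $ min j k = x $ max j k}" using assms(2) by (auto simp: transverse_to_def)
    then show ?thesis by (auto simp: min_def max_def split: if_splits)
  qed
  \<comment> \<open>Read off from the total count on \<open>P\<close>, so that volumes of pieces
    need not be added.\<close>
  then have lead: "c D t = (if \<exists>x\<in>s. of_int t *\<^sub>R x \<in> integer_points then lattice_volume P else 0)" for t
    unfolding assms(3) using open_count_leading_coefficient[OF P D _ c open_Q] by blast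
  define R where "R = (\<lambda>t. (-1) ^ D * Q (- t))"
  \<comment> \<open>The factor \<open>(-1) ^ i\<close> comes from the power
    \<open>(- t) ^ i\<close>, the factor \<open>(-1) ^ D\<close> from reciprocity.\<close>
  define e where "e = (\<lambda>i t. (-1) ^ D * (-1) ^ i * c i (- t))"
  have "quasipolynomial D e R" unfolding quasipolynomial_def
  proof (intro conjI allI impI)
    fix i assume "i \<le> D"
    then have "\<exists>p>0. \<forall>t. c i (t + p) = c i t" using c by (simp add: quasipolynomial_def)
    then obtain p where p: "p > 0" "\<And>t. c i (t + p) = c i t" by blast
    have "e i (t + p) = e i t" for t using p(2)[of "- (t + p)"] by (simp add: e_def)
    then show "\<exists>p>0. \<forall>t. e i (t + p) = e i t" using p(1) by blast
  next
    fix t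
    have "R t = (\<Sum>i\<le>D. (-1) ^ D * (c i (- t) * of_int (- t) ^ i))"
      using c by (simp add: R_def quasipolynomial_def sum_distrib_left)
    also have "\<dots> = (\<Sum>i\<le>D. e i t * of_int t ^ i)"
    proof (rule sum.cong[OF refl])
      fix i
      have "(of_int (- t) :: real) ^ i = (-1) ^ i * of_int t ^ i" by (simp flip: power_mult_distrib)
      then show "(-1) ^ D * (c i (- t) * of_int (- t) ^ i) = e i t * of_int t ^ i" by (simp add: e_def)
    qed
    finally show "R t = (\<Sum>i\<le>D. e i t * of_int t ^ i)" .
  qed
  moreover have "R (int t) = real (closed_count P t)" if "t > 0" for t
    using closed_Q[OF that] by (simp add: R_def)
  moreover have "e 0 0 = real (card ?T)"
  proof -
    have "Q 0 = (\<Sum>i\<le>D. c i 0 * 0 ^ i)" using c by (simp add: quasipolynomial_def)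
    also have "\<dots> = (\<Sum>i\<le>D. if i = 0 then c i 0 else 0)" by (rule sum.cong) auto
    finally have "Q 0 = c 0 0" by simp
    then show ?thesis using Q0 by (simp add: e_def)
  qed
  ultimately show ?thesis using c open_Q closed_Q lead by blast
qed

end
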